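(* For every constant $c>0$ there is a constant $C>0$ depending only on $c$ such that the following holds. Let $p$ be a prime, let $P\subseteq\mathbb{F}_{p^2}\times\mathbb{F}_{p^2}$ with $|P|=n$, and let $A=\{x:(x,y)\in P\}$. Let $t$ be a defining element of $\mathbb{F}_{p^2}$ over $\mathbb{F}_p$, so that $\mathbb{F}_{p^2}=\mathbb{F}_p+t\mathbb{F}_p$. Suppose that $|A|\leq c\,p$ and that $A=\bigcup_{j\in J}A_j$, where $J\subseteq\mathbb{F}_p$ satisfies $|J|\leq c\max\left\{p^{\frac12},n^{\frac{2560}{6419}}\right\}$, and, for each $j\in J$, $A_j\subseteq\mathbb{F}_p+jt$ with $|A_j|\leq c\max\left\{p^{\frac12},n^{\frac{2560}{6419}}\right\}$. Then $$I(P,L)\leq C\,n^{\frac32-\frac{1}{12838}}$$ for all sets of lines $L$ in $\mathbb{F}_{p^2}\times\mathbb{F}_{p^2}$ with $|L|=n$.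
   Context: For sets $P$ of points and $L$ of lines in the plane $F\times F$ over a field $F$, $I(P,L)=|\{(p,l)\in P\times L: p\in l\}|$ is the number of incidences. For $j\in\mathbb{F}_p$, $\mathbb{F}_p+jt=\{x+jt:x\in\mathbb{F}_p\}$. *)

theory Defs
  imports Complex_Main "HOL-Computational_Algebra.Primes" "HOL-Algebra.Generated_Fields"
begin

text \<open>
  Finite fields are records of HOL-Algebra rather than instances of a type class: a constant that is
  uniform over all finite fields cannot be stated when each field is a type of its own. Over an infinite carrier type such as \<open>nat\<close>, the records include
  an isomorphic copy of every finite field.
\<close>

definition lines :: "('a, 'b) ring_scheme \<Rightarrow> ('a \<times> 'a) set set" where
  "lines F = {l. \<exists>a\<in>carrier F. \<exists>b\<in>carrier F. \<exists>d\<in>carrier F.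
     (a \<noteq> \<zero>\<^bsub>F\<^esub> \<or> b \<noteq> \<zero>\<^bsub>F\<^esub>) \<and>
     l = {(x, y) \<in> carrier F \<times> carrier F. a \<otimes>\<^bsub>F\<^esub> x \<oplus>\<^bsub>F\<^esub> b \<otimes>\<^bsub>F\<^esub> y = d}}"

definition incidences :: "('a \<times> 'a) set \<Rightarrow> ('a \<times> 'a) set set \<Rightarrow> nat" where
  "incidences P L = card {(q, l) \<in> P \<times> L. q \<in> l}"

definition defining_element :: "('a, 'b) ring_scheme \<Rightarrow> 'a set \<Rightarrow> 'a \<Rightarrow> bool" where
  "defining_element F K t \<longleftrightarrow> t \<in> carrier F \<and> generate_field F (insert t K) = carrier F"

text \<open>In degree two this is the decomposition \<open>F = K + t K\<close>.\<close>

lemma defining_element_iff: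
  fixes F (structure)
  assumes "field F" and sub: "subfield K F" and cK: "card K = p" and cF: "order F = p\<^sup>2" and p: "p > 1"
  shows "defining_element F K t \<longleftrightarrow> t \<in> carrier F \<and> carrier F = K <+>\<^bsub>F\<^esub> (t <#\<^bsub>F\<^esub> K)"
proof -
  interpret field F by fact
  note K = subringE[OF subfieldE(1)[OF sub]]
  have Kc: "\<And>x. x \<in> K \<Longrightarrow> x \<in> carrier F" using K(1) by blast
  have decomp: "K <+>\<^bsub>F\<^esub> (t <#\<^bsub>F\<^esub> K) = (\<lambda>(x, y). x \<oplus> t \<otimes> y) ` (K \<times> K)" for t
    unfolding set_add_defs l_coset_def by (auto simp: image_def)
  have finF: "finite (carrier F)" using cF p unfolding order_def
    by (metis card.infinite power_eq_0_iff not_one_less_zero)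
  show ?thesis
  proof (cases "t \<in> carrier F")
    case t: True
    have gsub: "generate_field F (insert t K) \<subseteq> carrier F"
      by (rule generate_field_incl) (use t K(1) in auto)
    show ?thesis
    proof
      assume d: "defining_element F K t"
      have "t \<notin> K"
      proof
        assume "t \<in> K"
        then have "generate_field F (insert t K) \<subseteq> K"
          by (intro generate_field_min_subfield1[OF _ sub]) (use t K(1) in auto)
        then have "carrier F = K" using d K(1) by (auto simp: defining_element_def)
        then show False using cK cF p by (simp add: order_def power2_eq_square)
      qed
      have inj: "inj_on (\<lambda>(x, y). x \<oplus> t \<otimes> y) (K \<times> K)"
      proof (rule inj_onI, clarify)
        fix x y x' y' assume k: "x \<in> K" "y \<in> K" "x' \<in> K" "y' \<in> K"
          and e: "x \<oplus> t \<otimes> y = x' \<oplus> t \<otimes> y'"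
        note kc = k[THEN Kc]
        have e': "(y \<ominus> y') \<otimes> t = x' \<ominus> x"
        proof -
          have "(y \<ominus> y') \<otimes> t = (x \<oplus> t \<otimes> y) \<ominus> (x \<oplus> t \<otimes> y')"
            using kc t by algebra
          also have "\<dots> = x' \<ominus> x" unfolding e using kc t by algebra
          finally show ?thesis .
        qed
        have dif: "y \<ominus> y' \<in> K" "x' \<ominus> x \<in> K"
          using k K(5,7) unfolding a_minus_def by auto
        have yy: "y \<ominus> y' = \<zero>"
        proof (rule ccontr)
          assume "y \<ominus> y' \<noteq> \<zero>"
          then have "t \<in> K"
            using subfield_m_inv_simprule[OF sub, of "y \<ominus> y'" t] dif t e' by auto
          then show False using \<open>t \<notin> K\<close> by blast
        qed
        then have "y = y'" using kc by auto
        moreover have "x' \<ominus> x = \<zero>" using e' yy t by simp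
        then have "x = x'" using kc by auto
        ultimately show "x = x' \<and> y = y'" by simp
      qed
      have "card (K <+>\<^bsub>F\<^esub> (t <#\<^bsub>F\<^esub> K)) = card (carrier F)"
        unfolding decomp card_image[OF inj] card_cartesian_product
        using cK cF by (simp add: order_def power2_eq_square)
      moreover have "K <+>\<^bsub>F\<^esub> (t <#\<^bsub>F\<^esub> K) \<subseteq> carrier F"
        unfolding decomp using Kc t by auto
      ultimately show "t \<in> carrier F \<and> carrier F = K <+>\<^bsub>F\<^esub> (t <#\<^bsub>F\<^esub> K)"
        using card_subset_eq[OF finF] t by metis
    next
      assume h: "t \<in> carrier F \<and> carrier F = K <+>\<^bsub>F\<^esub> (t <#\<^bsub>F\<^esub> K)"
      have "carrier F \<subseteq> generate_field F (insert t K)"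
      proof
        fix z assume "z \<in> carrier F"
        then obtain x y where "x \<in> K" "y \<in> K" "z = x \<oplus> t \<otimes> y"
          using h unfolding decomp by auto
        then show "z \<in> generate_field F (insert t K)"
          by (metis generate_field.eng_add generate_field.eng_mult generate_field.incl insertCI)
      qed
      then show "defining_element F K t" using t gsub by (auto simp: defining_element_def)
    qed
  qed (simp add: defining_element_def)
qed

end

theory Submission
  imports Defs "HOL-Analysis.Convex"
begin

text \<open>
  Suppose \<open>I(P, L) \<ge> n\<^bsup>3/2 - \<epsilon>\<^esup>\<close> with \<open>\<epsilon> = 1/12838\<close>, and write \<open>N = n\<^bsup>1/2\<^esup>\<close>, \<open>K = n\<^bsup>\<epsilon>\<^esup>\<close>. If \<open>N \<ge> p K\<close>, the second
  moment of the degrees over the whole plane gives a contradiction. Otherwise some line \<open>l\<close> contains points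
  \<open>q\<^sub>0\<close>, \<open>q\<^sub>1\<close> and about \<open>N\<close> further points \<open>q\<close> of \<open>P\<close> such that about \<open>N\<^sup>2\<close> points of \<open>P\<close> are joined by lines of \<open>L\<close>
  to all of \<open>q\<^sub>0\<close>, \<open>q\<^sub>1\<close>, \<open>q\<close>. Sending \<open>l\<close> to infinity, the pencils at \<open>q\<^sub>0\<close>, \<open>q\<^sub>1\<close> become coordinates \<open>u \<in> U\<close>, \<open>v \<in> V\<close>, and the
  pencil at \<open>q\<close> becomes \<open>u + r v\<close>, where \<open>r = (x - x\<^sub>0) / (x\<^sub>1 - x)\<close> in terms of the abscissae. So \<open>U + r V\<close> is small
  along a dense graph for many \<open>r\<close>. One application of the Balog--Szemeredi--Gowers argument yields a large \<open>W \<subseteq> V\<close> and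
  a large set \<open>S\<close> of ratios \<open>r / r'\<close> such that \<open>W - s W\<close> is small for all \<open>s \<in> S\<close>.

  By Ruzsa covering and Petridis' form of Pluennecke's inequality, \<open>W - z W\<close> is small for every polynomial \<open>z\<close> of bounded
  complexity in the elements of \<open>S\<close>, whereas double counting shows that only about \<open>|W|\<close> elements \<open>z\<close> have this
  property. Hence \<open>(S - S) / (S - S)\<close> is stable under \<open>b \<mapsto> \<rho> b + \<sigma>\<close> for \<open>\<rho>, \<sigma> \<in> S\<close>, so it is a subfield, and this subfield
  has at most about \<open>N\<close> elements. Therefore it is the prime field and the abscissae lie on a circle (a
  Moebius image of the projective line over the prime field). A circle with three points in a coset of the prime
  field lies in that coset, so it has at most \<open>max (2 |J|) (max |A\<^sub>j|)\<close> points in \<open>A\<close>, which is too few.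

  All constants are absorbed in powers of \<open>b = n\<^bsup>1/128380\<^esup>\<close>, so \<open>N = b\<^bsup>64190\<^esup>\<close> and \<open>K = b\<^bsup>10\<^esup>\<close>.
\<close>

subsection \<open>Sumsets in a ring\<close>

text \<open>Three obstacles shape the argument. A separate Balog--Szemeredi--Gowers step for each
  \<open>r\<close> would yield unrelated subsets of \<open>V\<close>. So \<open>V\<close> is first
  cut down to elements whose degree is large on average over \<open>r\<close>, and the
  \<open>W\<close> found for one \<open>r\<close> still meets the graphs of many others. Smallness
  of \<open>W - z W\<close> is awkward to carry through sums of multipliers; it is exchanged for
  coverings of \<open>z W\<close> by translates of \<open>j W - j W\<close> and converted back once.
  Finally, a subfield other than the prime field has at least \<open>p^2\<close> elements, which
  \<open>N < p K\<close> rules out; in the range \<open>N >= p K\<close>, the bound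
  \<open>|A| <= c p\<close> forces \<open>n <= c p^3\<close>, which makes the expected count
  \<open>n^2 / p^2\<close> harmless.

  The exponents fit because \<open>N = K^6419\<close>, whereas the cost
  \<open>k = (2^29 / a^15)^31\<close> of the field step stays below \<open>K^5630\<close>. Here
  \<open>a\<close> is about \<open>K^-12\<close>, 15 is the loss of the graph step, and 31 = 18 + 13
  pays for six products of three factors and one use of Pluennecke. In the same scale
  \<open>n^(2560/6419)\<close> is \<open>K^5120\<close>.

  The coordinates at infinity are computed from slopes, so vertical lines are split off at the very
  end.\<close>

definition diff_set :: "('a, 'b) ring_scheme \<Rightarrow> 'a set \<Rightarrow> 'a set \<Rightarrow> 'a set" where
  "diff_set G A B = (\<lambda>(a, b). a \<ominus>\<^bsub>G\<^esub> b) ` (A \<times> B)"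

fun iter_sum :: "('a, 'b) ring_scheme \<Rightarrow> 'a set \<Rightarrow> nat \<Rightarrow> 'a set" where
  "iter_sum G A 0 = {\<zero>\<^bsub>G\<^esub>}"
| "iter_sum G A (Suc n) = A <+>\<^bsub>G\<^esub> iter_sum G A n"

lemma mem_set_add: "x \<in> A <+>\<^bsub>G\<^esub> B \<longleftrightarrow> (\<exists>a\<in>A. \<exists>b\<in>B. x = a \<oplus>\<^bsub>G\<^esub> b)"
  unfolding set_add_defs by auto

lemma set_add_image: "A <+>\<^bsub>G\<^esub> B = (\<lambda>(a, b). a \<oplus>\<^bsub>G\<^esub> b) ` (A \<times> B)"
  unfolding set_add_defs by auto

lemma set_add_mono: "A \<subseteq> A' \<Longrightarrow> B \<subseteq> B' \<Longrightarrow> A <+>\<^bsub>G\<^esub> B \<subseteq> A' <+>\<^bsub>G\<^esub> B'"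
  unfolding set_add_image by (intro image_mono) auto

lemma finite_set_add: "finite A \<Longrightarrow> finite B \<Longrightarrow> finite (A <+>\<^bsub>G\<^esub> B)"
  unfolding set_add_image by auto

lemma finite_diff_set: "finite A \<Longrightarrow> finite B \<Longrightarrow> finite (diff_set G A B)"
  unfolding diff_set_def by auto

lemma finite_iter_sum: "finite A \<Longrightarrow> finite (iter_sum G A n)"
  by (induction n) (auto intro: finite_set_add)

lemma card_set_add_le:
  assumes "finite A" "finite B"
  shows "card (A <+>\<^bsub>G\<^esub> B) \<le> card A * card B"
  unfolding set_add_image using card_image_le[of "A \<times> B"] assms
  by (simp add: card_cartesian_product)

context ring
begin

lemma diff_set_closed: "A \<subseteq> carrier R \<Longrightarrow> B \<subseteq> carrier R \<Longrightarrow> diff_set R A B \<subseteq> carrier R"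
  unfolding diff_set_def by auto

lemma iter_sum_closed: "A \<subseteq> carrier R \<Longrightarrow> iter_sum R A n \<subseteq> carrier R"
  by (induction n) (auto simp: mem_set_add subset_iff)

lemma iter_sum_add:
  assumes A: "A \<subseteq> carrier R" and "x \<in> iter_sum R A i" "y \<in> iter_sum R A j"
  shows "x \<oplus> y \<in> iter_sum R A (i + j)"
  using assms(2,3)
proof (induction i arbitrary: x)
  case 0
  then show ?case using iter_sum_closed[OF A, of j] by auto
next
  case (Suc i)
  obtain a z where "a \<in> A" and z: "z \<in> iter_sum R A i" and x: "x = a \<oplus> z"
    using Suc.prems(1) by (auto simp: mem_set_add)
  have "z \<oplus> y \<in> iter_sum R A (i + j)" using Suc.IH[OF z Suc.prems(2)] .
  moreover have "x \<oplus> y = a \<oplus> (z \<oplus> y)"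
    unfolding x using A \<open>a \<in> A\<close> iter_sum_closed[OF A] z Suc.prems(2) by (simp add: a_assoc subset_iff)
  ultimately show ?case using \<open>a \<in> A\<close> by (auto simp: mem_set_add)
qed

lemma iter_sum_1: "A \<subseteq> carrier R \<Longrightarrow> iter_sum R A (Suc 0) = A"
  by (auto simp: mem_set_add subset_iff)

lemma minus_left_cancel:
  assumes "a \<ominus> x = a \<ominus> y" "a \<in> carrier R" "x \<in> carrier R" "y \<in> carrier R"
  shows "x = y"
proof -
  have "x = a \<ominus> (a \<ominus> x)" using assms(2-4) by algebra
  also have "\<dots> = y" unfolding assms(1) using assms(2-4) by algebra
  finally show ?thesis .
qed

lemma card_translate:
  assumes "A \<subseteq> carrier R" "c \<in> carrier R"
  shows "card ((\<lambda>a. a \<oplus> c) ` A) = card A"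
  by (rule card_image) (use assms in \<open>auto intro!: inj_onI simp: subset_iff\<close>)

lemma card_diff_set_swap:
  assumes "A \<subseteq> carrier R" "B \<subseteq> carrier R"
  shows "card (diff_set R A B) = card (diff_set R B A)"
proof -
  have "diff_set R B A = a_inv R ` diff_set R A B"
    unfolding diff_set_def image_image using assms
    by (force simp: image_iff subset_iff a_minus_def minus_add a_comm)
  moreover have "inj_on (a_inv R) (diff_set R A B)"
    using diff_set_closed[OF assms] by (auto intro!: inj_onI simp: subset_iff) (metis minus_minus)
  ultimately show ?thesis by (metis card_image)
qed

text \<open>Fix one representation \<open>d = a - c\<close> of each difference. Then
  \<open>(d, b)\<close> is sent injectively to \<open>(b + a, b + c)\<close>: the difference of the
  two entries returns \<open>d\<close>, hence \<open>a\<close>, hence \<open>b\<close>.\<close>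

lemma ruzsa_triangle:
  assumes "finite A" "finite B" "finite C" and c: "A \<subseteq> carrier R" "B \<subseteq> carrier R" "C \<subseteq> carrier R"
  shows "card (diff_set R A C) * card B \<le> card (B <+>\<^bsub>R\<^esub> A) * card (B <+>\<^bsub>R\<^esub> C)"
proof -
  have "\<exists>f. \<forall>d\<in>diff_set R A C. fst (f d) \<in> A \<and> snd (f d) \<in> C \<and> d = fst (f d) \<ominus> snd (f d)"
    by (rule bchoice) (auto simp: diff_set_def)
  then obtain f where f: "\<And>d. d \<in> diff_set R A C \<Longrightarrow>
      fst (f d) \<in> A \<and> snd (f d) \<in> C \<and> d = fst (f d) \<ominus> snd (f d)" by blast
  let ?g = "\<lambda>(d, b). (b \<oplus> fst (f d), b \<oplus> snd (f d))"
  have "inj_on ?g (diff_set R A C \<times> B)"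
  proof (rule inj_onI, clarify)
    fix d b d' b'
    assume d: "d \<in> diff_set R A C" "d' \<in> diff_set R A C" and b: "b \<in> B" "b' \<in> B"
      and e: "b \<oplus> fst (f d) = b' \<oplus> fst (f d')" "b \<oplus> snd (f d) = b' \<oplus> snd (f d')"
    note f1 = f[OF d(1)] and f2 = f[OF d(2)]
    have cc: "fst (f d) \<in> carrier R" "snd (f d) \<in> carrier R" "fst (f d') \<in> carrier R"
      "snd (f d') \<in> carrier R" "b \<in> carrier R" "b' \<in> carrier R"
      using f1 f2 b c by auto
    have cancel: "(z \<oplus> x) \<ominus> (z \<oplus> y) = x \<ominus> y"
      if "x \<in> carrier R" "y \<in> carrier R" "z \<in> carrier R" for x y z
      using that by algebra
    have "d = (b \<oplus> fst (f d)) \<ominus> (b \<oplus> snd (f d))" using f1 cc cancel by metis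
    also have "\<dots> = (b' \<oplus> fst (f d')) \<ominus> (b' \<oplus> snd (f d'))" unfolding e ..
    also have "\<dots> = d'" using f2 cc cancel by metis
    finally have "d = d'" .
    with e(1) cc show "d = d' \<and> b = b'" by simp
  qed
  moreover have "?g ` (diff_set R A C \<times> B) \<subseteq> (B <+>\<^bsub>R\<^esub> A) \<times> (B <+>\<^bsub>R\<^esub> C)"
    using f by (force simp: mem_set_add)
  ultimately have "card (diff_set R A C \<times> B) \<le> card ((B <+>\<^bsub>R\<^esub> A) \<times> (B <+>\<^bsub>R\<^esub> C))"
    using assms by (intro card_inj_on_le) (auto intro: finite_set_add)
  then show ?thesis by (simp add: card_cartesian_product)
qed

lemma ruzsa_triangle_diff:
  assumes "finite A" "finite B" "finite C" and c: "A \<subseteq> carrier R" "B \<subseteq> carrier R" "C \<subseteq> carrier R"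
  shows "card (diff_set R A C) * card B \<le> card (diff_set R A B) * card (diff_set R C B)"
proof -
  have eq: "a_inv R ` B <+>\<^bsub>R\<^esub> X = diff_set R X B" if "X \<subseteq> carrier R" for X
    using that c(2) unfolding diff_set_def set_add_image
    by (force simp: image_iff a_minus_def a_comm subset_iff)
  have "inj_on (a_inv R) B"
    using c(2) by (auto intro!: inj_onI simp: subset_iff) (metis minus_minus)
  then have "card (a_inv R ` B) = card B" by (rule card_image)
  then show ?thesis
    using ruzsa_triangle[of A "a_inv R ` B" C] assms eq by auto
qed

text \<open>Petridis' argument: the part of a translate that is gained by adding one element to \<open>C\<close> is
  controlled by the minimality of \<open>X\<close>.\<close>

lemma petridis:
  assumes fin: "finite X" "finite B" "finite C"
    and c: "X \<subseteq> carrier R" "B \<subseteq> carrier R" "C \<subseteq> carrier R"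
    and min: "\<And>Y. Y \<subseteq> X \<Longrightarrow> card (X <+>\<^bsub>R\<^esub> B) * card Y \<le> card (Y <+>\<^bsub>R\<^esub> B) * card X"
  shows "card (X <+>\<^bsub>R\<^esub> (B <+>\<^bsub>R\<^esub> C)) * card X \<le> card (X <+>\<^bsub>R\<^esub> B) * card (X <+>\<^bsub>R\<^esub> C)"
  using fin(3) c(3)
proof (induction C)
  case empty
  then show ?case by (simp add: set_add_defs)
next
  case (insert d C)
  let ?S = "X <+>\<^bsub>R\<^esub> (B <+>\<^bsub>R\<^esub> C)" and ?T = "X <+>\<^bsub>R\<^esub> C"
  define tr where "tr = (\<lambda>A. (\<lambda>a. a \<oplus> d) ` A)"
  have d: "d \<in> carrier R" and C: "C \<subseteq> carrier R" using insert.prems by auto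
  have tr: "card (tr A) = card A" if "A \<subseteq> carrier R" for A
    unfolding tr_def using card_translate[OF that d] .
  \<comment> \<open>\<open>Y\<close> collects the \<open>x\<close> for which
    \<open>x + B + d\<close> adds nothing to the left sumset, \<open>Z\<close> those for which
    \<open>x + d\<close> adds nothing to the right one. The left side grows by at most
    \<open>|X + B| - |Y + B|\<close>, the right side by \<open>|X| - |Z|\<close> or more, which is
    at least \<open>|X| - |Y|\<close>; minimality of \<open>X\<close> compares the two.\<close>
  define Y where "Y = {x\<in>X. tr ({x} <+>\<^bsub>R\<^esub> B) \<subseteq> ?S}"
  define Z where "Z = {x\<in>X. x \<oplus> d \<in> ?T}"
  have XB: "X <+>\<^bsub>R\<^esub> B \<subseteq> carrier R" and YB: "Y <+>\<^bsub>R\<^esub> B \<subseteq> carrier R"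
    using c by (auto simp: mem_set_add Y_def subset_iff)
  have finXB: "finite (X <+>\<^bsub>R\<^esub> B)" "finite ?S" "finite ?T" "finite Z"
    using fin insert.hyps by (auto simp: Z_def intro: finite_set_add)
  have ZY: "Z \<subseteq> Y"
  proof
    fix x assume "x \<in> Z"
    then obtain x' e where x: "x \<in> X" "x' \<in> X" "e \<in> C" "x \<oplus> d = x' \<oplus> e"
      by (auto simp: Z_def mem_set_add)
    have "x \<oplus> b \<oplus> d \<in> ?S" if "b \<in> B" for b
    proof -
      have cc: "x \<in> carrier R" "x' \<in> carrier R" "e \<in> carrier R" "b \<in> carrier R"
        using x that c C by auto
      have "x \<oplus> b \<oplus> d = (x \<oplus> d) \<oplus> b" using cc d by algebra
      also have "\<dots> = x' \<oplus> (b \<oplus> e)" unfolding x(4) using cc d by algebra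
      finally have eq: "x \<oplus> b \<oplus> d = x' \<oplus> (b \<oplus> e)" .
      have "b \<oplus> e \<in> B <+>\<^bsub>R\<^esub> C" using x that unfolding mem_set_add by blast
      then show ?thesis using x eq unfolding mem_set_add[of _ _ X] by blast
    qed
    then show "x \<in> Y" using x by (auto simp: Y_def tr_def mem_set_add)
  qed
  have sub: "X <+>\<^bsub>R\<^esub> (B <+>\<^bsub>R\<^esub> insert d C) \<subseteq> ?S \<union> (tr (X <+>\<^bsub>R\<^esub> B) - tr (Y <+>\<^bsub>R\<^esub> B))"
  proof
    fix w assume "w \<in> X <+>\<^bsub>R\<^esub> (B <+>\<^bsub>R\<^esub> insert d C)"
    then obtain x b e where w: "x \<in> X" "b \<in> B" "e \<in> insert d C" "w = x \<oplus> (b \<oplus> e)"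
      by (auto simp: mem_set_add) blast+
    show "w \<in> ?S \<union> (tr (X <+>\<^bsub>R\<^esub> B) - tr (Y <+>\<^bsub>R\<^esub> B))"
    proof (cases "w \<in> ?S")
      case False
      moreover have "w \<in> ?S" if "e \<in> C"
      proof -
        have "b \<oplus> e \<in> B <+>\<^bsub>R\<^esub> C" using w that unfolding mem_set_add by blast
        then show ?thesis using w unfolding mem_set_add[of _ _ X] by blast
      qed
      ultimately have "e = d" using w by blast
      then have "w = x \<oplus> b \<oplus> d" using w c d by (auto simp: a_assoc subset_iff)
      moreover have "x \<oplus> b \<in> X <+>\<^bsub>R\<^esub> B" using w unfolding mem_set_add by blast
      ultimately have "w \<in> tr (X <+>\<^bsub>R\<^esub> B)" unfolding tr_def by blast
      moreover have "w \<notin> tr (Y <+>\<^bsub>R\<^esub> B)"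
      proof
        assume "w \<in> tr (Y <+>\<^bsub>R\<^esub> B)"
        then obtain y b' where "y \<in> Y" "b' \<in> B" "w = y \<oplus> b' \<oplus> d" by (auto simp: tr_def mem_set_add)
        moreover from this have "y \<oplus> b' \<in> {y} <+>\<^bsub>R\<^esub> B" by (auto simp: mem_set_add)
        ultimately have "w \<in> ?S" unfolding Y_def tr_def by blast
        with False show False ..
      qed
      ultimately show ?thesis by blast
    qed simp
  qed
  have YX: "tr (Y <+>\<^bsub>R\<^esub> B) \<subseteq> tr (X <+>\<^bsub>R\<^esub> B)"
    unfolding tr_def by (intro image_mono set_add_mono) (auto simp: Y_def)
  have 1: "card (X <+>\<^bsub>R\<^esub> (B <+>\<^bsub>R\<^esub> insert d C)) \<le> card ?S + (card (X <+>\<^bsub>R\<^esub> B) - card (Y <+>\<^bsub>R\<^esub> B))"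
  proof -
    have "card (X <+>\<^bsub>R\<^esub> (B <+>\<^bsub>R\<^esub> insert d C)) \<le> card (?S \<union> (tr (X <+>\<^bsub>R\<^esub> B) - tr (Y <+>\<^bsub>R\<^esub> B)))"
      using finXB by (intro card_mono[OF _ sub]) (auto simp: tr_def)
    also have "\<dots> \<le> card ?S + card (tr (X <+>\<^bsub>R\<^esub> B) - tr (Y <+>\<^bsub>R\<^esub> B))" by (rule card_Un_le)
    also have "card (tr (X <+>\<^bsub>R\<^esub> B) - tr (Y <+>\<^bsub>R\<^esub> B)) = card (X <+>\<^bsub>R\<^esub> B) - card (Y <+>\<^bsub>R\<^esub> B)"
      using card_Diff_subset[OF _ YX] finXB tr[OF XB] tr[OF YB] finite_subset[OF YX]
      by (simp add: tr_def)
    finally show ?thesis by simp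
  qed
  have 2: "card ?T + (card X - card Z) \<le> card (X <+>\<^bsub>R\<^esub> insert d C)"
  proof -
    have "card (tr (X - Z)) = card X - card Z"
      using tr[of "X - Z"] c finXB by (simp add: card_Diff_subset Z_def subset_iff)
    moreover have "?T \<inter> tr (X - Z) = {}" by (auto simp: tr_def Z_def)
    moreover have "?T \<union> tr (X - Z) \<subseteq> X <+>\<^bsub>R\<^esub> insert d C" by (auto simp: tr_def mem_set_add) blast
    ultimately show ?thesis
      using card_mono[of "X <+>\<^bsub>R\<^esub> insert d C" "?T \<union> tr (X - Z)"] card_Un_disjoint[of ?T "tr (X - Z)"]
        finXB fin insert.hyps by (simp add: finite_set_add tr_def)
  qed
  have le: "card (Y <+>\<^bsub>R\<^esub> B) \<le> card (X <+>\<^bsub>R\<^esub> B)"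
    using finXB by (intro card_mono set_add_mono) (auto simp: Y_def)
  have leZ: "card Z \<le> card Y" "card Y \<le> card X"
    using ZY fin by (auto intro!: card_mono simp: Y_def)
  have IH: "card ?S * card X \<le> card (X <+>\<^bsub>R\<^esub> B) * card ?T" using insert.IH C by auto
  have mY: "card (X <+>\<^bsub>R\<^esub> B) * card Y \<le> card (Y <+>\<^bsub>R\<^esub> B) * card X" by (rule min) (auto simp: Y_def)
  have "card (X <+>\<^bsub>R\<^esub> (B <+>\<^bsub>R\<^esub> insert d C)) * card X
      \<le> card ?S * card X + (card (X <+>\<^bsub>R\<^esub> B) * card X - card (Y <+>\<^bsub>R\<^esub> B) * card X)"
    using mult_right_mono[OF 1, of "card X"] by (simp add: algebra_simps)
  also have "\<dots> \<le> card (X <+>\<^bsub>R\<^esub> B) * card ?T + (card (X <+>\<^bsub>R\<^esub> B) * card X - card (X <+>\<^bsub>R\<^esub> B) * card Y)"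
    using IH mY by linarith
  also have "\<dots> = card (X <+>\<^bsub>R\<^esub> B) * (card ?T + (card X - card Y))" by (simp add: algebra_simps)
  also have "\<dots> \<le> card (X <+>\<^bsub>R\<^esub> B) * (card ?T + (card X - card Z))"
    using leZ by (intro mult_left_mono) auto
  also have "\<dots> \<le> card (X <+>\<^bsub>R\<^esub> B) * card (X <+>\<^bsub>R\<^esub> insert d C)"
    using 2 by (intro mult_left_mono) auto
  finally show ?case .
qed

text \<open>A nonempty \<open>X\<close> inside \<open>-V\<close> that minimises
  \<open>|X + V| / |X|\<close> has ratio at most \<open>K\<close>, because \<open>-V + V\<close> is
  \<open>V - V\<close>. Petridis' inequality then charges one factor \<open>K\<close> for each
  further summand \<open>V\<close>, and Ruzsa's triangle inequality through \<open>X\<close> joins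
  the \<open>i\<close>-fold and the \<open>j\<close>-fold sum.\<close>

lemma plunnecke_ruzsa:
  assumes fin: "finite V" and ne: "V \<noteq> {}" and c: "V \<subseteq> carrier R" and K: "K \<ge> 0"
    and small: "real (card (diff_set R V V)) \<le> K * real (card V)"
  shows "real (card (diff_set R (iter_sum R V i) (iter_sum R V j))) \<le> K ^ (i + j) * real (card V)"
proof -
  define W where "W = a_inv R ` V"
  have W: "finite W" "W \<noteq> {}" "W \<subseteq> carrier R" using fin ne c by (auto simp: W_def)
  have "inj_on (a_inv R) V"
    using c by (auto intro!: inj_onI simp: subset_iff) (metis minus_minus)
  then have cW: "card W = card V" unfolding W_def by (rule card_image)
  have WV: "W <+>\<^bsub>R\<^esub> V = diff_set R V V"
    using c unfolding W_def diff_set_def set_add_image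
    by (force simp: image_iff a_minus_def a_comm subset_iff)
  define S where "S = {X. X \<subseteq> W \<and> X \<noteq> {}}"
  define f where "f = (\<lambda>X. real (card (X <+>\<^bsub>R\<^esub> V)) / real (card X))"
  have S: "finite S" "W \<in> S" using W by (auto simp: S_def)
  then have "Min (f ` S) \<in> f ` S" by (intro Min_in) auto
  then obtain X where X: "X \<in> S" and minX: "f X = Min (f ` S)" by auto
  have min: "f X \<le> f Y" if "Y \<in> S" for Y
    unfolding minX using that S by (intro Min_le) auto
  have Xf: "finite X" "X \<noteq> {}" "X \<subseteq> carrier R" "X \<subseteq> W"
    using X W finite_subset by (auto simp: S_def)
  then have pX: "card X > 0" by (simp add: card_gt_0_iff)
  have "f X \<le> f W" by (rule min) (use S in auto)
  also have "\<dots> \<le> K"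
    unfolding f_def WV cW using small fin ne by (simp add: divide_le_eq card_gt_0_iff)
  finally have XK: "real (card (X <+>\<^bsub>R\<^esub> V)) \<le> K * real (card X)"
    using pX by (simp add: f_def divide_le_eq)
  have mn: "card (X <+>\<^bsub>R\<^esub> V) * card Y \<le> card (Y <+>\<^bsub>R\<^esub> V) * card X" if "Y \<subseteq> X" for Y
  proof (cases "Y = {}")
    case False
    then have "card Y > 0" using finite_subset[OF that Xf(1)] by (auto simp: card_gt_0_iff)
    moreover have "f X \<le> f Y" using that False Xf by (intro min) (auto simp: S_def)
    ultimately have "real (card (X <+>\<^bsub>R\<^esub> V)) * real (card Y) \<le> real (card (Y <+>\<^bsub>R\<^esub> V)) * real (card X)"
      using pX by (simp add: f_def field_simps)
    then show ?thesis by (metis of_nat_le_iff of_nat_mult)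
  qed simp
  have grow: "real (card (X <+>\<^bsub>R\<^esub> iter_sum R V i)) \<le> K ^ i * real (card X)" for i
  proof (induction i)
    case 0
    have "X <+>\<^bsub>R\<^esub> {\<zero>} = X" using Xf(3) by (force simp: set_add_image image_iff subset_iff)
    then show ?case by simp
  next
    case (Suc i)
    have "card (X <+>\<^bsub>R\<^esub> (V <+>\<^bsub>R\<^esub> iter_sum R V i)) * card X \<le> card (X <+>\<^bsub>R\<^esub> V) * card (X <+>\<^bsub>R\<^esub> iter_sum R V i)"
      by (rule petridis) (use Xf fin c mn in \<open>auto simp: finite_iter_sum dest: subsetD[OF iter_sum_closed[OF c]]\<close>)
    then have "real (card (X <+>\<^bsub>R\<^esub> iter_sum R V (Suc i))) * real (card X)
        \<le> real (card (X <+>\<^bsub>R\<^esub> V)) * real (card (X <+>\<^bsub>R\<^esub> iter_sum R V i))"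
      by (metis iter_sum.simps(2) of_nat_le_iff of_nat_mult)
    also have "\<dots> \<le> (K * real (card X)) * (K ^ i * real (card X))"
      using XK Suc K by (intro mult_mono) auto
    finally have "real (card (X <+>\<^bsub>R\<^esub> iter_sum R V (Suc i))) * real (card X)
        \<le> (K ^ Suc i * real (card X)) * real (card X)"
      by (simp add: algebra_simps)
    then show ?case using pX by (simp only: mult_le_cancel_right_pos of_nat_0_less_iff)
  qed
  have "card (diff_set R (iter_sum R V i) (iter_sum R V j)) * card X
      \<le> card (X <+>\<^bsub>R\<^esub> iter_sum R V i) * card (X <+>\<^bsub>R\<^esub> iter_sum R V j)"
    by (rule ruzsa_triangle) (use Xf fin c in \<open>auto simp: finite_iter_sum dest: subsetD[OF iter_sum_closed[OF c]]\<close>)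
  then have "real (card (diff_set R (iter_sum R V i) (iter_sum R V j))) * real (card X)
      \<le> real (card (X <+>\<^bsub>R\<^esub> iter_sum R V i)) * real (card (X <+>\<^bsub>R\<^esub> iter_sum R V j))"
    by (metis of_nat_le_iff of_nat_mult)
  also have "\<dots> \<le> (K ^ i * real (card X)) * (K ^ j * real (card X))"
    using grow K by (intro mult_mono) auto
  finally have "real (card (diff_set R (iter_sum R V i) (iter_sum R V j))) * real (card X)
      \<le> (K ^ (i + j) * real (card X)) * real (card X)"
    by (simp add: algebra_simps power_add)
  then have "real (card (diff_set R (iter_sum R V i) (iter_sum R V j))) \<le> K ^ (i + j) * real (card X)"
    using pX by (simp only: mult_le_cancel_right_pos of_nat_0_less_iff)
  also have "\<dots> \<le> K ^ (i + j) * real (card V)"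
    using card_mono[OF W(1) Xf(4)] K cW by (intro mult_left_mono) auto
  finally show ?thesis .
qed

text \<open>Take \<open>T\<close> maximal such that the sets \<open>t - V\<close> are pairwise
  disjoint. Disjointness bounds \<open>|T|\<close>; by maximality every \<open>a - V\<close> meets
  some \<open>t - V\<close>, which is the claimed representation.\<close>

lemma ruzsa_covering:
  assumes "finite A" "finite V" "V \<noteq> {}" and c: "A \<subseteq> carrier R" "V \<subseteq> carrier R"
  shows "\<exists>T\<subseteq>A. card T * card V \<le> card (diff_set R A V) \<and>
           (\<forall>a\<in>A. \<exists>t\<in>T. \<exists>v\<in>V. \<exists>v'\<in>V. a = t \<oplus> (v \<ominus> v'))"
proof -
  define D where "D = (\<lambda>a. (\<lambda>v. a \<ominus> v) ` V)"
  define S where "S = {T. T \<subseteq> A \<and> (\<forall>s\<in>T. \<forall>t\<in>T. s \<noteq> t \<longrightarrow> D s \<inter> D t = {})}"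
  have "finite S" "{} \<in> S" using assms by (auto simp: S_def)
  then obtain T where T: "T \<in> S" and max: "\<And>T'. T' \<in> S \<Longrightarrow> T \<subseteq> T' \<Longrightarrow> T = T'"
    using finite_has_maximal[of S] by blast
  have TA: "T \<subseteq> A" using T by (simp add: S_def)
  have finT: "finite T" using TA assms finite_subset by blast
  have "card (\<Union>t\<in>T. D t) = (\<Sum>t\<in>T. card (D t))"
    using T finT assms by (intro card_UN_disjoint) (auto simp: S_def D_def)
  also have "\<dots> = (\<Sum>t\<in>T. card V)"
    by (intro sum.cong refl, unfold D_def, rule card_image)
      (use TA c in \<open>auto intro!: inj_onI dest: minus_left_cancel simp: subset_iff\<close>)
  finally have "card T * card V = card (\<Union>t\<in>T. D t)" by simp
  also have "\<dots> \<le> card (diff_set R A V)"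
    using TA assms by (intro card_mono finite_diff_set) (auto simp: D_def diff_set_def)
  finally have card: "card T * card V \<le> card (diff_set R A V)" .
  have "\<exists>t\<in>T. \<exists>v\<in>V. \<exists>v'\<in>V. a = t \<oplus> (v \<ominus> v')" if a: "a \<in> A" for a
  proof -
    have "\<exists>t\<in>T. D a \<inter> D t \<noteq> {}"
    proof (cases "a \<in> T")
      case True
      moreover have "D a \<noteq> {}" using assms by (auto simp: D_def)
      ultimately show ?thesis by blast
    next
      case False
      then have "insert a T \<notin> S" using max[of "insert a T"] by auto
      then show ?thesis using T a by (auto simp: S_def)
    qed
    then obtain t v v' where t: "t \<in> T" "v \<in> V" "v' \<in> V" and e: "a \<ominus> v = t \<ominus> v'"
      by (auto simp: D_def)
    have cc: "a \<in> carrier R" "t \<in> carrier R" "v \<in> carrier R" "v' \<in> carrier R"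
      using t a TA c by auto
    have "a = (a \<ominus> v) \<oplus> v" using cc by algebra
    also have "\<dots> = t \<oplus> (v \<ominus> v')" unfolding e using cc by algebra
    finally show ?thesis using t by blast
  qed
  with card TA show ?thesis by blast
qed

end

subsection \<open>Dilates of a set in a finite field\<close>

text \<open>Cauchy--Schwarz for the fibres of \<open>f\<close>: their sizes add up to
  \<open>|A|\<close>, and the squares of the sizes count collisions.\<close>

lemma card_collisions:
  assumes fin: "finite A" "finite B" and sub: "f ` A \<subseteq> B"
  shows "(real (card A))\<^sup>2 \<le> real (card B) * real (card {(a, a') \<in> A \<times> A. f a = f a'})"
proof -
  let ?c = "\<lambda>b. {a\<in>A. f a = b}"
  have "A = (\<Union>b\<in>B. ?c b)" using sub by auto
  then have "card A = card (\<Union>b\<in>B. ?c b)" by simp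
  also have "\<dots> = (\<Sum>b\<in>B. card (?c b))" using fin by (intro card_UN_disjoint) auto
  finally have 1: "real (card A) = (\<Sum>b\<in>B. real (card (?c b)))" by simp
  have "{(a, a') \<in> A \<times> A. f a = f a'} = (\<Union>b\<in>B. ?c b \<times> ?c b)" using sub by auto
  also have "card \<dots> = (\<Sum>b\<in>B. card (?c b \<times> ?c b))" using fin by (intro card_UN_disjoint) auto
  finally have 2: "real (card {(a, a') \<in> A \<times> A. f a = f a'}) = (\<Sum>b\<in>B. (real (card (?c b)))\<^sup>2)"
    by (simp add: card_cartesian_product power2_eq_square)
  show ?thesis unfolding 1 2 by (subst mult.commute) (rule sum_squared_le_sum_of_squares)
qed

definition dilate :: "('a, 'b) ring_scheme \<Rightarrow> 'a \<Rightarrow> 'a set \<Rightarrow> 'a set" where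
  "dilate G x A = (\<lambda>a. x \<otimes>\<^bsub>G\<^esub> a) ` A"

locale finite_field = field +
  assumes finite_carrier: "finite (carrier R)"
begin

lemma finite_sub: "A \<subseteq> carrier R \<Longrightarrow> finite A"
  using finite_carrier finite_subset by blast

lemma dilate_closed: "x \<in> carrier R \<Longrightarrow> A \<subseteq> carrier R \<Longrightarrow> dilate R x A \<subseteq> carrier R"
  unfolding dilate_def by auto

lemma card_dilate:
  assumes "x \<in> carrier R" "x \<noteq> \<zero>" "A \<subseteq> carrier R"
  shows "card (dilate R x A) = card A"
  unfolding dilate_def by (rule card_image) (use assms m_lcancel in \<open>auto intro!: inj_onI simp: subset_iff\<close>)

text \<open>With \<open>m = |V|\<close>, each \<open>x\<close> in \<open>S\<close> forces at least
  \<open>m^4 / X\<close> collisions of \<open>(a, b) -> a - x b\<close>. At most \<open>m^2\<close>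
  of them have equal second coordinates (\<open>C1\<close>). The others (\<open>C2\<close>)
  determine \<open>x\<close> as a quotient of differences, so they are disjoint for different
  \<open>x\<close> and number at most \<open>m^4\<close> in total. Summing over \<open>S\<close>,
  the hypothesis \<open>2 X <= m^2\<close> absorbs the contribution of \<open>C1\<close>.\<close>

lemma few_small_dilates:
  assumes V: "V \<subseteq> carrier R" "V \<noteq> {}" and S: "S \<subseteq> carrier R"
    and small: "\<And>x. x \<in> S \<Longrightarrow> real (card (diff_set R V (dilate R x V))) \<le> X"
    and X: "2 * X \<le> (real (card V))\<^sup>2" "X \<ge> 0"
  shows "real (card S) \<le> 2 * X"
proof -
  define m where "m = real (card V)"
  have fV: "finite V" and fS: "finite S" using V S finite_sub by auto
  have m: "m > 0" using V fV by (simp add: m_def card_gt_0_iff)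
  define f where "f = (\<lambda>x (a, b). a \<ominus> x \<otimes> b)"
  define C where "C = (\<lambda>x. {(q, q') \<in> (V \<times> V) \<times> (V \<times> V). f x q = f x q'})"
  define C1 where "C1 = (\<lambda>x. {z \<in> C x. snd (fst z) = snd (snd z)})"
  define C2 where "C2 = (\<lambda>x. {z \<in> C x. snd (fst z) \<noteq> snd (snd z)})"
  have finC: "finite (C x)" for x
    unfolding C_def by (rule finite_subset[of _ "(V \<times> V) \<times> (V \<times> V)"]) (use fV in auto)
  have low: "m ^ 4 \<le> X * real (card (C x))" if x: "x \<in> S" for x
  proof -
    have "(real (card (V \<times> V)))\<^sup>2 \<le> real (card (diff_set R V (dilate R x V))) * real (card (C x))"
      unfolding C_def
      by (rule card_collisions) (use fV in \<open>auto simp: f_def diff_set_def dilate_def\<close>)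
    also have "\<dots> \<le> X * real (card (C x))" using small[OF x] by (intro mult_right_mono) auto
    finally show ?thesis
      by (simp add: m_def card_cartesian_product power2_eq_square power4_eq_xxxx mult.assoc)
  qed
  have c1: "real (card (C1 x)) \<le> m\<^sup>2" if x: "x \<in> S" for x
  proof -
    have xc: "x \<in> carrier R" using x S by auto
    have "C1 x \<subseteq> (\<lambda>q. (q, q)) ` (V \<times> V)"
    proof
      fix z assume "z \<in> C1 x"
      then obtain a b c where z: "z = ((a, b), (c, b))" "a \<in> V" "b \<in> V" "c \<in> V"
        and e: "a \<ominus> x \<otimes> b = c \<ominus> x \<otimes> b"
        by (auto simp: C1_def C_def f_def)
      have "a \<in> carrier R" "b \<in> carrier R" "c \<in> carrier R" using z V by auto
      with e have "a = c" using xc by (simp add: a_minus_def)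
      then show "z \<in> (\<lambda>q. (q, q)) ` (V \<times> V)" using z by auto
    qed
    then have "card (C1 x) \<le> card ((\<lambda>q. (q, q)) ` (V \<times> V))" using fV by (intro card_mono) auto
    also have "\<dots> \<le> card (V \<times> V)" using fV by (intro card_image_le) auto
    finally have "real (card (C1 x)) \<le> real (card V * card V)"
      by (simp only: card_cartesian_product of_nat_le_iff)
    then show ?thesis by (simp add: m_def power2_eq_square)
  qed
  have disj: "C2 x \<inter> C2 y = {}" if xy: "x \<in> S" "y \<in> S" "x \<noteq> y" for x y
  proof (rule ccontr)
    assume "C2 x \<inter> C2 y \<noteq> {}"
    then obtain a b c d where q: "a \<in> V" "b \<in> V" "c \<in> V" "d \<in> V" "b \<noteq> d"
      and e: "a \<ominus> x \<otimes> b = c \<ominus> x \<otimes> d" "a \<ominus> y \<otimes> b = c \<ominus> y \<otimes> d"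
      by (auto simp: C2_def C_def f_def)
    have cc: "a \<in> carrier R" "b \<in> carrier R" "c \<in> carrier R" "d \<in> carrier R"
      "x \<in> carrier R" "y \<in> carrier R"
      using q V xy S by auto
    have "(a \<ominus> x \<otimes> b) \<ominus> (a \<ominus> y \<otimes> b) = (y \<ominus> x) \<otimes> b" using cc by algebra
    moreover have "(c \<ominus> x \<otimes> d) \<ominus> (c \<ominus> y \<otimes> d) = (y \<ominus> x) \<otimes> d" using cc by algebra
    ultimately have "(y \<ominus> x) \<otimes> b = (y \<ominus> x) \<otimes> d" using e by simp
    moreover have "y \<ominus> x \<noteq> \<zero>" using cc xy(3) by auto
    ultimately have "b = d" using cc m_lcancel[of "y \<ominus> x" b d] by auto
    with q show False by simp
  qed
  have "(\<Sum>x\<in>S. card (C2 x)) = card (\<Union>x\<in>S. C2 x)"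
    using fS finC disj by (intro card_UN_disjoint[symmetric]) (auto simp: C2_def)
  also have "\<dots> \<le> card ((V \<times> V) \<times> (V \<times> V))"
    using fV by (intro card_mono) (auto simp: C2_def C_def)
  finally have "real (\<Sum>x\<in>S. card (C2 x)) \<le> real (card ((V \<times> V) \<times> (V \<times> V)))"
    by (rule of_nat_mono)
  then have c2: "(\<Sum>x\<in>S. real (card (C2 x))) \<le> m ^ 4"
    by (simp add: m_def card_cartesian_product power4_eq_xxxx mult.assoc)
  have split: "real (card (C x)) \<le> real (card (C1 x)) + real (card (C2 x))" for x
  proof -
    have "C x = C1 x \<union> C2 x" by (auto simp: C1_def C2_def)
    then show ?thesis using card_Un_le[of "C1 x" "C2 x"] by simp
  qed
  show ?thesis
  proof (cases "S = {}")
    case True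
    then show ?thesis using X by simp
  next
    case False
    have "real (card S) * m ^ 4 = (\<Sum>x\<in>S. m ^ 4)" by simp
    also have "\<dots> \<le> (\<Sum>x\<in>S. X * (m\<^sup>2 + real (card (C2 x))))"
    proof (intro sum_mono)
      fix x assume x: "x \<in> S"
      have "m ^ 4 \<le> X * real (card (C x))" by (rule low[OF x])
      also have "\<dots> \<le> X * (m\<^sup>2 + real (card (C2 x)))"
        using split[of x] c1[OF x] X(2) by (intro mult_left_mono) auto
      finally show "m ^ 4 \<le> X * (m\<^sup>2 + real (card (C2 x)))" .
    qed
    also have "\<dots> = X * (real (card S) * m\<^sup>2 + (\<Sum>x\<in>S. real (card (C2 x))))"
      by (simp add: sum_distrib_left[symmetric] sum.distrib)
    also have "\<dots> \<le> X * (real (card S) * m\<^sup>2 + m ^ 4)"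
      using c2 X(2) by (intro mult_left_mono) auto
    also have "\<dots> = X * (real (card S) * m\<^sup>2) + X * m ^ 4" by (rule distrib_left)
    also have "X * (real (card S) * m\<^sup>2) \<le> (m\<^sup>2 / 2) * (real (card S) * m\<^sup>2)"
      using X by (intro mult_right_mono) (auto simp: m_def)
    also have "(m\<^sup>2 / 2) * (real (card S) * m\<^sup>2) = (real (card S) * m ^ 4) / 2"
      by (simp add: power2_eq_square power4_eq_xxxx)
    finally have "real (card S) * m ^ 4 \<le> (2 * X) * m ^ 4" by simp
    then show ?thesis using m by simp
  qed
qed

text \<open>The dilate \<open>z V\<close> lies in at most \<open>k\<close> translates of
  \<open>j V - j V\<close>. Unlike a bound on \<open>|V - z V|\<close>, this passes directly to sums
  of multipliers: the fold numbers add and the numbers of translates multiply.\<close>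

definition covered :: "'a set \<Rightarrow> nat \<Rightarrow> real \<Rightarrow> 'a \<Rightarrow> bool" where
  "covered V j k z \<longleftrightarrow> (\<exists>T\<subseteq>carrier R. real (card T) \<le> k \<and>
     (\<forall>v\<in>V. \<exists>t\<in>T. \<exists>s\<in>iter_sum R V j. \<exists>s'\<in>iter_sum R V j. z \<otimes> v = t \<oplus> (s \<ominus> s')))"

lemma covered_small_dilate:
  assumes V: "V \<subseteq> carrier R" "V \<noteq> {}" and z: "z \<in> carrier R"
    and small: "real (card (diff_set R V (dilate R z V))) \<le> k * real (card V)"
  shows "covered V 1 k z"
proof -
  have fin: "finite (dilate R z V)" "finite V" using V z finite_sub dilate_closed by auto
  obtain T where T: "T \<subseteq> dilate R z V"
      "card T * card V \<le> card (diff_set R (dilate R z V) V)"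
      "\<forall>a\<in>dilate R z V. \<exists>t\<in>T. \<exists>v\<in>V. \<exists>v'\<in>V. a = t \<oplus> (v \<ominus> v')"
    using ruzsa_covering[OF fin V(2) dilate_closed[OF z V(1)] V(1)] by blast
  have "real (card T) * real (card V) \<le> real (card (diff_set R (dilate R z V) V))"
    using T(2) by (metis of_nat_le_iff of_nat_mult)
  also have "\<dots> \<le> k * real (card V)"
    using small card_diff_set_swap[OF dilate_closed[OF z V(1)] V(1)] by simp
  finally have "real (card T) \<le> k" using V fin by (simp add: card_gt_0_iff)
  moreover have "T \<subseteq> carrier R" using T dilate_closed[OF z V(1)] by blast
  ultimately show ?thesis
    using T(3) unfolding covered_def One_nat_def iter_sum_1[OF V(1)] dilate_def by blast
qed

lemma covered_add:
  assumes V: "V \<subseteq> carrier R" and y: "y \<in> carrier R" "covered V i k y"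
    and z: "z \<in> carrier R" "covered V j l z" and k: "k \<ge> 0"
  shows "covered V (i + j) (k * l) (y \<oplus> z)"
proof -
  obtain S where S: "S \<subseteq> carrier R" "real (card S) \<le> k"
    "\<forall>v\<in>V. \<exists>t\<in>S. \<exists>s\<in>iter_sum R V i. \<exists>s'\<in>iter_sum R V i. y \<otimes> v = t \<oplus> (s \<ominus> s')"
    using y(2) unfolding covered_def by blast
  obtain T where T: "T \<subseteq> carrier R" "real (card T) \<le> l"
    "\<forall>v\<in>V. \<exists>t\<in>T. \<exists>s\<in>iter_sum R V j. \<exists>s'\<in>iter_sum R V j. z \<otimes> v = t \<oplus> (s \<ominus> s')"
    using z(2) unfolding covered_def by blast
  have "real (card (S <+>\<^bsub>R\<^esub> T)) \<le> real (card S) * real (card T)"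
    using card_set_add_le[of S T R] S(1) T(1) finite_sub by (metis of_nat_le_iff of_nat_mult)
  also have "\<dots> \<le> k * l" using S T k by (intro mult_mono) auto
  finally have c: "real (card (S <+>\<^bsub>R\<^esub> T)) \<le> k * l" .
  have sub: "S <+>\<^bsub>R\<^esub> T \<subseteq> carrier R" using S(1) T(1) unfolding mem_set_add subset_iff by auto
  have "\<exists>t\<in>S <+>\<^bsub>R\<^esub> T. \<exists>s\<in>iter_sum R V (i + j). \<exists>s'\<in>iter_sum R V (i + j).
      (y \<oplus> z) \<otimes> v = t \<oplus> (s \<ominus> s')" if v: "v \<in> V" for v
  proof -
    obtain t s s' where 1: "t \<in> S" "s \<in> iter_sum R V i" "s' \<in> iter_sum R V i" "y \<otimes> v = t \<oplus> (s \<ominus> s')"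
      using S(3) v by blast
    obtain u r r' where 2: "u \<in> T" "r \<in> iter_sum R V j" "r' \<in> iter_sum R V j" "z \<otimes> v = u \<oplus> (r \<ominus> r')"
      using T(3) v by blast
    have cc: "t \<in> carrier R" "u \<in> carrier R" "s \<in> carrier R" "s' \<in> carrier R" "r \<in> carrier R"
      "r' \<in> carrier R" "v \<in> carrier R"
      using 1 2 S T v V iter_sum_closed[OF V] by blast+
    have "(y \<oplus> z) \<otimes> v = y \<otimes> v \<oplus> z \<otimes> v" using cc y z by algebra
    also have "\<dots> = (t \<oplus> u) \<oplus> ((s \<oplus> r) \<ominus> (s' \<oplus> r'))" unfolding 1 2 using cc by algebra
    finally have "(y \<oplus> z) \<otimes> v = (t \<oplus> u) \<oplus> ((s \<oplus> r) \<ominus> (s' \<oplus> r'))" .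
    moreover have "t \<oplus> u \<in> S <+>\<^bsub>R\<^esub> T" using 1 2 unfolding mem_set_add by blast
    ultimately show ?thesis using iter_sum_add[OF V] 1 2 by meson
  qed
  with c sub show ?thesis unfolding covered_def by blast
qed

lemma covered_neg:
  assumes V: "V \<subseteq> carrier R" and z: "z \<in> carrier R" "covered V j k z"
  shows "covered V j k (\<ominus> z)"
proof -
  obtain T where T: "T \<subseteq> carrier R" "real (card T) \<le> k"
    "\<forall>v\<in>V. \<exists>t\<in>T. \<exists>s\<in>iter_sum R V j. \<exists>s'\<in>iter_sum R V j. z \<otimes> v = t \<oplus> (s \<ominus> s')"
    using z(2) unfolding covered_def by blast
  have "card (a_inv R ` T) \<le> card T" using T(1) finite_sub by (intro card_image_le) auto
  then have c: "real (card (a_inv R ` T)) \<le> k" using T by linarith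
  have "\<exists>t\<in>a_inv R ` T. \<exists>s\<in>iter_sum R V j. \<exists>s'\<in>iter_sum R V j. \<ominus> z \<otimes> v = t \<oplus> (s \<ominus> s')"
    if v: "v \<in> V" for v
  proof -
    obtain t s s' where 1: "t \<in> T" "s \<in> iter_sum R V j" "s' \<in> iter_sum R V j" "z \<otimes> v = t \<oplus> (s \<ominus> s')"
      using T(3) v by blast
    have cc: "t \<in> carrier R" "s \<in> carrier R" "s' \<in> carrier R" "v \<in> carrier R"
      using 1 T v V iter_sum_closed[OF V] by blast+
    have "\<ominus> z \<otimes> v = \<ominus> (z \<otimes> v)" using cc z by algebra
    also have "\<dots> = \<ominus> t \<oplus> (s' \<ominus> s)" unfolding 1 using cc by algebra
    finally show ?thesis using 1 by blast
  qed
  moreover have "a_inv R ` T \<subseteq> carrier R" using T by auto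
  ultimately show ?thesis using c unfolding covered_def by blast
qed

text \<open>The way back from coverings to sizes: \<open>V - z V\<close> lies in \<open>k\<close>
  translates of \<open>(j + 1) V - j V\<close>, whose size Pluennecke bounds with exponent
  \<open>2 j + 1\<close>.\<close>

lemma card_diff_set_covered:
  assumes V: "V \<subseteq> carrier R" "V \<noteq> {}" and z: "z \<in> carrier R" "covered V j k z"
    and K: "K \<ge> 0" "real (card (diff_set R V V)) \<le> K * real (card V)" and k: "k \<ge> 0"
  shows "real (card (diff_set R V (dilate R z V))) \<le> k * K ^ (j + j + 1) * real (card V)"
proof -
  obtain T where T: "T \<subseteq> carrier R" "real (card T) \<le> k"
    "\<forall>v\<in>V. \<exists>t\<in>T. \<exists>s\<in>iter_sum R V j. \<exists>s'\<in>iter_sum R V j. z \<otimes> v = t \<oplus> (s \<ominus> s')"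
    using z(2) unfolding covered_def by blast
  let ?D = "diff_set R (iter_sum R V (Suc j)) (iter_sum R V j)"
  have fin: "finite T" "finite V" "finite ?D"
    using T V finite_sub by (auto intro!: finite_diff_set finite_set_add finite_iter_sum)
  have "diff_set R V (dilate R z V) \<subseteq> (\<lambda>(d, t). d \<ominus> t) ` (?D \<times> T)"
  proof
    fix w assume "w \<in> diff_set R V (dilate R z V)"
    then obtain u v where w: "u \<in> V" "v \<in> V" "w = u \<ominus> z \<otimes> v" by (auto simp: diff_set_def dilate_def)
    obtain t s s' where 1: "t \<in> T" "s \<in> iter_sum R V j" "s' \<in> iter_sum R V j" "z \<otimes> v = t \<oplus> (s \<ominus> s')"
      using T(3) w by blast
    have cc: "t \<in> carrier R" "s \<in> carrier R" "s' \<in> carrier R" "u \<in> carrier R"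
      using 1 T w V iter_sum_closed[OF V(1)] by blast+
    have "w = ((u \<oplus> s') \<ominus> s) \<ominus> t" unfolding w 1 using cc by algebra
    moreover have "u \<oplus> s' \<in> iter_sum R V (Suc j)"
      using w(1) 1(3) unfolding iter_sum.simps mem_set_add by blast
    ultimately show "w \<in> (\<lambda>(d, t). d \<ominus> t) ` (?D \<times> T)"
      using 1 unfolding diff_set_def[of R "iter_sum R V (Suc j)"] by (force simp: image_iff)
  qed
  then have "card (diff_set R V (dilate R z V)) \<le> card ((\<lambda>(d, t). d \<ominus> t) ` (?D \<times> T))"
    using fin by (intro card_mono) auto
  also have "\<dots> \<le> card (?D \<times> T)" using fin by (intro card_image_le) auto
  finally have "real (card (diff_set R V (dilate R z V))) \<le> real (card ?D) * real (card T)"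
    by (metis card_cartesian_product of_nat_le_iff of_nat_mult)
  also have "\<dots> \<le> (K ^ (Suc j + j) * real (card V)) * k"
    using plunnecke_ruzsa[OF fin(2) V(2) V(1) K, of "Suc j" j] T(2) K by (intro mult_mono) auto
  finally show ?thesis by (simp add: algebra_simps mult_2 mult_2_right)
qed

text \<open>For nonzero \<open>x\<close>, Ruzsa's triangle inequality through \<open>x V\<close>,
  where \<open>x V - x y V = x (V - y V)\<close> has the size of \<open>V - y V\<close>.\<close>

lemma small_dilate_mult:
  assumes V: "V \<subseteq> carrier R" "V \<noteq> {}" and xy: "x \<in> carrier R" "y \<in> carrier R" and a: "a \<ge> 0"
    and x: "real (card (diff_set R V (dilate R x V))) \<le> a * real (card V)"
    and y: "real (card (diff_set R V (dilate R y V))) \<le> b * real (card V)"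
  shows "real (card (diff_set R V (dilate R (x \<otimes> y) V))) \<le> a * b * real (card V)"
proof (cases "x = \<zero>")
  \<comment> \<open>Dilation by zero is not injective. Here \<open>x y = x\<close>, so only
    \<open>b >= 1\<close> is missing, and this holds because \<open>V - y V\<close> contains a
    translate of \<open>V\<close>.\<close>
  case True
  have fV: "finite V" using V finite_sub by auto
  obtain v where v: "v \<in> V" using V by blast
  have "card V = card ((\<lambda>u. u \<ominus> y \<otimes> v) ` V)"
    using V v xy card_translate[of V "\<ominus> (y \<otimes> v)"] by (simp add: a_minus_def subset_iff)
  also have "\<dots> \<le> card (diff_set R V (dilate R y V))"
    using fV v by (intro card_mono finite_diff_set) (auto simp: diff_set_def dilate_def)
  finally have "real (card V) \<le> b * real (card V)" using y by linarith
  then have b: "b \<ge> 1" using V fV by (simp add: card_gt_0_iff)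
  have "x \<otimes> y = x" using True xy by simp
  then have "real (card (diff_set R V (dilate R (x \<otimes> y) V))) \<le> a * real (card V)" using x by simp
  also have "\<dots> \<le> a * b * real (card V)" using a b mult_left_mono[of 1 b a] by (intro mult_right_mono) auto
  finally show ?thesis .
next
  case False
  have fV: "finite V" using V finite_sub by auto
  let ?xV = "dilate R x V" and ?z = "dilate R (x \<otimes> y) V"
  have c: "?xV \<subseteq> carrier R" "?z \<subseteq> carrier R" "dilate R y V \<subseteq> carrier R"
    using dilate_closed V xy by auto
  have "diff_set R ?z ?xV = dilate R x (diff_set R (dilate R y V) V)"
    using V xy unfolding diff_set_def dilate_def image_image
    by (force simp: image_iff subset_iff m_assoc r_distr r_minus a_minus_def)
  then have e: "card (diff_set R ?z ?xV) = card (diff_set R V (dilate R y V))"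
    using card_dilate[OF xy(1) False diff_set_closed[OF c(3) V(1)]]
      card_diff_set_swap[OF c(3) V(1)] by simp
  have "card (diff_set R V ?z) * card ?xV \<le> card (diff_set R V ?xV) * card (diff_set R ?z ?xV)"
    by (rule ruzsa_triangle_diff) (use V c finite_sub in auto)
  then have "card (diff_set R V ?z) * card V \<le> card (diff_set R V ?xV) * card (diff_set R V (dilate R y V))"
    unfolding e card_dilate[OF xy(1) False V(1)] .
  then have "real (card (diff_set R V ?z)) * real (card V)
      \<le> real (card (diff_set R V ?xV)) * real (card (diff_set R V (dilate R y V)))"
    by (metis of_nat_le_iff of_nat_mult)
  also have "\<dots> \<le> (a * real (card V)) * (b * real (card V))"
    using x y a by (intro mult_mono) auto
  finally have "real (card (diff_set R V ?z)) * real (card V) \<le> (a * b * real (card V)) * real (card V)"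
    by (simp only: ac_simps)
  then show ?thesis using V fV by (simp add: card_gt_0_iff)
qed

section \<open>From the quotient set \<open>(A - A) / (A - A)\<close>, written without division, to
  a subfield\<close>

definition quotients :: "'a set \<Rightarrow> 'a set" where
  "quotients A = {b \<in> carrier R. \<exists>r\<in>A. \<exists>s\<in>A. \<exists>t\<in>A. \<exists>u\<in>A. t \<noteq> u \<and> b \<otimes> (t \<ominus> u) = r \<ominus> s}"

text \<open>A collision \<open>a - x b = c - x d\<close> with \<open>b\<close> different from
  \<open>d\<close> would exhibit \<open>x\<close> as a quotient of differences, so all
  \<open>|A|^2\<close> values are distinct.\<close>

lemma card_diff_set_not_quotient:
  assumes A: "A \<subseteq> carrier R" and x: "x \<in> carrier R" "x \<notin> quotients A"
  shows "card (diff_set R A (dilate R x A)) = (card A)\<^sup>2"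
proof -
  have "diff_set R A (dilate R x A) = (\<lambda>(a, b). a \<ominus> x \<otimes> b) ` (A \<times> A)"
    unfolding diff_set_def dilate_def by force
  moreover have "inj_on (\<lambda>(a, b). a \<ominus> x \<otimes> b) (A \<times> A)"
  proof (rule inj_onI, clarify)
    fix a b c d assume m: "a \<in> A" "b \<in> A" "c \<in> A" "d \<in> A" and e: "a \<ominus> x \<otimes> b = c \<ominus> x \<otimes> d"
    have cc: "a \<in> carrier R" "b \<in> carrier R" "c \<in> carrier R" "d \<in> carrier R" using m A by auto
    have "x \<otimes> (b \<ominus> d) = a \<ominus> (a \<ominus> x \<otimes> b) \<ominus> x \<otimes> d" using cc x(1) by algebra
    also have "\<dots> = a \<ominus> c" unfolding e using cc x(1) by algebra
    finally have *: "x \<otimes> (b \<ominus> d) = a \<ominus> c" .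
    then have "b = d" using x m unfolding quotients_def by blast
    moreover from this e have "a = c" using cc x by (simp add: a_minus_def)
    ultimately show "a = c \<and> b = d" by simp
  qed
  ultimately show ?thesis by (simp add: card_image card_cartesian_product power2_eq_square)
qed

text \<open>A set \<open>B\<close> that is stable under all maps \<open>b \<mapsto> \<rho> b + \<sigma>\<close> with \<open>\<rho>, \<sigma> \<in> A\<close> is stable under translation by,
  hence contains, everything that is generated by \<open>A\<close>.\<close>

lemma quotients_subfield:
  assumes A: "A \<subseteq> carrier R" "\<zero> \<in> A" "\<one> \<in> A"
    and stable: "\<And>b r s. b \<in> quotients A \<Longrightarrow> r \<in> A \<Longrightarrow> s \<in> A \<Longrightarrow> r \<otimes> b \<oplus> s \<in> quotients A"
  shows "\<exists>K. subfield K R \<and> A \<subseteq> K \<and> K \<subseteq> quotients A"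
proof -
  define B where "B = quotients A"
  have Bc: "B \<subseteq> carrier R" by (auto simp: B_def quotients_def)
  have fB: "finite B" using Bc finite_sub by blast
  have B0: "\<zero> \<in> B"
  proof -
    have "\<zero> \<otimes> (\<zero> \<ominus> \<one>) = \<zero> \<ominus> \<zero>" using A by (simp add: a_minus_def)
    then show ?thesis unfolding B_def quotients_def using A zero_not_one by blast
  qed
  \<comment> \<open>The translations that preserve \<open>B\<close>. Closure under negation needs
    finiteness: an injective self-map of \<open>B\<close> is onto.\<close>
  define H where "H = {h \<in> carrier R. \<forall>b\<in>B. h \<oplus> b \<in> B}"
  have Hc: "H \<subseteq> carrier R" by (auto simp: H_def)
  have HB: "H \<subseteq> B" using B0 unfolding H_def by force
  have surj: "f ` B = B" if "f ` B \<subseteq> B" "inj_on f B" for f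
    using endo_inj_surj[OF fB that] .
  have H0: "\<zero> \<in> H" using Bc by (auto simp: H_def)
  have Hadd: "g \<oplus> h \<in> H" if "g \<in> H" "h \<in> H" for g h
    using that Bc by (auto simp: H_def a_assoc subset_iff)
  have Hneg: "\<ominus> h \<in> H" if h: "h \<in> H" for h
  proof -
    have hc: "h \<in> carrier R" using h Hc by auto
    have "(\<lambda>b. h \<oplus> b) ` B = B"
      by (rule surj) (use h Bc hc in \<open>auto simp: H_def inj_on_def subset_iff\<close>)
    then have "\<exists>b'\<in>B. b = h \<oplus> b'" if "b \<in> B" for b using that by blast
    moreover have "\<ominus> h \<oplus> (h \<oplus> b') = b'" if "b' \<in> B" for b'
      using that Bc hc by (simp add: r_neg1 subset_iff r_neg2)
    ultimately have "\<ominus> h \<oplus> b \<in> B" if "b \<in> B" for b using that by metis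
    then show ?thesis using hc by (auto simp: H_def)
  qed
  have AH: "A \<subseteq> H"
  proof
    fix s assume s: "s \<in> A"
    have "s \<oplus> b \<in> B" if b: "b \<in> B" for b
    proof -
      have "\<one> \<otimes> b \<oplus> s \<in> B" using stable b s A by (auto simp: B_def)
      moreover have "\<one> \<otimes> b \<oplus> s = s \<oplus> b" using b Bc s A by (simp add: a_comm subset_iff)
      ultimately show ?thesis by simp
    qed
    then show "s \<in> H" using s A by (auto simp: H_def)
  qed
  have AHH: "r \<otimes> h \<in> H" if r: "r \<in> A" and h: "h \<in> H" for r h
  proof (cases "r = \<zero>")
    case True
    then show ?thesis using H0 h Hc by auto
  next
    case False
    have rc: "r \<in> carrier R" "h \<in> carrier R" using r A h Hc by auto
    have mem: "r \<otimes> b \<in> B" if b: "b \<in> B" for b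
      using stable[of b r \<zero>] b r A rc Bc by (auto simp: B_def subset_iff)
    \<comment> \<open>Multiplication by \<open>r\<close> permutes \<open>B\<close>, so any
      \<open>b\<close> is \<open>r b'\<close> and \<open>r h + b = r (h + b')\<close> stays in
      \<open>B\<close>.\<close>
    have "(\<lambda>b. r \<otimes> b) ` B = B"
      by (rule surj) (use mem Bc rc False m_lcancel in \<open>auto simp: inj_on_def subset_iff\<close>)
    then have ex: "\<exists>b'\<in>B. b = r \<otimes> b'" if "b \<in> B" for b using that by blast
    have "r \<otimes> h \<oplus> b \<in> B" if b: "b \<in> B" for b
    proof -
      obtain b' where b': "b' \<in> B" "b = r \<otimes> b'" using ex b by blast
      have "r \<otimes> h \<oplus> b = r \<otimes> (h \<oplus> b')" using b' rc Bc by (simp add: r_distr subset_iff)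
      also have "\<dots> \<in> B" using h b' by (intro mem) (auto simp: H_def)
      finally show ?thesis .
    qed
    then show ?thesis using rc by (auto simp: H_def)
  qed
  \<comment> \<open>The multipliers of the additive group \<open>H\<close>. They form a ring, and a
    field by finiteness. The inclusions \<open>A <= K <= H <= B\<close> hold, the second because
    \<open>\<one>\<close> and the third because \<open>\<zero>\<close> is available to act
    on.\<close>
  define K where "K = {x \<in> carrier R. \<forall>h\<in>H. x \<otimes> h \<in> H}"
  have Kc: "K \<subseteq> carrier R" by (auto simp: K_def)
  have AK: "A \<subseteq> K" using AHH A by (auto simp: K_def)
  have sub: "subring K R"
  proof (rule subringI[OF Kc])
    show "\<one> \<in> K" using AK A by auto
    show "\<ominus> h \<in> K" if "h \<in> K" for h
      using that Hc Hneg by (auto simp: K_def l_minus subset_iff)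
    show "h1 \<otimes> h2 \<in> K" if "h1 \<in> K" "h2 \<in> K" for h1 h2
      using that Hc by (auto simp: K_def m_assoc subset_iff)
    show "h1 \<oplus> h2 \<in> K" if "h1 \<in> K" "h2 \<in> K" for h1 h2
      using that Hc Hadd by (auto simp: K_def l_distr subset_iff)
  qed
  have inv: "inv k \<in> K" if k: "k \<in> K - {\<zero>}" for k
  proof -
    have kc: "k \<in> carrier R" "k \<noteq> \<zero>" "k \<in> Units R" using k Kc field_Units by auto
    have "(\<lambda>h. k \<otimes> h) ` H = H"
      by (rule endo_inj_surj)
        (use k kc Hc finite_sub m_lcancel in \<open>auto simp: inj_on_def subset_iff K_def\<close>)
    then have ex: "\<exists>h'\<in>H. h = k \<otimes> h'" if "h \<in> H" for h using that by blast
    have "inv k \<otimes> h \<in> H" if h: "h \<in> H" for h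
    proof -
      obtain h' where h': "h' \<in> H" "h = k \<otimes> h'" using ex h by blast
      have "inv k \<otimes> h = h'"
        using h' kc Hc by (simp add: m_assoc[symmetric] subset_iff)
      then show ?thesis using h' by simp
    qed
    then show ?thesis using kc by (auto simp: K_def)
  qed
  have KH: "K \<subseteq> H"
  proof
    fix x assume x: "x \<in> K"
    then have "x \<otimes> \<one> \<in> H" using AH A unfolding K_def by blast
    then show "x \<in> H" using x Kc by auto
  qed
  have "subfield K R" using sub inv by (rule subfieldI')
  then show ?thesis using AK KH HB unfolding B_def by blast
qed

text \<open>Let \<open>x = r b + s\<close> with \<open>b = (r1 - r2) / (r3 - r4)\<close>. Multiplied
  by \<open>r3 - r4\<close>, an element \<open>u - x v\<close> becomes a signed sum of six products
  of at most three elements of \<open>A\<close>. Each product is covered with cost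
  \<open>K^3\<close>, the sum with cost \<open>K^18\<close> and fold number 6, and the return to
  sizes costs \<open>K^13\<close>, hence the exponent 31. As few multipliers have small dilates,
  \<open>A - x A\<close> is too small to have \<open>|A|^2\<close> elements, so \<open>x\<close> is
  again a quotient and the stability required by \<open>quotients_subfield\<close> follows. A second
  use of \<open>few_small_dilates\<close>, now with \<open>A\<close> in place of \<open>V\<close>,
  bounds the subfield.\<close>

lemma subfield_of_small_dilates:
  assumes V: "V \<subseteq> carrier R" "V \<noteq> {}" and A: "A \<subseteq> carrier R" "\<zero> \<in> A" "\<one> \<in> A"
    and small: "\<And>x. x \<in> A \<Longrightarrow> real (card (diff_set R V (dilate R x V))) \<le> K * real (card V)"
    and K: "K \<ge> 1" and V2: "2 * K ^ 31 \<le> real (card V)"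
    and A2: "4 * K ^ 31 * real (card V) \<le> (real (card A))\<^sup>2"
  shows "\<exists>k. subfield k R \<and> A \<subseteq> k \<and> real (card k) \<le> 4 * K ^ 31 * real (card V)"
proof -
  have K0: "K \<ge> 0" using K by simp
  have fV: "finite V" "finite A" using V A finite_sub by auto
  have V0: "real (card V) > 0" using V fV by (simp add: card_gt_0_iff)
  have VV: "real (card (diff_set R V V)) \<le> K * real (card V)"
  proof -
    have "dilate R \<one> V = V" using V by (force simp: dilate_def image_iff subset_iff)
    then show ?thesis using small[of \<one>] A by simp
  qed
  have cov3: "covered V 1 (K ^ 3) (x \<otimes> y \<otimes> z)" if "x \<in> A" "y \<in> A" "z \<in> A" for x y z
  proof (rule covered_small_dilate[OF V])
    have cc: "x \<in> carrier R" "y \<in> carrier R" "z \<in> carrier R" using that A by auto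
    then show "x \<otimes> y \<otimes> z \<in> carrier R" by simp
    have "real (card (diff_set R V (dilate R (x \<otimes> y) V))) \<le> K * K * real (card V)"
      using small_dilate_mult[OF V cc(1,2) K0] small that by blast
    then have "real (card (diff_set R V (dilate R (x \<otimes> y \<otimes> z) V))) \<le> K * K * K * real (card V)"
      using small_dilate_mult[OF V _ cc(3), of "x \<otimes> y" "K * K" K] small that cc K0 by simp
    then show "real (card (diff_set R V (dilate R (x \<otimes> y \<otimes> z) V))) \<le> K ^ 3 * real (card V)"
      by (simp add: power3_eq_cube)
  qed
  have cov2: "covered V 1 (K ^ 3) (x \<otimes> y)" if "x \<in> A" "y \<in> A" for x y
  proof -
    have "x \<otimes> y \<otimes> \<one> = x \<otimes> y" using that A by (simp add: subset_iff)
    then show ?thesis using cov3[OF that A(3)] by simp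
  qed
  define Z where "Z = {z \<in> carrier R. covered V 6 (K ^ 18) z}"
  have six: "covered V 6 (K ^ 18) (a \<oplus> (b \<oplus> (c \<oplus> (d \<oplus> (e \<oplus> f)))))"
    if cc: "a \<in> carrier R" "b \<in> carrier R" "c \<in> carrier R" "d \<in> carrier R" "e \<in> carrier R" "f \<in> carrier R"
      and cv: "covered V 1 (K ^ 3) a" "covered V 1 (K ^ 3) b" "covered V 1 (K ^ 3) c"
        "covered V 1 (K ^ 3) d" "covered V 1 (K ^ 3) e" "covered V 1 (K ^ 3) f" for a b c d e f
  proof -
    have K3: "K ^ 3 \<ge> 0" using K0 by simp
    note add = covered_add[OF V(1) _ _ _ _ K3]
    have c2: "covered V (1 + 1) (K ^ 3 * K ^ 3) (e \<oplus> f)"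
      by (rule add) (use cc cv in auto)
    have c3: "covered V (1 + (1 + 1)) (K ^ 3 * (K ^ 3 * K ^ 3)) (d \<oplus> (e \<oplus> f))"
      by (rule add[OF cc(4) cv(4) _ c2]) (use cc in auto)
    have c4: "covered V (1 + (1 + (1 + 1))) (K ^ 3 * (K ^ 3 * (K ^ 3 * K ^ 3))) (c \<oplus> (d \<oplus> (e \<oplus> f)))"
      by (rule add[OF cc(3) cv(3) _ c3]) (use cc in auto)
    have c5: "covered V (1 + (1 + (1 + (1 + 1)))) (K ^ 3 * (K ^ 3 * (K ^ 3 * (K ^ 3 * K ^ 3))))
        (b \<oplus> (c \<oplus> (d \<oplus> (e \<oplus> f))))"
      by (rule add[OF cc(2) cv(2) _ c4]) (use cc in auto)
    have "covered V (1 + (1 + (1 + (1 + (1 + 1)))))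
        (K ^ 3 * (K ^ 3 * (K ^ 3 * (K ^ 3 * (K ^ 3 * K ^ 3))))) (a \<oplus> (b \<oplus> (c \<oplus> (d \<oplus> (e \<oplus> f)))))"
      by (rule add[OF cc(1) cv(1) _ c5]) (use cc in auto)
    moreover have "(1 + (1 + (1 + (1 + (1 + (1::nat)))))) = 6" by simp
    moreover have "K ^ 3 * (K ^ 3 * (K ^ 3 * (K ^ 3 * (K ^ 3 * K ^ 3)))) = K ^ 18"
      by (simp flip: power_add)
    ultimately show ?thesis by metis
  qed
  have smallZ: "real (card (diff_set R V (dilate R z V))) \<le> K ^ 31 * real (card V)" if "z \<in> Z" for z
  proof -
    have "real (card (diff_set R V (dilate R z V))) \<le> K ^ 18 * K ^ (6 + 6 + 1) * real (card V)"
      using that K0 by (intro card_diff_set_covered[OF V _ _ K0 VV]) (auto simp: Z_def)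
    then show ?thesis by (simp add: power_add[symmetric])
  qed
  have X: "2 * (K ^ 31 * real (card V)) \<le> (real (card V))\<^sup>2" "K ^ 31 * real (card V) \<ge> 0"
    using V2 V0 K0 by (auto simp: power2_eq_square)
  have few: "real (card S) \<le> 2 * (K ^ 31 * real (card V))" if "S \<subseteq> Z" for S
    using that by (intro few_small_dilates[OF V _ _ X] smallZ) (auto simp: Z_def)
  have key: "real (card (diff_set R A (dilate R (r \<otimes> b \<oplus> s) A))) \<le> 2 * (K ^ 31 * real (card V))"
    if b: "b \<in> quotients A" and r: "r \<in> A" and s: "s \<in> A" for b r s
  proof -
    obtain r1 r2 r3 r4 where q: "r1 \<in> A" "r2 \<in> A" "r3 \<in> A" "r4 \<in> A" "r3 \<noteq> r4"
      "b \<otimes> (r3 \<ominus> r4) = r1 \<ominus> r2"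
      using b unfolding quotients_def by blast
    have bc: "b \<in> carrier R" using b by (auto simp: quotients_def)
    have cc: "r1 \<in> carrier R" "r2 \<in> carrier R" "r3 \<in> carrier R" "r4 \<in> carrier R"
      "r \<in> carrier R" "s \<in> carrier R"
      using q r s A by auto
    let ?x = "r \<otimes> b \<oplus> s" and ?d = "r3 \<ominus> r4"
    have xc: "?x \<in> carrier R" and dc: "?d \<in> carrier R" "?d \<noteq> \<zero>" using bc cc q by auto
    let ?D = "diff_set R A (dilate R ?x A)"
    have Dc: "?D \<subseteq> carrier R" using diff_set_closed A dilate_closed[OF xc] by auto
    have "dilate R ?d ?D \<subseteq> Z"
    proof
      fix w assume "w \<in> dilate R ?d ?D"
      then obtain u v where w: "u \<in> A" "v \<in> A" "w = ?d \<otimes> (u \<ominus> ?x \<otimes> v)"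
        by (auto simp: dilate_def diff_set_def)
      have uv: "u \<in> carrier R" "v \<in> carrier R" using w A by auto
      have "w = ?d \<otimes> u \<ominus> (r \<otimes> (b \<otimes> ?d) \<oplus> s \<otimes> ?d) \<otimes> v"
      proof -
        have "(r \<otimes> (b \<otimes> d) \<oplus> s \<otimes> d) \<otimes> v = d \<otimes> (?x \<otimes> v)" if "d = ?d" for d
          using that[symmetric] dc(1)[folded that] uv cc(5,6) bc by (simp add: l_distr r_distr m_ac)
        from this[OF refl] show ?thesis unfolding w using uv dc xc by (simp add: a_minus_def r_distr r_minus)
      qed
      also have "\<dots> = r3 \<otimes> u \<oplus> (\<ominus> (r4 \<otimes> u) \<oplus> (\<ominus> (r \<otimes> r1 \<otimes> v) \<oplus> (r \<otimes> r2 \<otimes> v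
          \<oplus> (\<ominus> (s \<otimes> r3 \<otimes> v) \<oplus> s \<otimes> r4 \<otimes> v))))"
      proof -
        have 1: "?d \<otimes> u = r3 \<otimes> u \<ominus> r4 \<otimes> u" using uv cc by algebra
        have 2: "(r \<otimes> (r1 \<ominus> r2) \<oplus> s \<otimes> ?d) \<otimes> v = (r \<otimes> r1 \<otimes> v \<ominus> r \<otimes> r2 \<otimes> v)
            \<oplus> (s \<otimes> r3 \<otimes> v \<ominus> s \<otimes> r4 \<otimes> v)"
          using uv cc by (simp add: a_minus_def l_distr r_distr l_minus r_minus m_assoc)
        have 3: "(a1 \<ominus> a2) \<ominus> ((a3 \<ominus> a4) \<oplus> (a5 \<ominus> a6))
            = a1 \<oplus> (\<ominus> a2 \<oplus> (\<ominus> a3 \<oplus> (a4 \<oplus> (\<ominus> a5 \<oplus> a6))))"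
          if "a1 \<in> carrier R" "a2 \<in> carrier R" "a3 \<in> carrier R" "a4 \<in> carrier R"
            "a5 \<in> carrier R" "a6 \<in> carrier R" for a1 a2 a3 a4 a5 a6
          using that by (simp add: a_minus_def minus_add a_ac)
        show ?thesis unfolding q(6) 1 2 using uv cc by (intro 3) auto
      qed
      finally have e: "w = r3 \<otimes> u \<oplus> (\<ominus> (r4 \<otimes> u) \<oplus> (\<ominus> (r \<otimes> r1 \<otimes> v) \<oplus> (r \<otimes> r2 \<otimes> v
          \<oplus> (\<ominus> (s \<otimes> r3 \<otimes> v) \<oplus> s \<otimes> r4 \<otimes> v))))" .
      have "covered V 6 (K ^ 18) w"
        unfolding e
        by (intro six covered_neg[OF V(1)] cov2 cov3) (use w q r s cc uv in auto)
      moreover have "w \<in> carrier R" unfolding w using uv cc bc by simp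
      ultimately show "w \<in> Z" by (simp add: Z_def)
    qed
    then have "real (card (dilate R ?d ?D)) \<le> 2 * (K ^ 31 * real (card V))" by (rule few)
    then show ?thesis using card_dilate[OF dc Dc] by simp
  qed
  have A0: "real (card A) > 0" using A fV by (auto simp: card_gt_0_iff)
  have "\<exists>k. subfield k R \<and> A \<subseteq> k \<and> k \<subseteq> quotients A"
  proof (rule quotients_subfield[OF A])
    fix b r s assume h: "b \<in> quotients A" "r \<in> A" "s \<in> A"
    show "r \<otimes> b \<oplus> s \<in> quotients A"
    proof (rule ccontr)
      assume "r \<otimes> b \<oplus> s \<notin> quotients A"
      moreover have "r \<otimes> b \<oplus> s \<in> carrier R" using h A by (auto simp: quotients_def)
      ultimately have "(real (card A))\<^sup>2 \<le> 2 * (K ^ 31 * real (card V))"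
        using key[OF h] card_diff_set_not_quotient[OF A(1)] by simp
      moreover have "(real (card A))\<^sup>2 > 0" using A0 by simp
      ultimately show False using A2 by simp
    qed
  qed
  then obtain k where k: "subfield k R" "A \<subseteq> k" "k \<subseteq> quotients A" by blast
  have kc: "k \<subseteq> carrier R" using k(3) by (auto simp: quotients_def)
  have "real (card k) \<le> 2 * (2 * (K ^ 31 * real (card V)))"
  proof (rule few_small_dilates[OF A(1) _ kc])
    show "A \<noteq> {}" using A by auto
    show "2 * (2 * (K ^ 31 * real (card V))) \<le> (real (card A))\<^sup>2" using A2 by simp
    show "0 \<le> 2 * (K ^ 31 * real (card V))" using X by simp
    show "real (card (diff_set R A (dilate R x A))) \<le> 2 * (K ^ 31 * real (card V))" if "x \<in> k" for x
    proof -
      \<comment> \<open>The choice \<open>r = 1\<close>, \<open>s = 0\<close> makes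
        \<open>key\<close> speak about the quotient \<open>x\<close> itself.\<close>
      have "\<one> \<otimes> x \<oplus> \<zero> = x" using that kc by auto
      then show ?thesis using key[of x \<one> \<zero>] that k A by auto
    qed
  qed
  with k show ?thesis by auto
qed

end

subsection \<open>Balog--Szemeredi--Gowers\<close>

lemma card_filter_sum:
  "finite A \<Longrightarrow> real (card {x \<in> A. P x}) = (\<Sum>x\<in>A. of_bool (P x))"
  by (simp add: sum_of_bool_eq Int_def)

lemma exists_ge_average:
  fixes f :: "'a \<Rightarrow> real"
  assumes "finite A" "A \<noteq> {}" "real (card A) \<le> N" "c \<ge> 0" "N * c \<le> (\<Sum>x\<in>A. f x)"
  shows "\<exists>x\<in>A. c \<le> f x"
proof (rule ccontr)
  assume "\<not> ?thesis"
  then have "(\<Sum>x\<in>A. f x) < (\<Sum>x\<in>A. c)" using assms by (intro sum_strict_mono) auto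
  also have "\<dots> \<le> N * c" using assms by (simp add: mult_right_mono)
  finally show False using assms by simp
qed

lemma card_popular:
  fixes f :: "'a \<Rightarrow> real"
  assumes "finite A" and "\<And>x. x \<in> A \<Longrightarrow> f x \<le> M" and "t \<ge> 0"
  shows "(\<Sum>x\<in>A. f x) \<le> real (card A) * t + real (card {x \<in> A. t \<le> f x}) * M"
proof -
  have "(\<Sum>x\<in>A. f x) = (\<Sum>x\<in>{x \<in> A. t \<le> f x}. f x) + (\<Sum>x\<in>A - {x \<in> A. t \<le> f x}. f x)"
    using assms(1) by (subst sum.subset_diff[of "{x \<in> A. t \<le> f x}" A]) auto
  also have "(\<Sum>x\<in>{x \<in> A. t \<le> f x}. f x) \<le> real (card {x \<in> A. t \<le> f x}) * M"
    using assms(2) by (intro sum_bounded_above) auto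
  also have "(\<Sum>x\<in>A - {x \<in> A. t \<le> f x}. f x) \<le> real (card (A - {x \<in> A. t \<le> f x})) * t"
    by (intro sum_bounded_above) auto
  also have "\<dots> \<le> real (card A) * t"
    using assms by (intro mult_right_mono) (auto intro!: card_mono)
  finally show ?thesis by simp
qed

context finite_field
begin

text \<open>Some neighbourhood \<open>N\<close> in \<open>V\<close> contains few bad pairs, that is,
  pairs with few common neighbours; \<open>W\<close> keeps the vertices of \<open>N\<close> that are
  bad with few others. Two vertices of \<open>W\<close> are joined by many paths
  \<open>v - u1 - w - u2 - v'\<close>, and along such a path \<open>r (v - v')\<close> is the
  alternating sum of the four edge values in the image of \<open>G\<close>. A difference thus uses
  up many quadruples of values, of which there are at most \<open>D^4\<close>.\<close>

lemma bsg_one_sided: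
  assumes U: "U \<subseteq> carrier R" "real (card U) \<le> D" and V: "V \<subseteq> carrier R" "real (card V) \<le> D"
    and G: "G \<subseteq> U \<times> V" "a * D\<^sup>2 \<le> real (card G)" and r: "r \<in> carrier R" "r \<noteq> \<zero>"
    and S: "real (card ((\<lambda>(u, v). u \<oplus> r \<otimes> v) ` G)) \<le> D" and a: "a > 0" and D: "D > 0"
  shows "\<exists>W\<subseteq>V. a * D / 4 \<le> real (card W) \<and> real (card (diff_set R W W)) \<le> 1024 / a ^ 5 * D"
proof -
  have fU: "finite U" and fV: "finite V" using U V finite_sub by auto
  have fG: "finite G" using G fU fV finite_subset by blast
  define nb where "nb = (\<lambda>u. {v \<in> V. (u, v) \<in> G})"
  define co where "co = (\<lambda>v v'. {u \<in> U. (u, v) \<in> G \<and> (u, v') \<in> G})"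
  define bad where "bad = (\<lambda>v v'. real (card (co v v')) < a\<^sup>2 * D / 16)"
  define B where "B = (\<lambda>u. {q \<in> V \<times> V. (u, fst q) \<in> G \<and> (u, snd q) \<in> G \<and> bad (fst q) (snd q)})"
  have fnb: "finite (nb u)" for u using fV by (auto simp: nb_def)
  have fco: "finite (co v v')" for v v' using fU by (auto simp: co_def)
  have coV: "bad v v' \<longleftrightarrow> bad v' v" for v v'
  proof -
    have "co v v' = co v' v" by (auto simp: co_def)
    then show ?thesis by (simp add: bad_def)
  qed
  have "G = Sigma U nb" using G by (auto simp: nb_def)
  then have cG: "real (card G) = (\<Sum>u\<in>U. real (card (nb u)))"
    using fU fnb by (simp add: card_SigmaI)
  have 1: "a\<^sup>2 * D ^ 3 \<le> (\<Sum>u\<in>U. (real (card (nb u)))\<^sup>2)"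
  proof -
    have "(a * D\<^sup>2)\<^sup>2 \<le> (real (card G))\<^sup>2" using G a by (intro power_mono) auto
    also have "\<dots> \<le> (\<Sum>u\<in>U. (real (card (nb u)))\<^sup>2) * real (card U)"
      unfolding cG by (rule sum_squared_le_sum_of_squares)
    also have "\<dots> \<le> (\<Sum>u\<in>U. (real (card (nb u)))\<^sup>2) * D"
      using U by (intro mult_left_mono sum_nonneg) auto
    finally have "(a\<^sup>2 * D ^ 3) * D \<le> (\<Sum>u\<in>U. (real (card (nb u)))\<^sup>2) * D"
      by (simp add: power2_eq_square power3_eq_cube mult_ac)
    then show ?thesis using D by simp
  qed
  have 2: "(\<Sum>u\<in>U. real (card (B u))) \<le> a\<^sup>2 * D ^ 3 / 16"
  proof -
    have "(\<Sum>u\<in>U. real (card (B u))) = (\<Sum>u\<in>U. \<Sum>q\<in>V \<times> V.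
        of_bool ((u, fst q) \<in> G \<and> (u, snd q) \<in> G \<and> bad (fst q) (snd q)))"
      unfolding B_def using fV by (intro sum.cong refl card_filter_sum) auto
    also have "\<dots> = (\<Sum>q\<in>V \<times> V. \<Sum>u\<in>U.
        of_bool ((u, fst q) \<in> G \<and> (u, snd q) \<in> G \<and> bad (fst q) (snd q)))"
      by (rule sum.swap)
    also have "\<dots> \<le> (\<Sum>q\<in>V \<times> V. a\<^sup>2 * D / 16)"
    proof (rule sum_mono)
      fix q
      have "(\<Sum>u\<in>U. of_bool ((u, fst q) \<in> G \<and> (u, snd q) \<in> G \<and> bad (fst q) (snd q)))
          = real (card {u \<in> U. (u, fst q) \<in> G \<and> (u, snd q) \<in> G \<and> bad (fst q) (snd q)})"
        using fU by (rule card_filter_sum[symmetric])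
      also have "\<dots> \<le> a\<^sup>2 * D / 16"
        using D by (cases "bad (fst q) (snd q)") (auto simp: bad_def co_def)
      finally show "(\<Sum>u\<in>U. of_bool ((u, fst q) \<in> G \<and> (u, snd q) \<in> G \<and> bad (fst q) (snd q)))
          \<le> a\<^sup>2 * D / 16" .
    qed
    also have "\<dots> = (real (card V) * real (card V)) * (a\<^sup>2 * D / 16)"
      by (simp add: card_cartesian_product)
    also have "\<dots> \<le> (D * D) * (a\<^sup>2 * D / 16)"
      using V D by (intro mult_right_mono mult_mono) auto
    also have "\<dots> = a\<^sup>2 * D ^ 3 / 16" by (simp add: power3_eq_cube)
    finally show ?thesis .
  qed
  have "0 < a * D\<^sup>2" using a D by simp
  then have "card G \<noteq> 0" using G by linarith
  then have "U \<noteq> {}" using G by auto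
  \<comment> \<open>The weight 8 makes the bad pairs cost half of the second moment:
    \<open>8 * a^2 D^3 / 16\<close> against \<open>a^2 D^3\<close>. A vertex above the average of
    the remainder has a large neighbourhood and at most \<open>n^2 / 8\<close> bad pairs
    simultaneously.\<close>
  then have "\<exists>u\<in>U. a\<^sup>2 * D\<^sup>2 / 2 \<le> (real (card (nb u)))\<^sup>2 - 8 * real (card (B u))"
  proof (intro exists_ge_average[OF fU _ U(2)])
    have "D * (a\<^sup>2 * D\<^sup>2 / 2) = a\<^sup>2 * D ^ 3 / 2" by (simp add: power2_eq_square power3_eq_cube)
    also have "\<dots> \<le> (\<Sum>u\<in>U. (real (card (nb u)))\<^sup>2) - 8 * (\<Sum>u\<in>U. real (card (B u)))"
      using 1 2 by simp
    finally show "D * (a\<^sup>2 * D\<^sup>2 / 2) \<le> (\<Sum>u\<in>U. (real (card (nb u)))\<^sup>2 - 8 * real (card (B u)))"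
      by (simp add: sum_subtractf sum_distrib_left)
  qed auto
  then obtain u where u: "u \<in> U" "a\<^sup>2 * D\<^sup>2 / 2 \<le> (real (card (nb u)))\<^sup>2 - 8 * real (card (B u))" by blast
  define N where "N = nb u"
  define n where "n = real (card N)"
  have fN: "finite N" "N \<subseteq> V" using fnb by (auto simp: N_def nb_def)
  have nsq: "(a * D)\<^sup>2 / 2 + 8 * real (card (B u)) \<le> n\<^sup>2"
    using u(2) by (simp add: n_def N_def power_mult_distrib)
  have "(a * D)\<^sup>2 / 4 \<le> n\<^sup>2" using nsq zero_le_power2[of "a * D"] by linarith
  then have "(a * D / 2)\<^sup>2 \<le> n\<^sup>2"
    by (simp add: power_divide)
  then have n: "a * D / 2 \<le> n" by (rule power2_le_imp_le) (simp add: n_def)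
  then have n0: "n > 0" using a D by (smt (verit) divide_pos_pos mult_pos_pos)
  have B8: "real (card (B u)) \<le> n\<^sup>2 / 8" using nsq zero_le_power2[of "a * D"] by linarith
  \<comment> \<open>Markov's inequality: with at most \<open>n^2 / 8\<close> bad pairs, at most
    \<open>n / 2\<close> vertices are bad with more than \<open>n / 4\<close> others. Two vertices
    of \<open>W\<close> therefore share \<open>n / 2\<close> partners \<open>w\<close> that are good
    for both.\<close>
  define W where "W = {v \<in> N. real (card {v' \<in> N. bad v v'}) \<le> n / 4}"
  have WN: "W \<subseteq> N" by (auto simp: W_def)
  have "real (card (N - W)) * (n / 4) \<le> n\<^sup>2 / 8"
  proof -
    have "real (card (N - W)) * (n / 4) = (\<Sum>v\<in>N - W. n / 4)" by simp
    also have "\<dots> \<le> (\<Sum>v\<in>N - W. real (card {v' \<in> N. bad v v'}))"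
      by (intro sum_mono) (auto simp: W_def)
    also have "\<dots> \<le> (\<Sum>v\<in>N. real (card {v' \<in> N. bad v v'}))"
      using fN by (intro sum_mono2) auto
    also have "\<dots> = real (card (SIGMA v:N. {v' \<in> N. bad v v'}))"
      using fN by (subst card_SigmaI) auto
    also have "(SIGMA v:N. {v' \<in> N. bad v v'}) = B u" by (auto simp: B_def N_def nb_def)
    finally show ?thesis using B8 by linarith
  qed
  then have NW: "real (card (N - W)) \<le> n / 2" using n0 by (simp add: power2_eq_square field_simps)
  have cW: "n / 2 \<le> real (card W)"
  proof -
    have "card N = card W + card (N - W)"
      using card_Diff_subset[OF finite_subset[OF WN fN(1)] WN] card_mono[OF fN(1) WN] by simp
    then show ?thesis using NW by (simp add: n_def)
  qed
  let ?S = "(\<lambda>(u, v). u \<oplus> r \<otimes> v) ` G"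
  let ?D0 = "diff_set R W W"
  define good where "good = (\<lambda>v v'. {w \<in> N. \<not> bad v w \<and> \<not> bad v' w})"
  have cgood: "n / 2 \<le> real (card (good v v'))" if "v \<in> W" "v' \<in> W" for v v'
  proof -
    let ?b = "\<lambda>v. {w \<in> N. bad v w}"
    have "N = good v v' \<union> (?b v \<union> ?b v')" by (auto simp: good_def)
    then have "card N \<le> card (good v v') + (card (?b v) + card (?b v'))"
      using card_Un_le[of "good v v'" "?b v \<union> ?b v'"] card_Un_le[of "?b v" "?b v'"] by simp
    moreover have "real (card (?b v)) \<le> n / 4" "real (card (?b v')) \<le> n / 4"
      using that by (auto simp: W_def)
    ultimately show ?thesis unfolding n_def by linarith
  qed
  have "\<exists>f. \<forall>d\<in>?D0. fst (f d) \<in> W \<and> snd (f d) \<in> W \<and> d = fst (f d) \<ominus> snd (f d)"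
    by (rule bchoice) (auto simp: diff_set_def)
  then obtain f where f: "\<And>d. d \<in> ?D0 \<Longrightarrow> fst (f d) \<in> W \<and> snd (f d) \<in> W \<and> d = fst (f d) \<ominus> snd (f d)"
    by blast
  \<comment> \<open>The paths of length four between the chosen representatives of \<open>d\<close>.
    At least \<open>a D / 4\<close> middle vertices, with \<open>a^2 D / 16\<close> choices for each
    of \<open>u1\<close> and \<open>u2\<close>, give the bound
    \<open>a^5 D^3 / 1024\<close>.\<close>
  define T where "T = (\<lambda>d. SIGMA w:good (fst (f d)) (snd (f d)). co (fst (f d)) w \<times> co (snd (f d)) w)"
  have fgood: "finite (good v v')" for v v' using fN by (auto simp: good_def)
  have cT: "a ^ 5 * D ^ 3 / 1024 \<le> real (card (T d))" if d: "d \<in> ?D0" for d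
  proof -
    note fd = f[OF d]
    have "a ^ 5 * D ^ 3 / 1024 = (a * D / 4) * ((a\<^sup>2 * D / 16) * (a\<^sup>2 * D / 16))"
      by (simp add: power2_eq_square power3_eq_cube power_def numeral_eq_Suc)
    also have "\<dots> \<le> real (card (good (fst (f d)) (snd (f d)))) * ((a\<^sup>2 * D / 16) * (a\<^sup>2 * D / 16))"
      using cgood[of "fst (f d)" "snd (f d)"] fd n D by (intro mult_right_mono) auto
    also have "\<dots> = (\<Sum>w\<in>good (fst (f d)) (snd (f d)). (a\<^sup>2 * D / 16) * (a\<^sup>2 * D / 16))" by simp
    also have "\<dots> \<le> (\<Sum>w\<in>good (fst (f d)) (snd (f d)).
        real (card (co (fst (f d)) w)) * real (card (co (snd (f d)) w)))"
      using D by (intro sum_mono mult_mono) (auto simp: good_def bad_def)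
    also have "\<dots> = real (card (T d))"
      unfolding T_def using fgood fco by (subst card_SigmaI) (auto simp: card_cartesian_product)
    finally show ?thesis .
  qed
  have fD0: "finite ?D0" using WN fN finite_subset by (intro finite_diff_set) blast+
  have fT: "finite (T d)" for d unfolding T_def using fgood fco by auto
  let ?g = "\<lambda>(d, w, u1, u2). (u1 \<oplus> r \<otimes> fst (f d), u1 \<oplus> r \<otimes> w, u2 \<oplus> r \<otimes> w, u2 \<oplus> r \<otimes> snd (f d))"
  have Nc: "N \<subseteq> carrier R" using fN V by auto
  have inj: "inj_on ?g (Sigma ?D0 T)"
  proof (rule inj_onI)
    fix x x' assume x: "x \<in> Sigma ?D0 T" "x' \<in> Sigma ?D0 T" "?g x = ?g x'"
    obtain d w u1 u2 d' w' u1' u2' where xx: "x = (d, w, u1, u2)" "x' = (d', w', u1', u2')"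
      by (metis prod_cases4)
    have d: "d \<in> ?D0" "d' \<in> ?D0" and t: "(w, u1, u2) \<in> T d" "(w', u1', u2') \<in> T d'"
      and e: "u1 \<oplus> r \<otimes> fst (f d) = u1' \<oplus> r \<otimes> fst (f d')" "u1 \<oplus> r \<otimes> w = u1' \<oplus> r \<otimes> w'"
        "u2 \<oplus> r \<otimes> w = u2' \<oplus> r \<otimes> w'" "u2 \<oplus> r \<otimes> snd (f d) = u2' \<oplus> r \<otimes> snd (f d')"
      using x unfolding xx by auto
    note fd = f[OF d(1)] and fd' = f[OF d(2)]
    have cc: "w \<in> carrier R" "w' \<in> carrier R" "u1 \<in> carrier R" "u1' \<in> carrier R" "u2 \<in> carrier R"
      "u2' \<in> carrier R"
      using t Nc U by (auto simp: T_def good_def co_def)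
    have fc: "fst (f d) \<in> carrier R" "snd (f d) \<in> carrier R" "fst (f d') \<in> carrier R" "snd (f d') \<in> carrier R"
      using fd fd' WN Nc by auto
    have id: "((p \<oplus> r \<otimes> x) \<ominus> (p \<oplus> r \<otimes> y)) \<oplus> ((q \<oplus> r \<otimes> y) \<ominus> (q \<oplus> r \<otimes> z)) = r \<otimes> (x \<ominus> z)"
      if "p \<in> carrier R" "q \<in> carrier R" "x \<in> carrier R" "y \<in> carrier R" "z \<in> carrier R" for p q x y z
      using that r(1) by algebra
    have "r \<otimes> (fst (f d) \<ominus> snd (f d)) = r \<otimes> (fst (f d') \<ominus> snd (f d'))"
      using id[of u1 u2 "fst (f d)" w "snd (f d)"] id[of u1' u2' "fst (f d')" w' "snd (f d')"] cc fc
      unfolding e by simp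
    then have "r \<otimes> d = r \<otimes> d'" using fd fd' by simp
    then have dd: "d = d'"
      using m_lcancel[OF r(2) r(1), of d d'] d diff_set_closed[of W W] WN Nc by blast
    then have "u1 = u1'" "u2 = u2'" using e(1,4) cc fc r by auto
    moreover from this have "r \<otimes> w = r \<otimes> w'" using e(2) cc r by auto
    then have "w = w'" using m_lcancel[OF r(2) r(1)] cc by blast
    ultimately show "x = x'" using dd xx by simp
  qed
  have "?g ` Sigma ?D0 T \<subseteq> ?S \<times> ?S \<times> ?S \<times> ?S"
    by (auto simp: T_def co_def)
  then have "card (Sigma ?D0 T) \<le> card (?S \<times> ?S \<times> ?S \<times> ?S)"
    using inj fG by (intro card_inj_on_le[of ?g]) auto
  then have "real (card (Sigma ?D0 T)) \<le> real (card (?S \<times> ?S \<times> ?S \<times> ?S))" by simp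
  also have "\<dots> = real (card ?S) ^ 4" by (simp add: card_cartesian_product power4_eq_xxxx mult.assoc)
  also have "\<dots> \<le> D ^ 4" using S by (intro power_mono) auto
  finally have up: "real (card (Sigma ?D0 T)) \<le> D ^ 4" .
  have "real (card ?D0) * (a ^ 5 * D ^ 3 / 1024) = (\<Sum>d\<in>?D0. a ^ 5 * D ^ 3 / 1024)" by simp
  also have "\<dots> \<le> (\<Sum>d\<in>?D0. real (card (T d)))" by (intro sum_mono cT)
  also have "\<dots> = real (card (Sigma ?D0 T))" using fD0 fT by (subst card_SigmaI) auto
  finally have "real (card ?D0) * (a ^ 5 / 1024) * D ^ 3 \<le> D * D ^ 3"
    using up by (simp add: power4_eq_xxxx power3_eq_cube mult_ac)
  then have "real (card ?D0) * (a ^ 5 / 1024) \<le> D" using D by simp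
  then have "real (card ?D0) \<le> 1024 / a ^ 5 * D" using a by (simp add: field_simps)
  moreover have "a * D / 4 \<le> real (card W)" using n cW by simp
  moreover have "W \<subseteq> V" using WN fN by blast
  ultimately show ?thesis by blast
qed

text \<open>One set \<open>W\<close> has to serve many \<open>r\<close>. For many \<open>r\<close> a
  popular value \<open>w r\<close> gives a large set \<open>Ur r\<close> inside
  \<open>w r - r W\<close>. Some \<open>Ur r\<close> meets many \<open>Ur s\<close> in a large set
  \<open>B\<close>; both \<open>B + r W\<close> and \<open>B + s W\<close> lie in translates of
  dilates of \<open>W - W\<close>, and the triangle inequality through \<open>B\<close> bounds
  \<open>s W - r W\<close>.\<close>

lemma common_small_dilates:
  assumes U: "U \<subseteq> carrier R" "real (card U) \<le> D" and V: "V \<subseteq> carrier R" "real (card V) \<le> D"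
    and A: "A \<subseteq> carrier R - {\<zero>}" "A \<noteq> {}"
    and G: "\<And>r. r \<in> A \<Longrightarrow> G r \<subseteq> U \<times> V" "\<And>r. r \<in> A \<Longrightarrow> 2 * a * D\<^sup>2 \<le> real (card (G r))"
    and S: "\<And>r. r \<in> A \<Longrightarrow> real (card ((\<lambda>(u, v). u \<oplus> r \<otimes> v) ` G r)) \<le> D"
    and a: "a > 0" "a \<le> 1" and D: "D > 0"
  shows "\<exists>W\<subseteq>V. \<exists>r\<in>A. \<exists>A'\<subseteq>A. a * D / 4 \<le> real (card W)
     \<and> a ^ 4 / 64 * real (card A) \<le> real (card A')
     \<and> real (card (diff_set R W W)) \<le> 4096 / a ^ 6 * real (card W)
     \<and> (\<forall>s\<in>A'. real (card (diff_set R (dilate R s W) (dilate R r W))) \<le> 2 ^ 29 / a ^ 15 * real (card W))"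
proof -
  have fU: "finite U" and fV: "finite V" and fA: "finite A"
    using U V A(1) by (auto intro!: finite_sub)
  define k where "k = real (card A)"
  have k: "k > 0" using A fA by (simp add: k_def card_gt_0_iff)
  have fG: "finite (G r)" if "r \<in> A" for r using G(1)[OF that] fU fV finite_subset by blast
  define deg where "deg = (\<lambda>r v. real (card {u \<in> U. (u, v) \<in> G r}))"
  have slice: "(\<Sum>v\<in>X. deg r v) = real (card {q \<in> G r. snd q \<in> X})" if "r \<in> A" "X \<subseteq> V" for r X
  proof -
    have fX: "finite X" using that fV finite_subset by blast
    have "(\<Sum>v\<in>X. deg r v) = real (card (SIGMA v:X. {u \<in> U. (u, v) \<in> G r}))"
      unfolding deg_def using fX fU by (subst card_SigmaI) auto
    also have "(SIGMA v:X. {u \<in> U. (u, v) \<in> G r}) = prod.swap ` {q \<in> G r. snd q \<in> X}"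
      using G(1)[OF that(1)] by (auto simp: image_iff Bex_def)
    also have "card \<dots> = card {q \<in> G r. snd q \<in> X}" by (rule card_image) auto
    finally show ?thesis .
  qed
  \<comment> \<open>Degrees are averaged over all of \<open>A\<close> before any single
    \<open>r\<close> is chosen. Whatever subset \<open>W\<close> of \<open>V1\<close> is found
    afterwards, the graphs together keep at least \<open>a k D\<close> edges at each of its
    elements.\<close>
  define V1 where "V1 = {v \<in> V. a * k * D \<le> (\<Sum>r\<in>A. deg r v)}"
  have V1: "V1 \<subseteq> V" by (auto simp: V1_def)
  have "(\<Sum>v\<in>V. \<Sum>r\<in>A. deg r v) = (\<Sum>r\<in>A. \<Sum>v\<in>V. deg r v)" by (rule sum.swap)
  also have "\<dots> \<ge> (\<Sum>r\<in>A. 2 * a * D\<^sup>2)"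
  proof (rule sum_mono)
    fix r assume r: "r \<in> A"
    have "{q \<in> G r. snd q \<in> V} = G r" using G(1)[OF r] by auto
    then show "2 * a * D\<^sup>2 \<le> (\<Sum>v\<in>V. deg r v)" using slice[OF r, of V] G(2)[OF r] by simp
  qed
  finally have tot: "k * (2 * a * D\<^sup>2) \<le> (\<Sum>v\<in>V. \<Sum>r\<in>A. deg r v)" by (simp add: k_def)
  have "(\<Sum>v\<in>V - V1. \<Sum>r\<in>A. deg r v) \<le> (\<Sum>v\<in>V - V1. a * k * D)"
    by (intro sum_mono) (auto simp: V1_def)
  also have "\<dots> = real (card (V - V1)) * (a * k * D)" by simp
  also have "\<dots> \<le> D * (a * k * D)"
  proof (intro mult_right_mono)
    have "card (V - V1) \<le> card V" using fV by (intro card_mono) auto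
    then show "real (card (V - V1)) \<le> D" using V by linarith
  qed (use a k D in auto)
  finally have rem: "(\<Sum>v\<in>V - V1. \<Sum>r\<in>A. deg r v) \<le> k * (a * D\<^sup>2)"
    by (simp add: power2_eq_square mult_ac)
  have "(\<Sum>v\<in>V. \<Sum>r\<in>A. deg r v) = (\<Sum>v\<in>V - V1. \<Sum>r\<in>A. deg r v) + (\<Sum>v\<in>V1. \<Sum>r\<in>A. deg r v)"
    using fV V1 by (rule sum.subset_diff[rotated])
  then have "k * (a * D\<^sup>2) \<le> (\<Sum>v\<in>V1. \<Sum>r\<in>A. deg r v)" using tot rem by (simp add: algebra_simps)
  also have "\<dots> = (\<Sum>r\<in>A. \<Sum>v\<in>V1. deg r v)" by (rule sum.swap)
  finally have "\<exists>r\<in>A. a * D\<^sup>2 \<le> (\<Sum>v\<in>V1. deg r v)"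
    using a by (intro exists_ge_average[OF fA A(2), of k]) (auto simp: k_def)
  then obtain r0 where r0: "r0 \<in> A" "a * D\<^sup>2 \<le> real (card {q \<in> G r0. snd q \<in> V1})"
    using slice[OF _ V1] by auto
  have "\<exists>W\<subseteq>V1. a * D / 4 \<le> real (card W) \<and> real (card (diff_set R W W)) \<le> 1024 / a ^ 5 * D"
  proof (rule bsg_one_sided[OF U])
    show "V1 \<subseteq> carrier R" using V1 V by blast
    have "card V1 \<le> card V" using fV V1 by (intro card_mono) auto
    then show "real (card V1) \<le> D" using V by linarith
    show "{q \<in> G r0. snd q \<in> V1} \<subseteq> U \<times> V1" using G(1)[OF r0(1)] by auto
    show "a * D\<^sup>2 \<le> real (card {q \<in> G r0. snd q \<in> V1})" by (rule r0)
    show "r0 \<in> carrier R" "r0 \<noteq> \<zero>" using r0 A by auto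
    have "card ((\<lambda>(u, v). u \<oplus> r0 \<otimes> v) ` {q \<in> G r0. snd q \<in> V1}) \<le> card ((\<lambda>(u, v). u \<oplus> r0 \<otimes> v) ` G r0)"
      using fG[OF r0(1)] by (intro card_mono image_mono) auto
    then show "real (card ((\<lambda>(u, v). u \<oplus> r0 \<otimes> v) ` {q \<in> G r0. snd q \<in> V1})) \<le> D"
      using S[OF r0(1)] by linarith
  qed (use a D in auto)
  then obtain W where W: "W \<subseteq> V1" "a * D / 4 \<le> real (card W)"
    "real (card (diff_set R W W)) \<le> 1024 / a ^ 5 * D" by blast
  define m where "m = real (card W)"
  have Wc: "W \<subseteq> carrier R" "W \<subseteq> V" using W V1 V by auto
  have fW: "finite W" using Wc finite_sub by blast
  have m0: "m > 0" using W(2) a D unfolding m_def by (smt (verit) divide_pos_pos mult_pos_pos)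
  have Dm: "D \<le> 4 / a * m" using W(2) a by (simp add: m_def field_simps)
  have mD: "m \<le> D"
  proof -
    have "card W \<le> card V" using Wc fV by (intro card_mono) auto
    then show ?thesis using V by (simp add: m_def)
  qed
  have dW: "real (card (diff_set R W W)) \<le> 4096 / a ^ 6 * m"
  proof -
    have "1024 / a ^ 5 * D \<le> 1024 / a ^ 5 * (4 / a * m)" using Dm a by (intro mult_left_mono) auto
    also have "\<dots> = 4096 / a ^ 6 * m" using a by (simp add: field_simps numeral_eq_Suc)
    finally show ?thesis using W(3) by simp
  qed
  define g where "g = (\<lambda>r. {q \<in> G r. snd q \<in> W})"
  have fg: "finite (g r)" if "r \<in> A" for r using fG[OF that] by (auto simp: g_def)
  have "k * (m * a * D) = (\<Sum>v\<in>W. a * k * D)" by (simp add: m_def)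
  also have "\<dots> \<le> (\<Sum>v\<in>W. \<Sum>r\<in>A. deg r v)" using W by (intro sum_mono) (auto simp: V1_def)
  also have "\<dots> = (\<Sum>r\<in>A. \<Sum>v\<in>W. deg r v)" by (rule sum.swap)
  also have "\<dots> = (\<Sum>r\<in>A. real (card (g r)))"
    unfolding g_def using slice Wc by (intro sum.cong) auto
  finally have gtot: "k * (m * a * D) \<le> (\<Sum>r\<in>A. real (card (g r)))" .
  have gmax: "real (card (g r)) \<le> m * D" if r: "r \<in> A" for r
  proof -
    have "card (g r) \<le> card (U \<times> W)" using G(1)[OF r] fU fW by (intro card_mono) (auto simp: g_def)
    then have "real (card (g r)) \<le> real (card U) * m"
      by (metis card_cartesian_product m_def of_nat_le_iff of_nat_mult)
    also have "\<dots> \<le> D * m" using U m0 by (intro mult_right_mono) auto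
    finally show ?thesis by (simp add: mult.commute)
  qed
  define A1 where "A1 = {r \<in> A. m * a * D / 2 \<le> real (card (g r))}"
  have "k * (m * a * D) \<le> k * (m * a * D / 2) + real (card A1) * (m * D)"
    using gtot card_popular[of A "\<lambda>r. real (card (g r))" "m * D" "m * a * D / 2"] fA gmax m0 a D by (simp add: A1_def k_def)
  then have "(k * a / 2) * (m * D) \<le> real (card A1) * (m * D)" by (simp add: algebra_simps)
  then have A1: "k * a / 2 \<le> real (card A1)" using m0 D by simp
  have fA1: "finite A1" "A1 \<subseteq> A" using fA by (auto simp: A1_def)
  have "k * a > 0" using k a by simp
  then have ne1: "A1 \<noteq> {}" using A1 by auto
  have "\<exists>w\<in>(\<lambda>(u, v). u \<oplus> r \<otimes> v) ` G r. m * a / 2 \<le> real (card {q \<in> g r. fst q \<oplus> r \<otimes> snd q = w})"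
    if r: "r \<in> A1" for r
  proof -
    have rA: "r \<in> A" using r fA1 by auto
    let ?I = "(\<lambda>(u, v). u \<oplus> r \<otimes> v) ` G r"
    have gp: "m * a * D / 2 \<le> real (card (g r))" using r by (simp add: A1_def)
    have "m * a * D > 0" using m0 a D by simp
    then have ne: "g r \<noteq> {}" using gp by auto
    show ?thesis
    proof (rule exists_ge_average[OF _ _ S[OF rA]])
      show "finite ?I" using fG[OF rA] by auto
      show "?I \<noteq> {}" using ne by (auto simp: g_def)
      show "0 \<le> m * a / 2" using m0 a by simp
      have "g r = (\<Union>w\<in>?I. {q \<in> g r. fst q \<oplus> r \<otimes> snd q = w})" by (force simp: g_def)
      then have "card (g r) = card (\<Union>w\<in>?I. {q \<in> g r. fst q \<oplus> r \<otimes> snd q = w})" by simp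
      also have "\<dots> = (\<Sum>w\<in>?I. card {q \<in> g r. fst q \<oplus> r \<otimes> snd q = w})"
        using fg[OF rA] fG[OF rA] by (intro card_UN_disjoint) auto
      finally show "D * (m * a / 2) \<le> (\<Sum>w\<in>?I. real (card {q \<in> g r. fst q \<oplus> r \<otimes> snd q = w}))"
        using gp by (simp add: mult_ac)
    qed
  qed
  then have "\<exists>w. \<forall>r\<in>A1. w r \<in> (\<lambda>(u, v). u \<oplus> r \<otimes> v) ` G r \<and>
      m * a / 2 \<le> real (card {q \<in> g r. fst q \<oplus> r \<otimes> snd q = w r})"
    by (intro bchoice) blast
  then obtain w where w: "\<And>r. r \<in> A1 \<Longrightarrow> w r \<in> (\<lambda>(u, v). u \<oplus> r \<otimes> v) ` G r \<and>
      m * a / 2 \<le> real (card {q \<in> g r. fst q \<oplus> r \<otimes> snd q = w r})" by blast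
  \<comment> \<open>Since \<open>g r\<close> has at least \<open>m a D / 2\<close> edges and at most
    \<open>D\<close> values, some value \<open>w r\<close> is taken \<open>m a / 2\<close> times.
    Either coordinate of an edge with this value determines the other, so \<open>Ur r\<close> has
    between \<open>m a / 2\<close> and \<open>m\<close> elements.\<close>
  define Ur where "Ur = (\<lambda>r. fst ` {q \<in> g r. fst q \<oplus> r \<otimes> snd q = w r})"
  have gUW: "q \<in> U \<times> W" if "r \<in> A1" "q \<in> g r" for r q
    using that G(1)[of r] fA1(2) by (cases q) (auto simp: g_def)
  have rc: "r \<in> carrier R" "r \<noteq> \<zero>" if "r \<in> A1" for r using that fA1 A by auto
  have UrU: "Ur r \<subseteq> U" if "r \<in> A1" for r using gUW[OF that] by (auto simp: Ur_def)
  have Urep: "\<exists>v\<in>W. u \<oplus> r \<otimes> v = w r" if "r \<in> A1" "u \<in> Ur r" for r u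
    using that gUW[OF that(1)] by (force simp: Ur_def)
  have inj1: "inj_on fst {q \<in> g r. fst q \<oplus> r \<otimes> snd q = w r}" if r: "r \<in> A1" for r
  proof (rule inj_onI, clarify)
    fix u v u' v'
    assume h: "(u, v) \<in> g r" "(u', v') \<in> g r" "fst (u, v) \<oplus> r \<otimes> snd (u, v) = w r"
      "fst (u', v') \<oplus> r \<otimes> snd (u', v') = w r" "fst (u, v) = fst (u', v')"
    have cc: "u \<in> carrier R" "v \<in> carrier R" "v' \<in> carrier R"
      using gUW[OF r h(1)] gUW[OF r h(2)] U Wc by auto
    have "u \<oplus> r \<otimes> v = u \<oplus> r \<otimes> v'" using h by simp
    then have "r \<otimes> v = r \<otimes> v'" using cc rc[OF r] by auto
    then show "u = u' \<and> v = v'" using h(5) m_lcancel[OF rc(2)[OF r] rc(1)[OF r]] cc by auto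
  qed
  have cUr: "m * a / 2 \<le> real (card (Ur r))" if "r \<in> A1" for r
    unfolding Ur_def using w[OF that] card_image[OF inj1[OF that]] by simp
  have cUr2: "real (card (Ur r)) \<le> m" if r: "r \<in> A1" for r
  proof -
    have "inj_on snd {q \<in> g r. fst q \<oplus> r \<otimes> snd q = w r}"
    proof (rule inj_onI, clarify)
      fix u v u' v'
      assume h: "(u, v) \<in> g r" "(u', v') \<in> g r" "fst (u, v) \<oplus> r \<otimes> snd (u, v) = w r"
        "fst (u', v') \<oplus> r \<otimes> snd (u', v') = w r" "snd (u, v) = snd (u', v')"
      have cc: "u \<in> carrier R" "u' \<in> carrier R" "v' \<in> carrier R"
        using gUW[OF r h(1)] gUW[OF r h(2)] U Wc by auto
      have "u \<oplus> r \<otimes> v' = u' \<oplus> r \<otimes> v'" using h by simp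
      then show "u = u' \<and> v = v'" using h(5) cc rc[OF r] by auto
    qed
    then have "card {q \<in> g r. fst q \<oplus> r \<otimes> snd q = w r} \<le> card W"
      using gUW[OF r] fW by (intro card_inj_on_le[of snd]) auto
    then show ?thesis unfolding Ur_def m_def using card_image[OF inj1[OF r]] by simp
  qed
  \<comment> \<open>Cauchy--Schwarz over \<open>U\<close> for the multiplicity with which the sets
    \<open>Ur r\<close> cover a point.\<close>
  have cover: "(\<Sum>r\<in>A1. real (card (Ur r)))\<^sup>2 \<le> (\<Sum>r\<in>A1. \<Sum>s\<in>A1. real (card (Ur r \<inter> Ur s))) * D"
  proof -
    let ?c = "\<lambda>u. \<Sum>r\<in>A1. of_bool (u \<in> Ur r) :: real"
    have cnt: "real (card X) = (\<Sum>u\<in>U. of_bool (u \<in> X))" if "X \<subseteq> U" for X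
    proof -
      have "{u \<in> U. u \<in> X} = X" using that by auto
      then show ?thesis using card_filter_sum[OF fU, of "\<lambda>u. u \<in> X"] by simp
    qed
    have "(\<Sum>r\<in>A1. real (card (Ur r))) = (\<Sum>r\<in>A1. \<Sum>u\<in>U. of_bool (u \<in> Ur r))"
      using UrU cnt by (intro sum.cong) auto
    also have "\<dots> = (\<Sum>u\<in>U. ?c u)" by (rule sum.swap)
    finally have "(\<Sum>r\<in>A1. real (card (Ur r)))\<^sup>2 \<le> (\<Sum>u\<in>U. (?c u)\<^sup>2) * real (card U)"
      using sum_squared_le_sum_of_squares[of ?c U] by simp
    also have "\<dots> \<le> (\<Sum>u\<in>U. (?c u)\<^sup>2) * D" using U by (intro mult_left_mono sum_nonneg) auto
    also have "(\<Sum>u\<in>U. (?c u)\<^sup>2) = (\<Sum>u\<in>U. \<Sum>r\<in>A1. \<Sum>s\<in>A1. of_bool (u \<in> Ur r \<inter> Ur s))"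
      by (simp add: power2_eq_square sum_product flip: of_bool_conj)
    also have "\<dots> = (\<Sum>r\<in>A1. \<Sum>s\<in>A1. \<Sum>u\<in>U. of_bool (u \<in> Ur r \<inter> Ur s))"
      by (subst sum.swap) (intro sum.cong refl sum.swap)
    also have "\<dots> = (\<Sum>r\<in>A1. \<Sum>s\<in>A1. real (card (Ur r \<inter> Ur s)))"
      using UrU by (intro sum.cong refl cnt[symmetric]) auto
    finally show ?thesis .
  qed
  define l where "l = real (card A1)"
  have l0: "l > 0" using ne1 fA1 by (simp add: l_def card_gt_0_iff)
  \<comment> \<open>Half of the average intersection: sets of size \<open>m a / 2\<close> inside a
    set of at most \<open>D\<close> points meet in \<open>(m a / 2)^2 / D = 2 b\<close> points on
    average.\<close>
  define b where "b = m\<^sup>2 * a\<^sup>2 / (8 * D)"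
  have b0: "b > 0" using m0 a D by (simp add: b_def)
  have "(l * (m * a / 2))\<^sup>2 \<le> (\<Sum>r\<in>A1. real (card (Ur r)))\<^sup>2"
  proof (rule power_mono)
    have "l * (m * a / 2) = (\<Sum>r\<in>A1. m * a / 2)" by (simp add: l_def)
    also have "\<dots> \<le> (\<Sum>r\<in>A1. real (card (Ur r)))" by (intro sum_mono cUr)
    finally show "l * (m * a / 2) \<le> (\<Sum>r\<in>A1. real (card (Ur r)))" .
  qed (use l0 m0 a in auto)
  with cover have "(l * (m * a / 2))\<^sup>2 \<le> (\<Sum>r\<in>A1. \<Sum>s\<in>A1. real (card (Ur r \<inter> Ur s))) * D" by linarith
  moreover have "(l * (m * a / 2))\<^sup>2 = (l * (l * (2 * b))) * D"
    using D by (simp add: b_def power2_eq_square field_simps)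
  ultimately have "l * (l * (2 * b)) \<le> (\<Sum>r\<in>A1. \<Sum>s\<in>A1. real (card (Ur r \<inter> Ur s)))"
    using D by simp
  then have "\<exists>r\<in>A1. l * (2 * b) \<le> (\<Sum>s\<in>A1. real (card (Ur r \<inter> Ur s)))"
    using l0 b0 by (intro exists_ge_average[OF fA1(1) ne1, of l]) (auto simp: l_def)
  then obtain r where r: "r \<in> A1" "l * (2 * b) \<le> (\<Sum>s\<in>A1. real (card (Ur r \<inter> Ur s)))" by blast
  define A2 where "A2 = {s \<in> A1. b \<le> real (card (Ur r \<inter> Ur s))}"
  have "l * (2 * b) \<le> l * b + real (card A2) * m"
    unfolding A2_def l_def
  proof (rule order_trans[OF r(2)[unfolded l_def] card_popular[OF fA1(1)]])
    fix s assume s: "s \<in> A1"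
    have "card (Ur r \<inter> Ur s) \<le> card (Ur s)"
      using UrU[OF s] fU finite_subset by (intro card_mono) auto
    then show "real (card (Ur r \<inter> Ur s)) \<le> m" using cUr2[OF s] by linarith
  qed (use b0 in auto)
  then have A2: "l * b / m \<le> real (card A2)" using m0 by (simp add: field_simps)
  have "a ^ 4 / 64 * k \<le> l * b / m"
  proof -
    have "a ^ 4 / 64 * k = (k * a / 2) * (a * a\<^sup>2 / 32)" by (simp add: power2_eq_square power4_eq_xxxx)
    also have "\<dots> \<le> l * (a * a\<^sup>2 / 32)" using A1 a by (intro mult_right_mono) (auto simp: l_def)
    also have "a * a\<^sup>2 / 32 \<le> m * a\<^sup>2 / (8 * D)"
      using W(2) a D by (simp add: m_def field_simps mult_right_mono power2_eq_square)
    then have "l * (a * a\<^sup>2 / 32) \<le> l * (m * a\<^sup>2 / (8 * D))" using l0 by (intro mult_left_mono) auto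
    also have "\<dots> = l * b / m" using m0 by (simp add: b_def power2_eq_square)
    finally show ?thesis .
  qed
  then have cA2: "a ^ 4 / 64 * real (card A) \<le> real (card A2)" using A2 unfolding k_def by linarith
  have fin: "real (card (diff_set R (dilate R s W) (dilate R r W))) \<le> 2 ^ 29 / a ^ 15 * m" if s: "s \<in> A2" for s
  proof -
    have s1: "s \<in> A1" using s by (auto simp: A2_def)
    let ?B = "Ur r \<inter> Ur s"
    have Bc: "?B \<subseteq> carrier R" using UrU[OF r(1)] U by blast
    \<comment> \<open>For \<open>u\<close> in \<open>B\<close> write \<open>w q = u + q v'\<close>
      with \<open>v'\<close> in \<open>W\<close>; then
      \<open>u + q v = w q + q (v - v')\<close>.\<close>
    have sub: "card (?B <+>\<^bsub>R\<^esub> dilate R q W) \<le> card (diff_set R W W)" if q: "q \<in> A1" "?B \<subseteq> Ur q" for q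
    proof -
      have qc: "q \<in> carrier R" using rc[OF q(1)] by simp
      have wc: "w q \<in> carrier R" using w[OF q(1)] G(1) q(1) fA1 U V qc by (fastforce)
      have "?B <+>\<^bsub>R\<^esub> dilate R q W \<subseteq> (\<lambda>d. w q \<oplus> q \<otimes> d) ` diff_set R W W"
      proof
        fix x assume "x \<in> ?B <+>\<^bsub>R\<^esub> dilate R q W"
        then obtain u v where x: "u \<in> ?B" "v \<in> W" "x = u \<oplus> q \<otimes> v" by (auto simp: mem_set_add dilate_def)
        obtain v' where v': "v' \<in> W" "u \<oplus> q \<otimes> v' = w q" using Urep[OF q(1)] x q(2) by blast
        have cc: "u \<in> carrier R" "v \<in> carrier R" "v' \<in> carrier R" using x v' Bc Wc by auto
        have "x = (u \<oplus> q \<otimes> v') \<oplus> q \<otimes> (v \<ominus> v')" unfolding x using cc qc by algebra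
        then show "x \<in> (\<lambda>d. w q \<oplus> q \<otimes> d) ` diff_set R W W"
          using v' x by (auto simp: diff_set_def)
      qed
      then have "card (?B <+>\<^bsub>R\<^esub> dilate R q W) \<le> card ((\<lambda>d. w q \<oplus> q \<otimes> d) ` diff_set R W W)"
        using fW by (intro card_mono) (auto simp: finite_diff_set)
      also have "\<dots> \<le> card (diff_set R W W)" using fW by (intro card_image_le finite_diff_set) auto
      finally show ?thesis .
    qed
    have dc: "dilate R s W \<subseteq> carrier R" "dilate R r W \<subseteq> carrier R"
      using dilate_closed rc s1 r(1) Wc by auto
    have "card (diff_set R (dilate R s W) (dilate R r W)) * card ?B
        \<le> card (?B <+>\<^bsub>R\<^esub> dilate R s W) * card (?B <+>\<^bsub>R\<^esub> dilate R r W)"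
      by (rule ruzsa_triangle) (use dc Bc finite_sub in auto)
    also have "\<dots> \<le> card (diff_set R W W) * card (diff_set R W W)"
      using sub s1 r(1) by (intro mult_mono) auto
    finally have "real (card (diff_set R (dilate R s W) (dilate R r W))) * real (card ?B)
        \<le> real (card (diff_set R W W)) * real (card (diff_set R W W))"
      by (metis of_nat_le_iff of_nat_mult)
    also have "\<dots> \<le> (4096 / a ^ 6 * m) * (4096 / a ^ 6 * m)"
      using dW by (intro mult_mono) auto
    finally have "real (card (diff_set R (dilate R s W) (dilate R r W))) * b \<le> (4096 / a ^ 6 * m) * (4096 / a ^ 6 * m)"
      using s mult_left_mono[of b "real (card ?B)" "real (card (diff_set R (dilate R s W) (dilate R r W)))"]
      by (simp add: A2_def)
    moreover have "m * a ^ 3 / 32 \<le> b"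
    proof -
      have "m * a ^ 3 / 32 * D \<le> m * a ^ 3 / 32 * (4 / a * m)"
        using Dm m0 a by (intro mult_left_mono) auto
      also have "\<dots> = b * D" using a D by (simp add: b_def power2_eq_square power3_eq_cube field_simps)
      finally show ?thesis using D by simp
    qed
    ultimately have "real (card (diff_set R (dilate R s W) (dilate R r W))) * (m * a ^ 3 / 32)
        \<le> (4096 / a ^ 6 * m) * (4096 / a ^ 6 * m)"
      using mult_left_mono[of "m * a ^ 3 / 32" b "real (card (diff_set R (dilate R s W) (dilate R r W)))"]
      by simp
    then have "real (card (diff_set R (dilate R s W) (dilate R r W))) * (a ^ 3 / 32) * m
        \<le> ((4096 / a ^ 6) * (4096 / a ^ 6) * m) * m"
      by (simp only: mult_ac times_divide_eq_right times_divide_eq_left)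
    then have "real (card (diff_set R (dilate R s W) (dilate R r W))) * (a ^ 3 / 32)
        \<le> (4096 / a ^ 6) * (4096 / a ^ 6) * m"
      using m0 by (simp only: mult_le_cancel_right_pos)
    then have "real (card (diff_set R (dilate R s W) (dilate R r W)))
        \<le> (4096 / a ^ 6) * (4096 / a ^ 6) * m / (a ^ 3 / 32)"
      using a by (subst pos_le_divide_eq) auto
    also have "\<dots> = 2 ^ 29 / a ^ 15 * m"
      using a by (simp add: field_simps power_add[symmetric])
    finally show ?thesis .
  qed
  have "A2 \<subseteq> A" using fA1 by (auto simp: A2_def)
  moreover have "r \<in> A" using r fA1 by blast
  ultimately show ?thesis
    using Wc(2) W(2) cA2 dW fin unfolding m_def by blast
qed

end

subsection \<open>Incidence graphs without rectangles\<close>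

text \<open>An abstract relation instead of points and lines, so that each count can be reused with
  the two sides exchanged.\<close>

definition edges :: "('a \<Rightarrow> 'b \<Rightarrow> bool) \<Rightarrow> 'a set \<Rightarrow> 'b set \<Rightarrow> real" where
  "edges E A B = (\<Sum>a\<in>A. real (card {b \<in> B. E a b}))"

definition rectangle_free :: "('a \<Rightarrow> 'b \<Rightarrow> bool) \<Rightarrow> 'a set \<Rightarrow> 'b set \<Rightarrow> bool" where
  "rectangle_free E A B \<longleftrightarrow> (\<forall>a\<in>A. \<forall>a'\<in>A. \<forall>b\<in>B. \<forall>b'\<in>B.
     E a b \<longrightarrow> E a b' \<longrightarrow> E a' b \<longrightarrow> E a' b' \<longrightarrow> a = a' \<or> b = b')"

lemma rectangle_freeD:
  "rectangle_free E A B \<Longrightarrow> a \<in> A \<Longrightarrow> a' \<in> A \<Longrightarrow> b \<in> B \<Longrightarrow> b' \<in> B \<Longrightarrow>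
    E a b \<Longrightarrow> E a b' \<Longrightarrow> E a' b \<Longrightarrow> E a' b' \<Longrightarrow> a = a' \<or> b = b'"
  unfolding rectangle_free_def by blast

lemma rectangle_free_subset:
  "rectangle_free E A B \<Longrightarrow> A' \<subseteq> A \<Longrightarrow> B' \<subseteq> B \<Longrightarrow> rectangle_free E A' B'"
  unfolding rectangle_free_def by (meson subsetD)

lemma rectangle_free_swap: "rectangle_free E A B \<Longrightarrow> rectangle_free (\<lambda>b a. E a b) B A"
  unfolding rectangle_free_def by blast

lemma edges_swap:
  assumes "finite A" "finite B"
  shows "edges E A B = edges (\<lambda>b a. E a b) B A"
proof -
  have "edges E A B = (\<Sum>a\<in>A. \<Sum>b\<in>B. of_bool (E a b))"
    unfolding edges_def using assms by (intro sum.cong refl card_filter_sum) auto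
  also have "\<dots> = (\<Sum>b\<in>B. \<Sum>a\<in>A. of_bool (E a b))" by (rule sum.swap)
  also have "\<dots> = edges (\<lambda>b a. E a b) B A"
    unfolding edges_def using assms by (intro sum.cong refl card_filter_sum[symmetric]) auto
  finally show ?thesis .
qed

lemma edges_le:
  assumes "finite B"
  shows "edges E A B \<le> real (card A) * real (card B)"
  unfolding edges_def using assms by (intro sum_bounded_above) (auto intro!: card_mono)

lemma edges_card:
  assumes "finite A" "finite B"
  shows "edges E A B = real (card {(a, b) \<in> A \<times> B. E a b})"
proof -
  have "{(a, b) \<in> A \<times> B. E a b} = (SIGMA a:A. {b \<in> B. E a b})" by auto
  then show ?thesis unfolding edges_def using assms by (simp add: card_SigmaI)
qed

text \<open>Count triples \<open>(a, b, b')\<close> by the pair \<open>(b, b')\<close>: pairs off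
  the diagonal have at most one common neighbour, and the diagonal counts the edges.\<close>

lemma sum_degree_squares:
  assumes fin: "finite A" "finite B" and free: "rectangle_free E A B"
  shows "(\<Sum>a\<in>A. (real (card {b \<in> B. E a b}))\<^sup>2) \<le> edges E A B + (real (card B))\<^sup>2"
proof -
  have "(\<Sum>a\<in>A. (real (card {b \<in> B. E a b}))\<^sup>2) = (\<Sum>a\<in>A. \<Sum>b\<in>B. \<Sum>b'\<in>B. of_bool (E a b \<and> E a b'))"
    by (simp only: card_filter_sum[OF fin(2)] power2_eq_square sum_product of_bool_conj)
  also have "\<dots> = (\<Sum>b\<in>B. \<Sum>b'\<in>B. \<Sum>a\<in>A. of_bool (E a b \<and> E a b'))"
    by (subst sum.swap) (intro sum.cong refl sum.swap)
  also have "\<dots> \<le> (\<Sum>b\<in>B. \<Sum>b'\<in>B. (if b = b' then real (card {a \<in> A. E a b}) else 0) + 1)"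
  proof (intro sum_mono)
    fix b b' assume b: "b \<in> B" "b' \<in> B"
    have "(\<Sum>a\<in>A. of_bool (E a b \<and> E a b')) = real (card {a \<in> A. E a b \<and> E a b'})"
      using fin by (simp add: card_filter_sum)
    also have "\<dots> \<le> (if b = b' then real (card {a \<in> A. E a b}) else 0) + 1"
    proof (cases "b = b'")
      case False
      then have "card {a \<in> A. E a b \<and> E a b'} \<le> 1"
        using b fin rectangle_freeD[OF free] by (intro card_le_Suc0_iff_eq[THEN iffD2, unfolded One_nat_def[symmetric]]) auto
      then show ?thesis using False by simp
    qed simp
    finally show "(\<Sum>a\<in>A. of_bool (E a b \<and> E a b'))
        \<le> (if b = b' then real (card {a \<in> A. E a b}) else 0) + 1" .
  qed
  also have "\<dots> = edges (\<lambda>b a. E a b) B A + (real (card B))\<^sup>2"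
    using fin by (simp add: sum.distrib edges_def power2_eq_square)
  finally show ?thesis using edges_swap[OF fin, of E] by simp
qed

text \<open>A degree \<open>d > D\<close> is at most \<open>d^2 / D\<close>, so the second moment
  bounds all edges at vertices of high degree.\<close>

lemma prune_high_degrees:
  assumes fin: "finite A" "finite B" and free: "rectangle_free E A B"
    and n: "real (card A) \<le> n" "real (card B) \<le> n" and D: "D > 0"
  shows "edges E A B \<le> edges E {a \<in> A. real (card {b \<in> B. E a b}) \<le> D} B + 2 * n\<^sup>2 / D"
proof -
  let ?d = "\<lambda>a. real (card {b \<in> B. E a b})" and ?A = "{a \<in> A. real (card {b \<in> B. E a b}) \<le> D}"
  have n0: "n \<ge> 0" using n(1) by (meson of_nat_0_le_iff order_trans)
  have "edges E A B = edges E ?A B + (\<Sum>a\<in>A - ?A. ?d a)"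
    unfolding edges_def using fin by (subst sum.subset_diff[of ?A A]) auto
  also have "(\<Sum>a\<in>A - ?A. ?d a) \<le> (\<Sum>a\<in>A - ?A. (?d a)\<^sup>2 / D)"
    using D by (intro sum_mono) (auto simp: field_simps power2_eq_square intro!: mult_left_mono)
  also have "\<dots> \<le> (\<Sum>a\<in>A. (?d a)\<^sup>2 / D)" using fin D by (intro sum_mono2) auto
  also have "\<dots> = (\<Sum>a\<in>A. (?d a)\<^sup>2) / D" by (rule sum_divide_distrib[symmetric])
  also have "\<dots> \<le> (edges E A B + (real (card B))\<^sup>2) / D"
    using sum_degree_squares[OF fin free] D by (intro divide_right_mono) auto
  also have "\<dots> \<le> (n * n + n\<^sup>2) / D"
  proof (intro divide_right_mono add_mono power_mono n)
    have "edges E A B \<le> real (card A) * real (card B)" by (rule edges_le[OF fin(2)])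
    also have "\<dots> \<le> n * n" using n n0 by (intro mult_mono) auto
    finally show "edges E A B \<le> n * n" .
  qed (use D in auto)
  finally show ?thesis by (simp add: power2_eq_square)
qed

lemma path_count:
  assumes fin: "finite A" "finite B" and free: "rectangle_free E A B"
    and n: "real (card A) \<le> n" "real (card B) \<le> n" and t: "t \<ge> 2" and many: "4 * n * t \<le> edges E A B"
  shows "edges E A B * t\<^sup>2 / 8
    \<le> (\<Sum>l\<in>B. \<Sum>z\<in>{z \<in> A. \<not> E z l}. real (card {q \<in> A. E q l \<and> (\<exists>l'\<in>B. E z l' \<and> E q l')}))"
proof -
  let ?d = "\<lambda>a. real (card {b \<in> B. E a b})" and ?e = "\<lambda>b. real (card {a \<in> A. E a b})"
  define X where "X = {(q, l) \<in> A \<times> B. E q l}"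
  have fX: "finite X" unfolding X_def using fin by (auto intro: finite_subset[of _ "A \<times> B"])
  have cX: "real (card X) = edges E A B" unfolding X_def using edges_card[OF fin] by simp
  define Y where "Y = {(q, l) \<in> X. t \<le> ?d q \<and> t \<le> ?e l}"
  define X1 where "X1 = {(q, l) \<in> X. ?d q < t}"
  define X2 where "X2 = {(q, l) \<in> X. ?e l < t}"
  have t0: "t \<ge> 0" using t by simp
  have low: "edges G {a \<in> C. real (card {b \<in> F. G a b}) < t} F \<le> n * t"
    if "finite C" "real (card C) \<le> n" for C :: "'x set" and F :: "'y set" and G
  proof -
    have "edges G {a \<in> C. real (card {b \<in> F. G a b}) < t} F \<le> real (card {a \<in> C. real (card {b \<in> F. G a b}) < t}) * t"
      unfolding edges_def by (intro sum_bounded_above) auto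
    also have "\<dots> \<le> n * t"
    proof (intro mult_right_mono t0)
      have "card {a \<in> C. real (card {b \<in> F. G a b}) < t} \<le> card C" using that by (intro card_mono) auto
      then show "real (card {a \<in> C. real (card {b \<in> F. G a b}) < t}) \<le> n" using that by linarith
    qed
    finally show ?thesis .
  qed
  have "X1 = {(a, b) \<in> {a \<in> A. ?d a < t} \<times> B. E a b}" by (auto simp: X1_def X_def)
  then have "real (card X1) \<le> n * t"
    using edges_card[of "{a \<in> A. ?d a < t}" B E] low[OF fin(1) n(1), of E B] fin by simp
  moreover have "real (card X2) \<le> n * t"
  proof -
    have "X2 = prod.swap ` {(b, a) \<in> {b \<in> B. ?e b < t} \<times> A. E a b}" by (auto simp: X2_def X_def)
    then have "card X2 = card {(b, a) \<in> {b \<in> B. ?e b < t} \<times> A. E a b}" by (simp add: card_image)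
    then show ?thesis
      using edges_card[of "{b \<in> B. ?e b < t}" A "\<lambda>b a. E a b"] low[OF fin(2) n(2), of "\<lambda>b a. E a b" A] fin by simp
  qed
  moreover have "real (card X) \<le> real (card Y) + (real (card X1) + real (card X2))"
  proof -
    have "X = Y \<union> (X1 \<union> X2)" by (auto simp: Y_def X1_def X2_def)
    then show ?thesis using card_Un_le[of Y "X1 \<union> X2"] card_Un_le[of X1 X2] by simp
  qed
  ultimately have cY: "edges E A B / 2 \<le> real (card Y)" using many cX by simp
  \<comment> \<open>Flags with an end of degree below \<open>t\<close> number at most
    \<open>2 n t\<close>, half of all edges. A remaining flag \<open>(q, l')\<close> is extended by
    another line \<open>l\<close> through \<open>q\<close> and another point \<open>z\<close> on
    \<open>l'\<close>, each in at least \<open>t - 1 >= t / 2\<close> ways. Without rectangles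
    \<open>z\<close> is off \<open>l\<close>, and \<open>l'\<close> can be recovered from
    \<open>z\<close> and \<open>q\<close>.\<close>
  define T where "T = (\<lambda>(q, l'). ({l \<in> B. E q l} - {l'}) \<times> ({z \<in> A. E z l'} - {q}))"
  have cT: "(t / 2)\<^sup>2 \<le> real (card (T y))" if y: "y \<in> Y" for y
  proof -
    obtain q l' where q: "y = (q, l')" "q \<in> A" "l' \<in> B" "E q l'" "t \<le> ?d q" "t \<le> ?e l'"
      using y by (auto simp: Y_def X_def)
    have "real (card ({l \<in> B. E q l} - {l'})) = ?d q - 1" "real (card ({z \<in> A. E z l'} - {q})) = ?e l' - 1"
      using q t by (auto simp: card_Diff_singleton of_nat_diff)
    then have "real (card (T y)) = (?d q - 1) * (?e l' - 1)"
      unfolding T_def q(1) by (simp add: card_cartesian_product)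
    also have "(?d q - 1) * (?e l' - 1) \<ge> (t / 2) * (t / 2)"
      using q t by (intro mult_mono) auto
    finally show ?thesis by (simp add: power2_eq_square)
  qed
  define Z where "Z = (SIGMA l:B. SIGMA z:{z \<in> A. \<not> E z l}. {q \<in> A. E q l \<and> (\<exists>l'\<in>B. E z l' \<and> E q l')})"
  have fZ: "finite Z" unfolding Z_def using fin by auto
  have fY: "finite Y" using fX by (auto simp: Y_def intro: finite_subset)
  have fT: "finite (T y)" for y using fin by (auto simp: T_def split: prod.split)
  let ?g = "\<lambda>((q, l'), (l, z)). (l, z, q)"
  have mem: "q \<in> A \<and> l' \<in> B \<and> l \<in> B \<and> z \<in> A \<and> E q l' \<and> E q l \<and> l \<noteq> l' \<and> E z l' \<and> z \<noteq> q"
    if "((q, l'), (l, z)) \<in> Sigma Y T" for q l' l z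
    using that by (auto simp: T_def Y_def X_def)
  have "inj_on ?g (Sigma Y T)"
  proof (rule inj_onI)
    fix x x' assume x: "x \<in> Sigma Y T" "x' \<in> Sigma Y T" "?g x = ?g x'"
    obtain q l' l z where e: "x = ((q, l'), (l, z))" by (metis surj_pair)
    obtain q' m' m z' where e': "x' = ((q', m'), (m, z'))" by (metis surj_pair)
    have eq: "q' = q" "m = l" "z' = z" using x(3) unfolding e e' by auto
    have "l' = m'"
      using mem[OF x(1)[unfolded e]] mem[OF x(2)[unfolded e']] unfolding eq
      using rectangle_freeD[OF free, of q z l' m'] by blast
    then show "x = x'" using e e' eq by simp
  qed
  moreover have "?g ` Sigma Y T \<subseteq> Z"
  proof
    fix w assume "w \<in> ?g ` Sigma Y T"
    then obtain x where x: "x \<in> Sigma Y T" "w = ?g x" by blast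
    obtain q l' l z where e: "x = ((q, l'), (l, z))" by (metis surj_pair)
    have w: "w = (l, z, q)" using x e by simp
    note m = mem[OF x(1)[unfolded e]]
    then have "\<not> E z l" using rectangle_freeD[OF free, of q z l' l] by blast
    then show "w \<in> Z" unfolding w Z_def using m by auto
  qed
  ultimately have "card (Sigma Y T) \<le> card Z" using fZ by (intro card_inj_on_le) auto
  have "edges E A B * t\<^sup>2 / 8 = (edges E A B / 2) * (t / 2)\<^sup>2" by (simp add: power2_eq_square)
  also have "\<dots> \<le> real (card Y) * (t / 2)\<^sup>2" using cY by (intro mult_right_mono) auto
  also have "\<dots> = (\<Sum>y\<in>Y. (t / 2)\<^sup>2)" by simp
  also have "\<dots> \<le> (\<Sum>y\<in>Y. real (card (T y)))" by (intro sum_mono cT)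
  also have "\<dots> = real (card (Sigma Y T))" using fY fT by (subst card_SigmaI) auto
  also have "\<dots> \<le> real (card Z)" using \<open>card (Sigma Y T) \<le> card Z\<close> by simp
  also have "real (card Z) = (\<Sum>l\<in>B. \<Sum>z\<in>{z \<in> A. \<not> E z l}. real (card {q \<in> A. E q l \<and> (\<exists>l'\<in>B. E z l' \<and> E q l')}))"
    unfolding Z_def using fin by (simp add: card_SigmaI)
  finally show ?thesis .
qed

text \<open>The tangent inequality \<open>f\<^sup>3 \<ge> 3 h\<^sup>2 f - 2 h\<^sup>3\<close> at the mean \<open>h\<close> replaces Hoelder's inequality.\<close>

lemma cube_tangent:
  fixes f h :: real
  assumes "f \<ge> 0" "h \<ge> 0"
  shows "3 * h\<^sup>2 * f - 2 * h ^ 3 \<le> f ^ 3"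
proof -
  have "0 \<le> (f - h)\<^sup>2 * (f + 2 * h)" using assms by simp
  also have "\<dots> = f ^ 3 - (3 * h\<^sup>2 * f - 2 * h ^ 3)"
    by (simp add: power2_eq_square power3_eq_cube algebra_simps)
  finally show ?thesis by simp
qed

text \<open>\<open>f z l\<close> counts the points of \<open>l\<close> that are joined to
  \<open>z\<close>. Its third moment over all \<open>z\<close> off \<open>l\<close> counts triples
  \<open>q0, q1, q2\<close> on \<open>l\<close> by their common partners \<open>z\<close>. This is
  what allows two points to be fixed as centres of the coordinates while a third still varies over
  many points of the same line.\<close>

lemma rich_line_bounded_degree:
  fixes E :: "'a \<Rightarrow> 'b \<Rightarrow> bool"
  assumes fin: "finite A" "finite B" and free: "rectangle_free E A B"
    and n: "real (card A) \<le> N\<^sup>2" "real (card B) \<le> N\<^sup>2"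
    and K: "K \<ge> 1" and N: "2 ^ 42 * K ^ 11 \<le> N"
    and many: "N ^ 3 / (2 * K) \<le> edges E A B"
    and degA: "\<And>a. a \<in> A \<Longrightarrow> real (card {b \<in> B. E a b}) \<le> 8 * N * K"
    and degB: "\<And>b. b \<in> B \<Longrightarrow> real (card {a \<in> A. E a b}) \<le> 8 * N * K"
  shows "\<exists>l\<in>B. \<exists>q0\<in>A. \<exists>q1\<in>A. \<exists>Q\<subseteq>A. E q0 l \<and> E q1 l \<and> q0 \<noteq> q1 \<and> q0 \<notin> Q \<and> q1 \<notin> Q
    \<and> N / (2 ^ 40 * K ^ 11) \<le> real (card Q)
    \<and> (\<forall>q\<in>Q. E q l \<and> N\<^sup>2 / (2 ^ 37 * K ^ 10) \<le> real (card {z \<in> A. \<not> E z l \<and>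
        (\<exists>l'\<in>B. E z l' \<and> E q0 l') \<and> (\<exists>l'\<in>B. E z l' \<and> E q1 l') \<and> (\<exists>l'\<in>B. E z l' \<and> E q l')}))"
proof -
  define J where "J = (\<lambda>z q. \<exists>l'\<in>B. E z l' \<and> E q l')"
  define pl where "pl = (\<lambda>l. {q \<in> A. E q l})"
  define Z where "Z = (\<lambda>l. {z \<in> A. \<not> E z l})"
  define f where "f = (\<lambda>z l. real (card {q \<in> pl l. J z q}))"
  define c where "c = (\<lambda>l q0 q1 q2. real (card {z \<in> Z l. J z q0 \<and> J z q1 \<and> J z q2}))"
  have K0: "K > 0" using K by simp
  have K11: "1 \<le> K ^ 11" using K by (rule one_le_power)
  have N0: "N > 0" using N K11 by (smt (verit) mult_le_cancel_left1 zero_less_power)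
  have fpl: "finite (pl l)" "finite (Z l)" for l using fin by (auto simp: pl_def Z_def)
  have pow: "K ^ i \<le> K ^ 11" if "i \<le> 11" for i using K that by (rule power_increasing[rotated])
  have pl2: "(\<Sum>l\<in>B. (real (card (pl l)))\<^sup>2) \<le> 2 * N ^ 4"
  proof -
    have "(\<Sum>l\<in>B. (real (card (pl l)))\<^sup>2) \<le> edges E A B + (real (card A))\<^sup>2"
      using sum_degree_squares[OF fin(2,1) rectangle_free_swap[OF free]] edges_swap[OF fin, of E]
      by (simp add: pl_def)
    also have "edges E A B \<le> real (card A) * real (card B)" by (rule edges_le[OF fin(2)])
    also have "\<dots> \<le> N\<^sup>2 * N\<^sup>2" using n by (intro mult_mono) auto
    also have "(real (card A))\<^sup>2 \<le> (N\<^sup>2)\<^sup>2" using n by (intro power_mono) auto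
    finally show ?thesis by (simp flip: power_add power_mult)
  qed
  have W: "N ^ 5 / (1024 * K ^ 3) \<le> (\<Sum>l\<in>B. \<Sum>z\<in>Z l. f z l)"
  proof -
    have "2 * (8 * K) \<le> 2 ^ 42 * K ^ 11" using pow[of 1] K0 by simp
    then have t2: "2 \<le> N / (8 * K)" using N K0 by (subst pos_le_divide_eq) auto
    have t4: "4 * N\<^sup>2 * (N / (8 * K)) \<le> edges E A B"
      using many by (simp add: power2_eq_square power3_eq_cube)
    have "N ^ 5 / (1024 * K ^ 3) = (N ^ 3 / (2 * K)) * (N / (8 * K))\<^sup>2 / 8"
      using K0 by (simp add: field_simps power2_eq_square power3_eq_cube numeral_eq_Suc)
    also have "\<dots> \<le> edges E A B * (N / (8 * K))\<^sup>2 / 8"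
      using many by (intro divide_right_mono mult_right_mono) auto
    also have "\<dots> \<le> (\<Sum>l\<in>B. \<Sum>z\<in>{z \<in> A. \<not> E z l}. real (card {q \<in> A. E q l \<and> (\<exists>l'\<in>B. E z l' \<and> E q l')}))"
      by (rule path_count[OF fin free n t2 t4])
    also have "\<dots> = (\<Sum>l\<in>B. \<Sum>z\<in>Z l. f z l)" by (simp add: Z_def f_def pl_def J_def conj_assoc)
    finally show ?thesis .
  qed
  \<comment> \<open>A lower bound for the mean of \<open>f\<close>: the total
    \<open>N^5 / (1024 K^3)\<close> divided by the at most \<open>N^4\<close> pairs
    \<open>(l, z)\<close>.\<close>
  define h where "h = N / (1024 * K ^ 3)"
  have h0: "h > 0" using N0 K0 by (simp add: h_def)
  have T3: "N ^ 7 / (2 ^ 30 * K ^ 9) \<le> (\<Sum>l\<in>B. \<Sum>z\<in>Z l. (f z l) ^ 3)"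
  proof -
    have ZZ: "(\<Sum>l\<in>B. real (card (Z l))) \<le> N ^ 4"
    proof -
      have "(\<Sum>l\<in>B. real (card (Z l))) \<le> real (card B) * real (card A)"
        using fin by (intro sum_bounded_above) (auto simp: Z_def intro!: card_mono)
      also have "\<dots> \<le> N\<^sup>2 * N\<^sup>2" using n by (intro mult_mono) auto
      finally show ?thesis by (simp flip: power_add)
    qed
    have "N ^ 7 / (2 ^ 30 * K ^ 9) = 3 * h\<^sup>2 * (N ^ 5 / (1024 * K ^ 3)) - 2 * h ^ 3 * N ^ 4"
      using K0 by (simp add: h_def field_simps power2_eq_square power3_eq_cube numeral_eq_Suc)
    also have "\<dots> \<le> 3 * h\<^sup>2 * (\<Sum>l\<in>B. \<Sum>z\<in>Z l. f z l) - 2 * h ^ 3 * (\<Sum>l\<in>B. real (card (Z l)))"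
      using W ZZ h0 by (intro diff_mono mult_left_mono) auto
    also have "\<dots> = (\<Sum>l\<in>B. \<Sum>z\<in>Z l. 3 * h\<^sup>2 * f z l - 2 * h ^ 3)"
      by (simp add: sum_subtractf sum_distrib_left mult_ac)
    also have "\<dots> \<le> (\<Sum>l\<in>B. \<Sum>z\<in>Z l. (f z l) ^ 3)"
      using h0 by (intro sum_mono cube_tangent) (auto simp: f_def)
    finally show ?thesis .
  qed
  have cube: "(\<Sum>z\<in>Z l. (f z l) ^ 3) = (\<Sum>q0\<in>pl l. \<Sum>q1\<in>pl l. \<Sum>q2\<in>pl l. c l q0 q1 q2)" for l
  proof -
    have "(\<Sum>z\<in>Z l. (f z l) ^ 3)
        = (\<Sum>z\<in>Z l. \<Sum>q0\<in>pl l. \<Sum>q1\<in>pl l. \<Sum>q2\<in>pl l. of_bool (J z q0 \<and> J z q1 \<and> J z q2))"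
    proof (intro sum.cong refl)
      fix z
      have "f z l = (\<Sum>q\<in>pl l. of_bool (J z q))" unfolding f_def using fpl by (intro card_filter_sum) auto
      then show "(f z l) ^ 3 = (\<Sum>q0\<in>pl l. \<Sum>q1\<in>pl l. \<Sum>q2\<in>pl l. of_bool (J z q0 \<and> J z q1 \<and> J z q2))"
        by (simp add: power3_eq_cube sum_product sum_distrib_left sum_distrib_right mult_ac of_bool_conj
            del: sum_of_bool_eq sum_mult_of_bool_eq sum_of_bool_mult_eq)
    qed
    also have "\<dots> = (\<Sum>q0\<in>pl l. \<Sum>q1\<in>pl l. \<Sum>q2\<in>pl l. \<Sum>z\<in>Z l. of_bool (J z q0 \<and> J z q1 \<and> J z q2))"
      by (subst sum.swap, rule sum.cong[OF refl], subst sum.swap, rule sum.cong[OF refl], rule sum.swap)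
    also have "\<dots> = (\<Sum>q0\<in>pl l. \<Sum>q1\<in>pl l. \<Sum>q2\<in>pl l. c l q0 q1 q2)"
      unfolding c_def using fpl by (intro sum.cong refl card_filter_sum[symmetric]) auto
    finally show ?thesis .
  qed
  define T where "T = N ^ 3 / (2 ^ 32 * K ^ 9)"
  have T0: "T > 0" using N0 K0 by (simp add: T_def)
  \<comment> \<open>The terms with \<open>q0 = q1\<close> contribute at most \<open>N^2\<close>
    times \<open>2 N^4\<close>, smaller than the third moment by a factor of order
    \<open>N / K^9\<close>. So they cannot account for it, and a good pair of distinct points
    exists.\<close>
  have "\<exists>l\<in>B. \<exists>q0\<in>pl l. \<exists>q1\<in>pl l. q0 \<noteq> q1 \<and> T \<le> (\<Sum>q2\<in>pl l. c l q0 q1 q2)"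
  proof (rule ccontr)
    assume neg: "\<not> ?thesis"
    have bnd: "(\<Sum>q2\<in>pl l. c l q0 q1 q2) \<le> T + (if q0 = q1 then real (card (pl l)) * N\<^sup>2 else 0)"
      if l: "l \<in> B" "q0 \<in> pl l" "q1 \<in> pl l" for l q0 q1
    proof (cases "q0 = q1")
      case True
      have "(\<Sum>q2\<in>pl l. c l q0 q1 q2) \<le> real (card (pl l)) * N\<^sup>2"
      proof (rule sum_bounded_above)
        fix q2
        have "card {z \<in> Z l. J z q0 \<and> J z q1 \<and> J z q2} \<le> card A"
          using fin by (intro card_mono) (auto simp: Z_def)
        then show "c l q0 q1 q2 \<le> N\<^sup>2" unfolding c_def using n by linarith
      qed
      then show ?thesis using True T0 by simp
    next
      case False
      then show ?thesis using neg l by force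
    qed
    have "(\<Sum>l\<in>B. \<Sum>z\<in>Z l. (f z l) ^ 3) \<le> (\<Sum>l\<in>B. \<Sum>q0\<in>pl l. \<Sum>q1\<in>pl l.
        T + (if q0 = q1 then real (card (pl l)) * N\<^sup>2 else 0))"
      unfolding cube by (intro sum_mono bnd)
    also have "\<dots> = (\<Sum>l\<in>B. (T + N\<^sup>2) * (real (card (pl l)))\<^sup>2)"
      using fpl by (intro sum.cong refl) (simp add: sum.distrib power2_eq_square algebra_simps)
    also have "\<dots> = (T + N\<^sup>2) * (\<Sum>l\<in>B. (real (card (pl l)))\<^sup>2)" by (simp add: sum_distrib_left)
    also have "\<dots> \<le> (T + N\<^sup>2) * (2 * N ^ 4)" using pl2 T0 by (intro mult_left_mono) auto
    finally have "N ^ 7 / (2 ^ 30 * K ^ 9) \<le> (T + N\<^sup>2) * (2 * N ^ 4)" using T3 by linarith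
    moreover have "(T + N\<^sup>2) * (2 * N ^ 4) = N ^ 6 * (N / (2 ^ 31 * K ^ 9) + 2)"
      using K0 by (simp add: T_def field_simps power2_eq_square power3_eq_cube numeral_eq_Suc)
    moreover have "N ^ 7 / (2 ^ 30 * K ^ 9) = N ^ 6 * (2 * (N / (2 ^ 31 * K ^ 9)))"
      using K0 by (simp add: field_simps numeral_eq_Suc)
    ultimately have "N ^ 6 * (2 * (N / (2 ^ 31 * K ^ 9))) \<le> N ^ 6 * (N / (2 ^ 31 * K ^ 9) + 2)"
      by linarith
    then have "2 * (N / (2 ^ 31 * K ^ 9)) \<le> N / (2 ^ 31 * K ^ 9) + 2"
      using N0 by (subst (asm) mult_le_cancel_left_pos) auto
    then have "N / (2 ^ 31 * K ^ 9) \<le> 2" by linarith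
    then have "N \<le> 2 ^ 32 * K ^ 9" using K0 by (simp add: divide_le_eq)
    moreover have "2 ^ 32 * K ^ 9 < 2 ^ 42 * K ^ 11" using pow[of 9] K11 by simp
    ultimately show False using N by simp
  qed
  then obtain l q0 q1 where l: "l \<in> B" "q0 \<in> pl l" "q1 \<in> pl l" "q0 \<noteq> q1"
    "T \<le> (\<Sum>q2\<in>pl l. c l q0 q1 q2)" by blast
  define D where "D = 8 * N * K"
  \<comment> \<open>A point \<open>z\<close> off \<open>l\<close> is the only intersection of a line
    through \<open>q0\<close> with a line through \<open>q1\<close>. These two lines differ, since
    otherwise both would be \<open>l\<close>; hence at most \<open>D^2\<close> points
    \<open>z\<close>.\<close>
  have cD: "c l q0 q1 q2 \<le> D\<^sup>2" for q2
  proof -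
    let ?S = "{z \<in> Z l. J z q0 \<and> J z q1 \<and> J z q2}"
    let ?L = "\<lambda>q. {l' \<in> B. E q l'}"
    have "\<exists>g. \<forall>z\<in>?S. fst (g z) \<in> B \<and> snd (g z) \<in> B \<and> E z (fst (g z)) \<and> E z (snd (g z))
        \<and> E q0 (fst (g z)) \<and> E q1 (snd (g z))"
      by (rule bchoice) (auto simp: J_def)
    then obtain g where g: "\<And>z. z \<in> ?S \<Longrightarrow> fst (g z) \<in> B \<and> snd (g z) \<in> B \<and> E z (fst (g z)) \<and> E z (snd (g z))
        \<and> E q0 (fst (g z)) \<and> E q1 (snd (g z))" by blast
    have "inj_on g ?S"
    proof (rule inj_onI)
      fix z z' assume z: "z \<in> ?S" "z' \<in> ?S" "g z = g z'"
      note g1 = g[OF z(1)] and g2 = g[OF z(2)]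
      have "fst (g z) \<noteq> snd (g z)"
      proof
        assume "fst (g z) = snd (g z)"
        then have "fst (g z) = l"
          using rectangle_freeD[OF free, of q0 q1 "fst (g z)" l] g1 l by (auto simp: pl_def)
        then show False using g1 z(1) by (auto simp: Z_def)
      qed
      then show "z = z'"
        using rectangle_freeD[OF free, of z z' "fst (g z)" "snd (g z)"] g1 g2 z by (auto simp: Z_def)
    qed
    moreover have "g ` ?S \<subseteq> ?L q0 \<times> ?L q1" 
    proof
      fix w assume "w \<in> g ` ?S"
      then obtain z where "z \<in> ?S" "w = g z" by blast
      then show "w \<in> ?L q0 \<times> ?L q1" using g[of z] by (simp add: mem_Times_iff)
    qed
    ultimately have "card ?S \<le> card (?L q0 \<times> ?L q1)" using fin by (intro card_inj_on_le) auto
    then have "real (card ?S) \<le> real (card (?L q0)) * real (card (?L q1))"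
      by (simp add: card_cartesian_product flip: of_nat_mult)
    also have "\<dots> \<le> D * D"
      using degA l N0 K0 unfolding D_def pl_def by (intro mult_mono) auto
    finally show ?thesis by (simp add: c_def power2_eq_square)
  qed
  \<comment> \<open>Chosen such that \<open>D * t = T / 4\<close>: the unpopular third points use up
    at most a quarter of the total. Discarding \<open>q0\<close> and \<open>q1\<close> from
    \<open>Q\<close> costs two elements, which the lower bound on \<open>N\<close> pays for.\<close>
  define t where "t = N\<^sup>2 / (2 ^ 37 * K ^ 10)"
  define Q where "Q = {q \<in> pl l. t \<le> c l q0 q1 q} - {q0, q1}"
  have t0: "t \<ge> 0" using K0 by (simp add: t_def)
  have "T \<le> real (card (pl l)) * t + real (card {q \<in> pl l. t \<le> c l q0 q1 q}) * D\<^sup>2"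
    using card_popular[OF fpl(1) cD t0, of "\<lambda>q. q" l] l(5) by linarith
  also have "real (card (pl l)) * t \<le> D * t"
    using degB[OF l(1)] t0 unfolding D_def pl_def by (intro mult_right_mono) auto
  also have "D * t = T / 4"
    using K0 by (simp add: D_def t_def T_def field_simps power2_eq_square power3_eq_cube numeral_eq_Suc)
  finally have "T / 2 \<le> real (card {q \<in> pl l. t \<le> c l q0 q1 q}) * D\<^sup>2" using T0 by linarith
  moreover have "T / 2 = N / (2 ^ 39 * K ^ 11) * D\<^sup>2"
    using K0 by (simp add: D_def T_def field_simps power2_eq_square power3_eq_cube numeral_eq_Suc)
  moreover have "D\<^sup>2 > 0" using N0 K0 by (simp add: D_def)
  ultimately have "N / (2 ^ 39 * K ^ 11) \<le> real (card {q \<in> pl l. t \<le> c l q0 q1 q})"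
    by (metis mult_le_cancel_right_pos)
  moreover have "real (card {q \<in> pl l. t \<le> c l q0 q1 q}) \<le> real (card Q) + 2"
  proof -
    have "card {q \<in> pl l. t \<le> c l q0 q1 q} \<le> card (Q \<union> {q0, q1})"
      using fpl by (intro card_mono) (auto simp: Q_def)
    also have "\<dots> \<le> card Q + card {q0, q1}" by (rule card_Un_le)
    also have "card {q0, q1} \<le> 2" by (simp add: card_insert_if)
    finally show ?thesis by simp
  qed
  moreover have "2 \<le> N / (2 ^ 40 * K ^ 11)" using N K11 K0 by (subst pos_le_divide_eq) (auto simp del: one_le_power)
  moreover have "N / (2 ^ 39 * K ^ 11) = 2 * (N / (2 ^ 40 * K ^ 11))" using K0 by (simp add: field_simps)
  ultimately have cQ: "N / (2 ^ 40 * K ^ 11) \<le> real (card Q)" by linarith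
  have "\<forall>q\<in>Q. E q l \<and> N\<^sup>2 / (2 ^ 37 * K ^ 10) \<le> real (card {z \<in> A. \<not> E z l \<and>
        (\<exists>l'\<in>B. E z l' \<and> E q0 l') \<and> (\<exists>l'\<in>B. E z l' \<and> E q1 l') \<and> (\<exists>l'\<in>B. E z l' \<and> E q l')})"
    by (auto simp: Q_def pl_def c_def t_def Z_def J_def conj_assoc)
  moreover have "Q \<subseteq> A" "q0 \<notin> Q" "q1 \<notin> Q" "q0 \<in> A" "q1 \<in> A" "E q0 l" "E q1 l"
    using l by (auto simp: Q_def pl_def)
  ultimately show ?thesis using cQ l by blast
qed

text \<open>Pruning at degree \<open>8 N K\<close> loses \<open>N^3 / (4 K)\<close> edges on each
  side, half of them altogether. Thinning \<open>B\<close> after \<open>A\<close> only lowers the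
  degrees on \<open>A'\<close>, so both degree bounds survive.\<close>

lemma rich_line:
  fixes E :: "'a \<Rightarrow> 'b \<Rightarrow> bool"
  assumes fin: "finite A" "finite B" and free: "rectangle_free E A B"
    and n: "real (card A) \<le> N\<^sup>2" "real (card B) \<le> N\<^sup>2"
    and K: "K \<ge> 1" and N: "2 ^ 42 * K ^ 11 \<le> N"
    and many: "N ^ 3 / K \<le> edges E A B"
  shows "\<exists>A'\<subseteq>A. \<exists>B'\<subseteq>B. \<exists>l\<in>B'. \<exists>q0\<in>A'. \<exists>q1\<in>A'. \<exists>Q\<subseteq>A'.
    E q0 l \<and> E q1 l \<and> q0 \<noteq> q1 \<and> q0 \<notin> Q \<and> q1 \<notin> Q
    \<and> (\<forall>q\<in>A'. real (card {l' \<in> B'. E q l'}) \<le> 8 * N * K)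
    \<and> N / (2 ^ 40 * K ^ 11) \<le> real (card Q)
    \<and> (\<forall>q\<in>Q. E q l \<and> N\<^sup>2 / (2 ^ 37 * K ^ 10) \<le> real (card {z \<in> A'. \<not> E z l \<and>
        (\<exists>l'\<in>B'. E z l' \<and> E q0 l') \<and> (\<exists>l'\<in>B'. E z l' \<and> E q1 l') \<and> (\<exists>l'\<in>B'. E z l' \<and> E q l')}))"
proof -
  have K0: "K > 0" using K by simp
  have "1 \<le> K ^ 11" using K by (rule one_le_power)
  then have N0: "N > 0" using N by (smt (verit) mult_le_cancel_left1 zero_less_power)
  define D where "D = 8 * N * K"
  have D0: "D > 0" using N0 K0 by (simp add: D_def)
  have loss: "2 * (N\<^sup>2)\<^sup>2 / D = N ^ 3 / (4 * K)"
    using N0 K0 by (simp add: D_def field_simps power2_eq_square power3_eq_cube)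
  define A' where "A' = {a \<in> A. real (card {b \<in> B. E a b}) \<le> D}"
  define B' where "B' = {b \<in> B. real (card {a \<in> A'. E a b}) \<le> D}"
  have sub: "A' \<subseteq> A" "B' \<subseteq> B" by (auto simp: A'_def B'_def)
  have fin': "finite A'" "finite B'" using sub fin finite_subset by auto
  have cA: "card A' \<le> card A" "card B' \<le> card B" using sub fin by (auto intro: card_mono)
  have n': "real (card A') \<le> N\<^sup>2" "real (card B') \<le> N\<^sup>2" using cA n by linarith+
  have "edges E A B \<le> edges E A' B + N ^ 3 / (4 * K)"
    using prune_high_degrees[OF fin free n D0] unfolding loss A'_def .
  moreover have "edges (\<lambda>b a. E a b) B A' \<le> edges (\<lambda>b a. E a b) B' A' + N ^ 3 / (4 * K)"
    using prune_high_degrees[OF fin(2) fin'(1) rectangle_free_swap[OF rectangle_free_subset[OF free sub(1) subset_refl]] n(2) n'(1) D0]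
    unfolding loss B'_def .
  moreover have "edges (\<lambda>b a. E a b) B A' = edges E A' B" "edges (\<lambda>b a. E a b) B' A' = edges E A' B'"
    using edges_swap fin fin' by metis+
  moreover have "N ^ 3 / K = N ^ 3 / (2 * K) + (N ^ 3 / (4 * K) + N ^ 3 / (4 * K))"
    using K0 by (simp add: field_simps)
  ultimately have many': "N ^ 3 / (2 * K) \<le> edges E A' B'" using many by linarith
  have degA: "real (card {b \<in> B'. E a b}) \<le> 8 * N * K" if "a \<in> A'" for a
  proof -
    have "card {b \<in> B'. E a b} \<le> card {b \<in> B. E a b}" using fin sub by (intro card_mono) auto
    then show ?thesis using that by (simp add: A'_def D_def)
  qed
  have degB: "real (card {a \<in> A'. E a b}) \<le> 8 * N * K" if "b \<in> B'" for b
    using that by (simp add: B'_def D_def)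
  obtain l q0 q1 Q where h: "l \<in> B'" "q0 \<in> A'" "q1 \<in> A'" "Q \<subseteq> A'"
    "E q0 l" "E q1 l" "q0 \<noteq> q1" "q0 \<notin> Q" "q1 \<notin> Q" "N / (2 ^ 40 * K ^ 11) \<le> real (card Q)"
    "\<forall>q\<in>Q. E q l \<and> N\<^sup>2 / (2 ^ 37 * K ^ 10) \<le> real (card {z \<in> A'. \<not> E z l \<and>
        (\<exists>l'\<in>B'. E z l' \<and> E q0 l') \<and> (\<exists>l'\<in>B'. E z l' \<and> E q1 l') \<and> (\<exists>l'\<in>B'. E z l' \<and> E q l')})"
    using rich_line_bounded_degree[OF fin' rectangle_free_subset[OF free sub] n' K N many' degA degB] by blast
  have deg: "\<forall>q\<in>A'. real (card {l' \<in> B'. E q l'}) \<le> 8 * N * K" using degA by blast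
  show ?thesis
    by (rule exI[of _ A'], intro conjI, rule sub, rule exI[of _ B'], intro conjI, rule sub)
      (intro bexI[of _ l] bexI[of _ q0] bexI[of _ q1] exI[of _ Q] conjI h deg)
qed

text \<open>The second moment of the degrees over all points of the plane gives the bound of Vinh.\<close>

lemma edges_regular:
  assumes fin: "finite \<Omega>" "finite B" and free: "rectangle_free E \<Omega> B" and A: "A \<subseteq> \<Omega>"
    and q: "q > 0" "real (card \<Omega>) = q\<^sup>2"
    and reg: "\<And>b. b \<in> B \<Longrightarrow> real (card {a \<in> \<Omega>. E a b}) = q"
  shows "(edges E A B - real (card A) * real (card B) / q)\<^sup>2 \<le> q * real (card A) * real (card B)"
proof -
  let ?d = "\<lambda>a. real (card {b \<in> B. E a b})"
  define m where "m = real (card B) / q"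
  have "edges E \<Omega> B = edges (\<lambda>b a. E a b) B \<Omega>" by (rule edges_swap[OF fin])
  also have "\<dots> = real (card B) * q" unfolding edges_def using reg by simp
  finally have e: "edges E \<Omega> B = real (card B) * q" .
  have fA: "finite A" using A fin finite_subset by blast
  have "(\<Sum>a\<in>\<Omega>. (?d a - m)\<^sup>2) = (\<Sum>a\<in>\<Omega>. (?d a)\<^sup>2) - 2 * m * edges E \<Omega> B + real (card \<Omega>) * m\<^sup>2"
    by (simp add: power2_diff sum.distrib sum_subtractf edges_def sum_distrib_left mult_ac)
  also have "\<dots> \<le> edges E \<Omega> B + (real (card B))\<^sup>2 - 2 * m * edges E \<Omega> B + real (card \<Omega>) * m\<^sup>2"
    using sum_degree_squares[OF fin free] by simp
  also have "\<dots> = q * real (card B)"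
    unfolding e q(2) m_def using q(1) by (simp add: field_simps power2_eq_square)
  finally have var: "(\<Sum>a\<in>\<Omega>. (?d a - m)\<^sup>2) \<le> q * real (card B)" .
  have "(edges E A B - real (card A) * real (card B) / q)\<^sup>2 = (\<Sum>a\<in>A. ?d a - m)\<^sup>2"
    by (simp add: edges_def sum_subtractf m_def)
  also have "\<dots> \<le> (\<Sum>a\<in>A. (?d a - m)\<^sup>2) * real (card A)" by (rule sum_squared_le_sum_of_squares)
  also have "\<dots> \<le> (\<Sum>a\<in>\<Omega>. (?d a - m)\<^sup>2) * real (card A)"
    using fin A by (intro mult_right_mono sum_mono2) auto
  also have "\<dots> \<le> (q * real (card B)) * real (card A)" using var by (intro mult_right_mono) auto
  finally show ?thesis by (simp add: mult_ac)
qed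

subsection \<open>Circles, lines and pencils\<close>

context finite_field
begin

lemma nonzero_inv: "x \<in> carrier R \<Longrightarrow> x \<noteq> \<zero> \<Longrightarrow> inv x \<in> carrier R \<and> x \<otimes> inv x = \<one> \<and> inv x \<otimes> x = \<one> \<and> inv x \<noteq> \<zero>"
  using field_Units Units_inv_closed Units_r_inv Units_l_inv zero_not_one by (metis DiffI r_null empty_iff insert_iff)

lemma minus_eq_zero: "x \<in> carrier R \<Longrightarrow> y \<in> carrier R \<Longrightarrow> x \<ominus> y = \<zero> \<longleftrightarrow> x = y"
  by auto

text \<open>Lagrange's theorem in the additive group of \<open>K\<close>, which has prime order: the
  subgroup \<open>K\<close> intersected with \<open>E\<close> contains both zero and one, so it is
  not trivial.\<close>

lemma prime_subfield_subset:
  assumes K: "subfield K R" and E: "subfield E R" and p: "prime (card K)"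
  shows "K \<subseteq> E"
proof -
  note Kr = subringE[OF subfieldE(1)[OF K]] and Er = subringE[OF subfieldE(1)[OF E]]
  have sK: "subgroup K (add_monoid R)" and sE: "subgroup E (add_monoid R)"
    using subring.axioms(1) subfieldE(1) K E by blast+
  have sH: "subgroup (K \<inter> E) (add_monoid R)" using add.subgroups_Inter_pair[OF sK sE] .
  have "subgroup (K \<inter> E) (add_monoid R \<lparr>carrier := K\<rparr>)"
    by (rule add.subgroup_incl[OF sH sK]) simp
  from group.lagrange[OF add.subgroup_imp_group[OF sK] this]
  have "card (K \<inter> E) dvd card K" unfolding order_def by (metis dvd_triv_right partial_object.select_convs(1) partial_object.update_convs(1))
  moreover have "card (K \<inter> E) \<noteq> 1"
  proof
    assume "card (K \<inter> E) = 1"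
    then obtain x where "K \<inter> E = {x}" by (auto simp: card_1_singleton_iff)
    then have "\<zero> = \<one>" using Kr(2,3) Er(2,3) by (metis IntI singletonD)
    then show False using zero_not_one by simp
  qed
  ultimately have "card (K \<inter> E) = card K" using p by (meson prime_nat_iff)
  moreover have "finite K" using Kr(1) finite_sub by blast
  ultimately have "K \<inter> E = K" by (intro card_subset_eq) auto
  then show ?thesis by blast
qed

text \<open>\<open>E\<close> contains \<open>K\<close> and some \<open>t\<close> outside it, and the
  elements \<open>x + t y\<close> with \<open>x\<close>, \<open>y\<close> in \<open>K\<close> are
  distinct.\<close>

lemma subfield_of_prime_square:
  assumes K: "subfield K R" and E: "subfield E R" and p: "prime (card K)" and ne: "E \<noteq> K"
  shows "(card K)\<^sup>2 \<le> card E"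
proof -
  note Kr = subringE[OF subfieldE(1)[OF K]] and Er = subringE[OF subfieldE(1)[OF E]]
  have KE: "K \<subseteq> E" by (rule prime_subfield_subset[OF K E p])
  then obtain t where t: "t \<in> E" "t \<notin> K" using ne by blast
  have tc: "t \<in> carrier R" using t Er by auto
  have inj: "inj_on (\<lambda>(x, y). x \<oplus> t \<otimes> y) (K \<times> K)"
  proof (rule inj_onI, clarify)
    fix x y x' y' assume k: "x \<in> K" "y \<in> K" "x' \<in> K" "y' \<in> K" and e: "x \<oplus> t \<otimes> y = x' \<oplus> t \<otimes> y'"
    have kc: "x \<in> carrier R" "y \<in> carrier R" "x' \<in> carrier R" "y' \<in> carrier R" using k Kr(1) by auto
    have "(y \<ominus> y') \<otimes> t = (x \<oplus> t \<otimes> y) \<ominus> (x \<oplus> t \<otimes> y')" using kc tc by algebra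
    also have "\<dots> = x' \<ominus> x" unfolding e using kc tc by algebra
    finally have e': "(y \<ominus> y') \<otimes> t = x' \<ominus> x" .
    have dif: "y \<ominus> y' \<in> K" "x' \<ominus> x \<in> K" using k Kr(5,7) unfolding a_minus_def by auto
    have "y \<ominus> y' = \<zero>"
      using subfield_m_inv_simprule[OF K, of "y \<ominus> y'" t] dif tc e' t(2) by auto
    then have "y = y'" using kc by simp
    with e kc tc show "x = x' \<and> y = y'" by simp
  qed
  have "(\<lambda>(x, y). x \<oplus> t \<otimes> y) ` (K \<times> K) \<subseteq> E" using KE t(1) Er(6,7) by (auto simp: subset_iff)
  moreover have "finite E" using Er(1) finite_sub by blast
  ultimately have "card ((\<lambda>(x, y). x \<oplus> t \<otimes> y) ` (K \<times> K)) \<le> card E" by (intro card_mono)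
  then show ?thesis using inj by (simp add: card_image card_cartesian_product power2_eq_square)
qed

text \<open>The points \<open>x\<close> with \<open>(x - a) / (b - x) \<in> s K\<close> form a circle of the inversive plane over \<open>K\<close>;
  the relation between four of them below is the invariance of the cross ratio.\<close>

lemma circle_in_coset:
  assumes K: "subfield K R" and c: "a \<in> carrier R" "b \<in> carrier R" "s \<in> carrier R" "a \<noteq> b" "s \<noteq> \<zero>"
    and X: "X \<subseteq> carrier R" "\<And>x. x \<in> X \<Longrightarrow> \<exists>r\<in>K. x \<ominus> a = r \<otimes> s \<otimes> (b \<ominus> x)"
    and x3: "x1 \<in> X" "x2 \<in> X" "x3 \<in> X" "x1 \<noteq> x2" "x2 \<noteq> x3" "x1 \<noteq> x3"
    and dif: "x2 \<ominus> x3 \<in> K" "x2 \<ominus> x1 \<in> K" "x1 \<ominus> x3 \<in> K" and x: "x \<in> X"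
  shows "x \<ominus> x1 \<in> K"
proof -
  note Kr = subringE[OF subfieldE(1)[OF K]]
  have Km: "u \<ominus> v \<in> K" if "u \<in> K" "v \<in> K" for u v using that Kr(5,7) by (auto simp: a_minus_def)
  have "\<exists>r. \<forall>x\<in>X. r x \<in> K \<and> x \<ominus> a = r x \<otimes> s \<otimes> (b \<ominus> x)" by (rule bchoice) (use X(2) in blast)
  then obtain r where r: "\<And>x. x \<in> X \<Longrightarrow> r x \<in> K \<and> x \<ominus> a = r x \<otimes> s \<otimes> (b \<ominus> x)" by blast
  define d where "d = b \<ominus> a"
  have d: "d \<in> carrier R" "d \<noteq> \<zero>" using c minus_eq_zero[of b a] by (auto simp: d_def)
  define w where "w = (\<lambda>x. b \<ominus> x)"
  have wc: "w x \<in> carrier R" if "x \<in> X" for x using that X c by (auto simp: w_def)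
  have rc: "r x \<in> carrier R" if "x \<in> X" for x using r[OF that] Kr(1) by auto
  \<comment> \<open>How differences change under the Moebius map from \<open>x\<close> to its
    parameter \<open>r x\<close>. The factors \<open>s\<close>, \<open>d\<close> and
    \<open>w\<close> cancel in a cross ratio.\<close>
  have key: "(x \<ominus> y) \<otimes> d = (r x \<ominus> r y) \<otimes> (s \<otimes> w x \<otimes> w y)" if xy: "x \<in> X" "y \<in> X" for x y
  proof -
    have cc: "x \<in> carrier R" "y \<in> carrier R" using xy X by auto
    note cc = cc rc[OF xy(1)] rc[OF xy(2)] wc[OF xy(1)] wc[OF xy(2)] c(1-3)
    have 1: "d \<ominus> w x = r x \<otimes> s \<otimes> w x" "d \<ominus> w y = r y \<otimes> s \<otimes> w y"
    proof -
      have "b \<ominus> a \<ominus> (b \<ominus> z) = z \<ominus> a" if "z \<in> carrier R" for z using that c(1,2) by algebra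
      then show "d \<ominus> w x = r x \<otimes> s \<otimes> w x" "d \<ominus> w y = r y \<otimes> s \<otimes> w y"
        using r xy cc(1,2) by (auto simp: d_def w_def)
    qed
    have "(r x \<ominus> r y) \<otimes> (s \<otimes> w x \<otimes> w y) = (r x \<otimes> s \<otimes> w x) \<otimes> w y \<ominus> (r y \<otimes> s \<otimes> w y) \<otimes> w x"
      using cc by algebra
    also have "\<dots> = (d \<ominus> w x) \<otimes> w y \<ominus> (d \<ominus> w y) \<otimes> w x" unfolding 1 ..
    also have "\<dots> = (w y \<ominus> w x) \<otimes> d" using cc d(1) by algebra
    also have "w y \<ominus> w x = x \<ominus> y" unfolding w_def using cc by algebra
    finally show ?thesis ..
  qed
  have inj: "r x \<noteq> r y" if "x \<in> X" "y \<in> X" "x \<noteq> y" for x y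
  proof
    assume "r x = r y"
    then have "(x \<ominus> y) \<otimes> d = \<zero>" using key[OF that(1,2)] rc[OF that(2)] wc that c(3)
      by (simp add: a_minus_def r_neg)
    moreover have "x \<in> carrier R" "y \<in> carrier R" using that X(1) by auto
    then have "x \<ominus> y \<noteq> \<zero>" "x \<ominus> y \<in> carrier R" using that(3) minus_eq_zero by auto
    ultimately show False using integral d by blast
  qed
  have xc: "x \<in> carrier R" "x1 \<in> carrier R" "x2 \<in> carrier R" "x3 \<in> carrier R" using x x3 X by auto
  \<comment> \<open>Equality of the cross ratios of \<open>x, x1, x2, x3\<close> and of their
    parameters, with denominators cleared, reads \<open>(x - x1) A = (x - x3) B\<close>. As
    \<open>A\<close> and \<open>B\<close> lie in \<open>K\<close>, this is a linear equation over
    \<open>K\<close> for \<open>x - x1\<close>.\<close>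
  define A where "A = (x2 \<ominus> x3) \<otimes> ((r x \<ominus> r x3) \<otimes> (r x2 \<ominus> r x1))"
  define B where "B = (x2 \<ominus> x1) \<otimes> ((r x \<ominus> r x1) \<otimes> (r x2 \<ominus> r x3))"
  have AB: "A \<in> K" "B \<in> K" unfolding A_def B_def
    by (intro Kr(6) dif Km conjunct1[OF r] x x3)+
  have ABc: "A \<in> carrier R" "B \<in> carrier R" using AB Kr(1) by auto
  have cross: "(x \<ominus> x1) \<otimes> A = (x \<ominus> x3) \<otimes> B"
  proof -
    define e1 e3 f g where "e1 = r x \<ominus> r x1" and "e3 = r x \<ominus> r x3" and "f = r x2 \<ominus> r x1" and "g = r x2 \<ominus> r x3"
    have ec: "e1 \<in> carrier R" "e3 \<in> carrier R" "f \<in> carrier R" "g \<in> carrier R"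
      using rc x x3 by (auto simp: e1_def e3_def f_def g_def)
    define y1 y3 z1 z3 where "y1 = x \<ominus> x1" and "y3 = x \<ominus> x3" and "z1 = x2 \<ominus> x1" and "z3 = x2 \<ominus> x3"
    have yc: "y1 \<in> carrier R" "y3 \<in> carrier R" "z1 \<in> carrier R" "z3 \<in> carrier R"
      using xc by (auto simp: y1_def y3_def z1_def z3_def)
    define v v1 v2 v3 where "v = w x" and "v1 = w x1" and "v2 = w x2" and "v3 = w x3"
    have vc: "v \<in> carrier R" "v1 \<in> carrier R" "v2 \<in> carrier R" "v3 \<in> carrier R"
      using wc x x3 by (auto simp: v_def v1_def v2_def v3_def)
    have k: "y1 \<otimes> d = e1 \<otimes> (s \<otimes> v \<otimes> v1)" "y3 \<otimes> d = e3 \<otimes> (s \<otimes> v \<otimes> v3)"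
      "z1 \<otimes> d = f \<otimes> (s \<otimes> v2 \<otimes> v1)" "z3 \<otimes> d = g \<otimes> (s \<otimes> v2 \<otimes> v3)"
      unfolding y1_def y3_def z1_def z3_def e1_def e3_def f_def g_def v_def v1_def v2_def v3_def
      using key x x3 by auto
    have "(y1 \<otimes> (z3 \<otimes> (e3 \<otimes> f))) \<otimes> (d \<otimes> d) = (y1 \<otimes> d) \<otimes> (z3 \<otimes> d) \<otimes> (e3 \<otimes> f)"
      using yc ec d(1) by (simp add: m_ac)
    also have "\<dots> = (y3 \<otimes> d) \<otimes> (z1 \<otimes> d) \<otimes> (e1 \<otimes> g)"
      unfolding k using vc ec c(3) by (simp add: m_ac)
    also have "\<dots> = (y3 \<otimes> (z1 \<otimes> (e1 \<otimes> g))) \<otimes> (d \<otimes> d)"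
      using yc ec d(1) by (simp add: m_ac)
    finally have h: "(y1 \<otimes> (z3 \<otimes> (e3 \<otimes> f))) \<otimes> (d \<otimes> d) = (y3 \<otimes> (z1 \<otimes> (e1 \<otimes> g))) \<otimes> (d \<otimes> d)" .
    have "y1 \<otimes> (z3 \<otimes> (e3 \<otimes> f)) = y3 \<otimes> (z1 \<otimes> (e1 \<otimes> g))"
    proof -
      have "d \<otimes> d \<noteq> \<zero>" using integral d by blast
      moreover have "d \<otimes> d \<in> carrier R" "y1 \<otimes> (z3 \<otimes> (e3 \<otimes> f)) \<in> carrier R" "y3 \<otimes> (z1 \<otimes> (e1 \<otimes> g)) \<in> carrier R"
        using yc ec d(1) by simp_all
      ultimately show ?thesis by (rule iffD1[OF m_rcancel h])
    qed
    then show ?thesis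
      unfolding A_def B_def y1_def y3_def z1_def z3_def e1_def e3_def f_def g_def .
  qed
  have rel: "(A \<ominus> B) \<otimes> (x \<ominus> x1) = (x1 \<ominus> x3) \<otimes> B"
  proof -
    have "(A \<ominus> B) \<otimes> (x \<ominus> x1) = (x \<ominus> x1) \<otimes> A \<ominus> (x \<ominus> x1) \<otimes> B" using xc ABc by algebra
    also have "\<dots> = (x \<ominus> x3) \<otimes> B \<ominus> (x \<ominus> x1) \<otimes> B" unfolding cross ..
    also have "\<dots> = (x1 \<ominus> x3) \<otimes> B" using xc ABc by algebra
    finally show ?thesis .
  qed
  show ?thesis
  proof (cases "A = B")
    case True
    \<comment> \<open>The degenerate case of the linear equation: \<open>B\<close> must vanish, and
      its only factor that can vanish is \<open>r x - r x1\<close>, so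
      \<open>x = x1\<close>.\<close>
    have nz: "x1 \<ominus> x3 \<noteq> \<zero>" "x2 \<ominus> x1 \<noteq> \<zero>" using xc x3 minus_eq_zero[of x1 x3] minus_eq_zero[of x2 x1] by auto
    have "(x1 \<ominus> x3) \<otimes> B = \<zero>" using rel[symmetric] True ABc xc
      by (simp add: a_minus_def r_neg)
    then have "B = \<zero>" using integral nz xc ABc by blast
    moreover have "r x2 \<ominus> r x3 \<noteq> \<zero>" using inj[OF x3(2,3,5)] rc x3 minus_eq_zero by blast
    ultimately have "r x \<ominus> r x1 = \<zero>"
      unfolding B_def using nz xc rc x x3 integral by (metis m_closed minus_closed)
    then have "r x = r x1" using rc x x3 minus_eq_zero by blast
    then have "x = x1" using inj[OF x x3(1)] by blast
    then show ?thesis using xc Kr(2) by (simp add: a_minus_def r_neg)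
  next
    case False
    then have "A \<ominus> B \<noteq> \<zero>" using ABc by simp
    then show ?thesis
      using subfield_m_inv_simprule[OF K, of "A \<ominus> B" "x \<ominus> x1"] Km[OF AB] rel xc dif AB Kr(6) by auto
  qed
qed

text \<open>If no piece has three points of the circle, the count is at most \<open>2 |J|\<close>.
  Otherwise the circle lies in one coset of \<open>K\<close>; as \<open>t\<close> is outside
  \<open>K\<close>, distinct \<open>j\<close> give distinct cosets, and all of \<open>X\<close>
  falls into a single piece \<open>A j\<close>.\<close>

lemma card_circle_le:
  assumes K: "subfield K R" and c: "a \<in> carrier R" "b \<in> carrier R" "s \<in> carrier R" "a \<noteq> b" "s \<noteq> \<zero>"
    and X: "X \<subseteq> carrier R" "\<And>x. x \<in> X \<Longrightarrow> \<exists>r\<in>K. x \<ominus> a = r \<otimes> s \<otimes> (b \<ominus> x)"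
    and t: "t \<in> carrier R" "t \<notin> K" and J: "J \<subseteq> K" and cover: "X \<subseteq> (\<Union>j\<in>J. A j)"
    and A: "\<And>j. j \<in> J \<Longrightarrow> A j \<subseteq> K +> (j \<otimes> t)"
    and cA: "\<And>j. j \<in> J \<Longrightarrow> real (card (A j)) \<le> M" and cJ: "real (card J) \<le> M"
  shows "real (card X) \<le> 2 * M"
proof (cases "\<forall>j\<in>J. card (X \<inter> A j) \<le> 2")
  case True
  note Kr = subringE[OF subfieldE(1)[OF K]]
  have fJ: "finite J" using J Kr(1) finite_sub by blast
  have "X = (\<Union>j\<in>J. X \<inter> A j)" using cover by auto
  then have "card X \<le> (\<Sum>j\<in>J. card (X \<inter> A j))" using card_UN_le[OF fJ, of "\<lambda>j. X \<inter> A j"] by simp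
  also have "\<dots> \<le> (\<Sum>j\<in>J. 2)" using True by (intro sum_mono) auto
  finally show ?thesis using cJ by simp
next
  case False
  note Kr = subringE[OF subfieldE(1)[OF K]]
  have Km: "u \<ominus> v \<in> K" if "u \<in> K" "v \<in> K" for u v using that Kr(5,7) by (auto simp: a_minus_def)
  obtain j where j: "j \<in> J" "3 \<le> card (X \<inter> A j)" using False by force
  then obtain S where "S \<subseteq> X \<inter> A j" "card S = 3" by (meson obtain_subset_with_card_n)
  then obtain x1 x2 x3 where x3: "x1 \<in> X \<inter> A j" "x2 \<in> X \<inter> A j" "x3 \<in> X \<inter> A j"
    "x1 \<noteq> x2" "x2 \<noteq> x3" "x1 \<noteq> x3" by (auto simp: card_3_iff)
  have rep: "\<exists>u\<in>K. x = u \<oplus> i \<otimes> t" if "i \<in> J" "x \<in> A i" for x i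
    using A[OF that(1)] that(2) by (auto simp: a_r_coset_defs)
  have jc: "i \<in> carrier R" if "i \<in> J" for i using that J Kr(1) by blast
  have difK: "x \<ominus> y \<in> K" if xy: "x \<in> A j" "y \<in> A j" for x y
  proof -
    obtain u v where u: "u \<in> K" "x = u \<oplus> j \<otimes> t" "v \<in> K" "y = v \<oplus> j \<otimes> t" using rep[OF j(1)] xy by blast
    have "u \<in> carrier R" "v \<in> carrier R" using u Kr(1) by auto
    then have "x \<ominus> y = u \<ominus> v" unfolding u using t(1) jc[OF j(1)] by algebra
    then show ?thesis using Km u by simp
  qed
  have "X \<subseteq> A j"
  proof
    fix x assume x: "x \<in> X"
    have d: "x \<ominus> x1 \<in> K"
      by (rule circle_in_coset[OF K c X, of x1 x2 x3]) (use x3 x difK in auto)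
    obtain i where i: "i \<in> J" "x \<in> A i" using cover x by blast
    obtain u where u: "u \<in> K" "x = u \<oplus> i \<otimes> t" using rep i by blast
    obtain v where v: "v \<in> K" "x1 = v \<oplus> j \<otimes> t" using rep[OF j(1)] x3 by blast
    have uv: "u \<in> carrier R" "v \<in> carrier R" "i \<in> carrier R" "j \<in> carrier R" using u v jc i j Kr(1) by auto
    have "(i \<ominus> j) \<otimes> t = (x \<ominus> x1) \<ominus> (u \<ominus> v)" unfolding u v using uv t(1) by algebra
    then have m: "(i \<ominus> j) \<otimes> t \<in> K" using Km d u v by simp
    have "i \<ominus> j = \<zero>"
      using subfield_m_inv_simprule[OF K, of "i \<ominus> j" t] m t Km i(1) j(1) J by auto
    then have "i = j" using uv by simp
    then show "x \<in> A j" using i by simp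
  qed
  moreover have "finite (A j)"
    using j(2) rep[OF j(1)] Kr(1) t jc[OF j(1)] by (intro finite_sub) (auto dest!: rep[OF j(1)])
  ultimately have "card X \<le> card (A j)" by (intro card_mono)
  moreover have "M \<ge> 0" using cJ by (meson of_nat_0_le_iff order_trans)
  ultimately show ?thesis using cA[OF j(1)] by linarith
qed

section \<open>Lines of the plane and pencils as projective coordinates\<close>

definition graph_line :: "'a \<Rightarrow> 'a \<Rightarrow> ('a \<times> 'a) set" where
  "graph_line m b = {(x, y) \<in> carrier R \<times> carrier R. y = m \<otimes> x \<oplus> b}"

lemma line_cases:
  assumes "l \<in> lines R"
  obtains (graph) m b where "m \<in> carrier R" "b \<in> carrier R" "l = graph_line m b"
    | (vertical) c where "c \<in> carrier R" "l = {c} \<times> carrier R"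
proof -
  obtain a b d where h: "a \<in> carrier R" "b \<in> carrier R" "d \<in> carrier R" "a \<noteq> \<zero> \<or> b \<noteq> \<zero>"
    and l: "l = {(x, y) \<in> carrier R \<times> carrier R. a \<otimes> x \<oplus> b \<otimes> y = d}"
    using assms unfolding lines_def by blast
  show thesis
  proof (cases "b = \<zero>")
    case True
    then have a: "a \<noteq> \<zero>" using h by simp
    note ia = nonzero_inv[OF h(1) a]
    have eqv: "a \<otimes> x = d \<longleftrightarrow> x = inv a \<otimes> d" if x: "x \<in> carrier R" for x
    proof
      assume "a \<otimes> x = d"
      then have "inv a \<otimes> d = (inv a \<otimes> a) \<otimes> x" using ia h(1) x m_assoc[of "inv a" a x] by simp
      then show "x = inv a \<otimes> d" using ia x by simp
    next
      assume "x = inv a \<otimes> d"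
      then have "a \<otimes> x = (a \<otimes> inv a) \<otimes> d" using ia h(1,3) m_assoc[of a "inv a" d] by simp
      then show "a \<otimes> x = d" using ia h by simp
    qed
    have "a \<otimes> x \<oplus> b \<otimes> y = d \<longleftrightarrow> x = inv a \<otimes> d" if "x \<in> carrier R" "y \<in> carrier R" for x y
      using that True h(1) eqv by simp
    then have "l = {(x, y) \<in> carrier R \<times> carrier R. x = inv a \<otimes> d}"
      unfolding l by (intro Collect_cong) (simp cong: conj_cong split: prod.split)
    also have "\<dots> = {inv a \<otimes> d} \<times> carrier R" using ia h(3) by auto
    finally have "l = {inv a \<otimes> d} \<times> carrier R" .
    then show thesis using vertical ia h by blast
  next
    case False
    note ib = nonzero_inv[OF h(2) False]
    have "a \<otimes> x \<oplus> b \<otimes> y = d \<longleftrightarrow> y = \<ominus> (inv b \<otimes> a) \<otimes> x \<oplus> inv b \<otimes> d"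
      if x: "x \<in> carrier R" "y \<in> carrier R" for x y
    proof
      assume e: "a \<otimes> x \<oplus> b \<otimes> y = d"
      have "\<ominus> (inv b \<otimes> a) \<otimes> x \<oplus> inv b \<otimes> d = (inv b \<otimes> b) \<otimes> y"
      proof -
        have "\<ominus> (i \<otimes> a) \<otimes> x \<oplus> i \<otimes> (a \<otimes> x \<oplus> b \<otimes> y) = (i \<otimes> b) \<otimes> y" if "i \<in> carrier R" for i
          using that h(1,2) x by algebra
        then show ?thesis using ib e by metis
      qed
      then show "y = \<ominus> (inv b \<otimes> a) \<otimes> x \<oplus> inv b \<otimes> d" using ib x by simp
    next
      assume y: "y = \<ominus> (inv b \<otimes> a) \<otimes> x \<oplus> inv b \<otimes> d"
      have "a \<otimes> x \<oplus> b \<otimes> y = a \<otimes> x \<ominus> (b \<otimes> inv b) \<otimes> (a \<otimes> x) \<oplus> (b \<otimes> inv b) \<otimes> d"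
      proof -
        have "a \<otimes> x \<oplus> b \<otimes> (\<ominus> (i \<otimes> a) \<otimes> x \<oplus> i \<otimes> d) = a \<otimes> x \<ominus> (b \<otimes> i) \<otimes> (a \<otimes> x) \<oplus> (b \<otimes> i) \<otimes> d"
          if "i \<in> carrier R" for i
          using that h(1-3) x(1) by algebra
        then show ?thesis unfolding y using ib by blast
      qed
      then show "a \<otimes> x \<oplus> b \<otimes> y = d" using ib h x by (simp add: a_minus_def r_neg)
    qed
    then have "l = graph_line (\<ominus> (inv b \<otimes> a)) (inv b \<otimes> d)" 
      unfolding l graph_line_def by (intro Collect_cong) (simp cong: conj_cong split: prod.split)
    then show thesis using ib h by (intro graph) auto
  qed
qed

lemma graph_lines_eq:
  assumes c: "m \<in> carrier R" "b \<in> carrier R" "m' \<in> carrier R" "b' \<in> carrier R"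
    and q: "q \<in> graph_line m b" "q \<in> graph_line m' b'" "q' \<in> graph_line m b" "q' \<in> graph_line m' b'" "q \<noteq> q'"
  shows "m = m' \<and> b = b'"
proof -
  obtain x y x' y' where z: "q = (x, y)" "q' = (x', y')" by (metis surj_pair)
  have xc: "x \<in> carrier R" "x' \<in> carrier R"
    and e: "y = m \<otimes> x \<oplus> b" "y = m' \<otimes> x \<oplus> b'" "y' = m \<otimes> x' \<oplus> b" "y' = m' \<otimes> x' \<oplus> b'"
    using q unfolding z graph_line_def by simp_all
  have "x \<noteq> x'" using q(5) e(1,3) z by blast
  have s: "(m \<ominus> m') \<otimes> u = b' \<ominus> b" if u: "u \<in> carrier R" "m \<otimes> u \<oplus> b = m' \<otimes> u \<oplus> b'" for u
  proof -
    have "(m \<ominus> m') \<otimes> u = (m \<otimes> u \<oplus> b) \<ominus> b \<ominus> m' \<otimes> u" using c u(1) by algebra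
    also have "\<dots> = b' \<ominus> b" unfolding u(2) using c u(1) by algebra
    finally show ?thesis .
  qed
  have "(m \<ominus> m') \<otimes> x = (m \<ominus> m') \<otimes> x'" using s xc e by metis
  then have "m \<ominus> m' = \<zero>" using m_lcancel[of "m \<ominus> m'" x x'] \<open>x \<noteq> x'\<close> c xc by auto
  then have "m = m'" using c by simp
  moreover have "m \<otimes> x \<oplus> b = m \<otimes> x \<oplus> b'" using e(1,2) \<open>m = m'\<close> by simp
  then have "b = b'" using c xc by simp
  ultimately show ?thesis by blast
qed

lemma rectangle_free_lines: "rectangle_free (\<in>) P (lines R)"
  unfolding rectangle_free_def
proof (intro ballI impI)
  fix q q' l l' assume l: "l \<in> lines R" "l' \<in> lines R" and q: "q \<in> l" "q \<in> l'" "q' \<in> l" "q' \<in> l'"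
  show "q = q' \<or> l = l'"
    using l(1)
  proof (cases rule: line_cases)
    case (graph m b)
    note g = this
    show ?thesis
      using l(2)
    proof (cases rule: line_cases)
      case (graph m' b')
      then show ?thesis using g graph_lines_eq[of m b m' b' q q'] q by metis
    next
      case (vertical c)
      then show ?thesis using g q by (auto simp: graph_line_def)
    qed
  next
    case (vertical c)
    note g = this
    show ?thesis
      using l(2)
    proof (cases rule: line_cases)
      case (graph m' b')
      then show ?thesis using g q by (auto simp: graph_line_def)
    next
      case (vertical c')
      then show ?thesis using g q by auto
    qed
  qed
qed

text \<open>The projective map that sends the line \<open>y = m x + b\<close> to infinity turns the pencil of lines through
  \<open>(a, m a + b)\<close> into a pencil of parallel lines; \<open>pencil m b a\<close> is the parameter of the line.\<close>

definition pencil :: "'a \<Rightarrow> 'a \<Rightarrow> 'a \<Rightarrow> 'a \<times> 'a \<Rightarrow> 'a" where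
  "pencil m b a z = (fst z \<ominus> a) \<otimes> inv (snd z \<ominus> (m \<otimes> fst z \<oplus> b))"

lemma off_line:
  assumes "m \<in> carrier R" "b \<in> carrier R" "z \<in> carrier R \<times> carrier R" "z \<notin> graph_line m b"
  shows "snd z \<ominus> (m \<otimes> fst z \<oplus> b) \<noteq> \<zero>" "snd z \<ominus> (m \<otimes> fst z \<oplus> b) \<in> carrier R" "fst z \<in> carrier R" "snd z \<in> carrier R"
  using assms by (auto simp: graph_line_def mem_Times_iff)

lemma pencil_closed:
  assumes "m \<in> carrier R" "b \<in> carrier R" "a \<in> carrier R" "z \<in> carrier R \<times> carrier R" "z \<notin> graph_line m b"
  shows "pencil m b a z \<in> carrier R"
  using off_line[OF assms(1,2,4,5)] nonzero_inv assms(3) by (simp add: pencil_def)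

text \<open>On a line of slope \<open>m'\<close> through \<open>(a, m a + b)\<close> the height
  above \<open>y = m x + b\<close> is \<open>(m' - m) (x - a)\<close>, so the parameter is
  \<open>1 / (m' - m)\<close>; on the vertical line it is zero.\<close>

lemma pencil_const:
  assumes c: "m \<in> carrier R" "b \<in> carrier R" "a \<in> carrier R" and l: "l \<in> lines R" "(a, m \<otimes> a \<oplus> b) \<in> l"
  shows "\<exists>k. \<forall>z\<in>l. z \<notin> graph_line m b \<longrightarrow> pencil m b a z = k"
  using l(1)
proof (cases rule: line_cases)
  case (graph m' b')
  have e: "m \<otimes> a \<oplus> b = m' \<otimes> a \<oplus> b'" using l(2) graph by (simp add: graph_line_def)
  have "pencil m b a z = inv (m' \<ominus> m)" if z: "z \<in> l" "z \<notin> graph_line m b" for z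
  proof -
    obtain x y where xy: "z = (x, y)" by (metis surj_pair)
    have x: "x \<in> carrier R" "y = m' \<otimes> x \<oplus> b'" using z(1) graph xy by (auto simp: graph_line_def)
    have zc: "z \<in> carrier R \<times> carrier R" using z(1) graph by (auto simp: graph_line_def)
    have h: "y \<ominus> (m \<otimes> x \<oplus> b) = (m' \<ominus> m) \<otimes> (x \<ominus> a)"
    proof -
      have "y \<ominus> (m \<otimes> x \<oplus> b) = m' \<otimes> x \<ominus> m \<otimes> x \<oplus> ((m' \<otimes> a \<oplus> b') \<ominus> m' \<otimes> a) \<ominus> ((m \<otimes> a \<oplus> b) \<ominus> m \<otimes> a)"
        unfolding x(2) using x(1) c graph(1,2) by algebra
      also have "\<dots> = m' \<otimes> x \<ominus> m \<otimes> x \<oplus> ((m' \<otimes> a \<oplus> b') \<ominus> m' \<otimes> a) \<ominus> ((m' \<otimes> a \<oplus> b') \<ominus> m \<otimes> a)"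
        unfolding e ..
      also have "\<dots> = (m' \<ominus> m) \<otimes> (x \<ominus> a)" using x(1) c graph(1,2) by algebra
      finally show ?thesis .
    qed
    have nz: "y \<ominus> (m \<otimes> x \<oplus> b) \<noteq> \<zero>" using off_line(1)[OF c(1,2) zc z(2)] xy by simp
    define u v where "u = m' \<ominus> m" and "v = x \<ominus> a"
    have uv: "u \<in> carrier R" "v \<in> carrier R" using x(1) c graph by (auto simp: u_def v_def)
    have uv0: "u \<noteq> \<zero>" "v \<noteq> \<zero>" using nz h uv unfolding u_def v_def by auto
    have iv: "inv (u \<otimes> v) = inv u \<otimes> inv v"
    proof (rule comm_inv_char)
      note iu = nonzero_inv[OF uv(1) uv0(1)] nonzero_inv[OF uv(2) uv0(2)]
      have "(u \<otimes> v) \<otimes> (inv u \<otimes> inv v) = (u \<otimes> inv u) \<otimes> (v \<otimes> inv v)"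
        using uv iu by (simp add: m_ac)
      then show "(u \<otimes> v) \<otimes> (inv u \<otimes> inv v) = \<one>" using iu by simp
    qed (use uv nonzero_inv[OF uv(1) uv0(1)] nonzero_inv[OF uv(2) uv0(2)] in auto)
    have "pencil m b a z = v \<otimes> inv (u \<otimes> v)" unfolding pencil_def xy using h by (simp add: u_def v_def)
    also have "\<dots> = inv u \<otimes> (v \<otimes> inv v)"
      unfolding iv using uv nonzero_inv[OF uv(1) uv0(1)] nonzero_inv[OF uv(2) uv0(2)] m_lcomm by blast
    also have "\<dots> = inv u" using nonzero_inv[OF uv(1) uv0(1)] nonzero_inv[OF uv(2) uv0(2)] by simp
    finally show ?thesis by (simp add: u_def)
  qed
  then show ?thesis by blast
next
  case (vertical c')
  have "pencil m b a z = \<zero>" if z: "z \<in> l" "z \<notin> graph_line m b" for z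
  proof -
    have "fst z = a" "z \<in> carrier R \<times> carrier R" using z l(2) vertical by auto
    then show ?thesis
      using off_line[OF c(1,2) _ z(2)] nonzero_inv c(3) by (simp add: pencil_def r_neg a_minus_def)
  qed
  then show ?thesis by blast
qed

lemma card_pencil_le:
  assumes c: "m \<in> carrier R" "b \<in> carrier R" "a \<in> carrier R" and B: "B \<subseteq> lines R" "finite B"
    and Z: "\<And>z. z \<in> Z \<Longrightarrow> z \<notin> graph_line m b \<and> (\<exists>l\<in>B. z \<in> l \<and> (a, m \<otimes> a \<oplus> b) \<in> l)"
  shows "card (pencil m b a ` Z) \<le> card {l \<in> B. (a, m \<otimes> a \<oplus> b) \<in> l}"
proof -
  let ?L = "{l \<in> B. (a, m \<otimes> a \<oplus> b) \<in> l}"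
  have "\<exists>k. \<forall>l\<in>?L. \<forall>z\<in>l. z \<notin> graph_line m b \<longrightarrow> pencil m b a z = k l"
    by (rule bchoice) (use pencil_const[OF c] B in blast)
  then obtain k where k: "\<And>l z. l \<in> ?L \<Longrightarrow> z \<in> l \<Longrightarrow> z \<notin> graph_line m b \<Longrightarrow> pencil m b a z = k l" by blast
  have "pencil m b a ` Z \<subseteq> k ` ?L"
  proof
    fix w assume "w \<in> pencil m b a ` Z"
    then obtain z where z: "z \<in> Z" "w = pencil m b a z" by blast
    then obtain l where l: "l \<in> ?L" "z \<in> l" using Z by blast
    then show "w \<in> k ` ?L" using k[OF l] Z z by auto
  qed
  then have "card (pencil m b a ` Z) \<le> card (k ` ?L)" using B by (intro card_mono) auto
  also have "\<dots> \<le> card ?L" using B by (intro card_image_le) auto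
  finally show ?thesis .
qed

text \<open>The two parameters differ by \<open>(a1 - a0)\<close> over the height of the point above
  the line. This recovers the height, then the abscissa, then the ordinate.\<close>

lemma pencil_inj:
  assumes c: "m \<in> carrier R" "b \<in> carrier R" "a0 \<in> carrier R" "a1 \<in> carrier R" "a0 \<noteq> a1"
    and z: "z \<in> carrier R \<times> carrier R" "z \<notin> graph_line m b" "z' \<in> carrier R \<times> carrier R" "z' \<notin> graph_line m b"
    and e: "pencil m b a0 z = pencil m b a0 z'" "pencil m b a1 z = pencil m b a1 z'"
  shows "z = z'"
proof -
  let ?h = "\<lambda>z. snd z \<ominus> (m \<otimes> fst z \<oplus> b)"
  note o1 = off_line[OF c(1,2) z(1,2)] and o2 = off_line[OF c(1,2) z(3,4)]
  note i1 = nonzero_inv[OF o1(2,1)] and i2 = nonzero_inv[OF o2(2,1)]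
  have dif: "pencil m b a0 w \<ominus> pencil m b a1 w = (a1 \<ominus> a0) \<otimes> inv (?h w)"
    if "inv (?h w) \<in> carrier R" "fst w \<in> carrier R" for w
  proof -
    have "(p \<ominus> a0) \<otimes> i \<ominus> (p \<ominus> a1) \<otimes> i = (a1 \<ominus> a0) \<otimes> i" if "p \<in> carrier R" "i \<in> carrier R" for p i
      using that c(3,4) by algebra
    then show ?thesis unfolding pencil_def using that by blast
  qed
  have "(a1 \<ominus> a0) \<otimes> inv (?h z) = (a1 \<ominus> a0) \<otimes> inv (?h z')"
    using dif[of z] dif[of z'] i1 i2 o1 o2 e by simp
  moreover have "a1 \<ominus> a0 \<noteq> \<zero>" using c minus_eq_zero[of a1 a0] by auto
  ultimately have ii: "inv (?h z) = inv (?h z')" using m_lcancel[of "a1 \<ominus> a0"] c i1 i2 by auto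
  have hh: "?h z = ?h z'"
    using inv_eq_imp_eq[OF ii] o1(1,2) o2(1,2) field_Units by blast
  have "(fst z \<ominus> a0) \<otimes> inv (?h z) = (fst z' \<ominus> a0) \<otimes> inv (?h z)" using e(1) ii unfolding pencil_def by simp
  then have "fst z \<ominus> a0 = fst z' \<ominus> a0" using m_rcancel[of "inv (?h z)"] i1 o1 o2 c by auto
  then have f: "fst z = fst z'" using o1 o2 c by (simp add: a_minus_def)
  have "snd z = ?h z \<oplus> (m \<otimes> fst z \<oplus> b)" "snd z' = ?h z' \<oplus> (m \<otimes> fst z' \<oplus> b)"
  proof -
    have "y = (y \<ominus> w) \<oplus> w" if "y \<in> carrier R" "w \<in> carrier R" for y w using that by algebra
    then show "snd z = ?h z \<oplus> (m \<otimes> fst z \<oplus> b)" "snd z' = ?h z' \<oplus> (m \<otimes> fst z' \<oplus> b)"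
      using o1(3,4) o2(3,4) c(1,2) by (meson m_closed a_closed)+
  qed
  then have "snd z = snd z'" using hh f by simp
  with f show ?thesis by (simp add: prod_eq_iff)
qed

text \<open>Apart from the common denominator, this is the identity
  \<open>(a1 - a) (x - a0) + (a - a0) (x - a1) = (a1 - a0) (x - a)\<close>. A third pencil is thus a
  fixed combination of the first two, and its few lines give few values of
  \<open>u + r v\<close>.\<close>

lemma pencil_linear:
  assumes c: "m \<in> carrier R" "b \<in> carrier R" "a0 \<in> carrier R" "a1 \<in> carrier R" "a \<in> carrier R" "a \<noteq> a1"
    and z: "z \<in> carrier R \<times> carrier R" "z \<notin> graph_line m b"
  shows "pencil m b a0 z \<oplus> ((a \<ominus> a0) \<otimes> inv (a1 \<ominus> a)) \<otimes> pencil m b a1 z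
    = ((a1 \<ominus> a0) \<otimes> inv (a1 \<ominus> a)) \<otimes> pencil m b a z"
proof -
  note o = off_line[OF c(1,2) z]
  note i = nonzero_inv[OF o(2,1)]
  define w where "w = inv (snd z \<ominus> (m \<otimes> fst z \<oplus> b))"
  define k where "k = inv (a1 \<ominus> a)"
  have "a1 \<ominus> a \<noteq> \<zero>" using c minus_eq_zero[of a1 a] by auto
  then have k: "k \<in> carrier R" "k \<otimes> (a1 \<ominus> a) = \<one>" using nonzero_inv[of "a1 \<ominus> a"] c by (auto simp: k_def)
  have wc: "w \<in> carrier R" using i by (simp add: w_def)
  have "(fst z \<ominus> a0) \<otimes> w \<oplus> ((a \<ominus> a0) \<otimes> k) \<otimes> ((fst z \<ominus> a1) \<otimes> w)
      = (k \<otimes> (a1 \<ominus> a)) \<otimes> ((fst z \<ominus> a0) \<otimes> w) \<oplus> ((a \<ominus> a0) \<otimes> k) \<otimes> ((fst z \<ominus> a1) \<otimes> w)"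
    unfolding k(2) using o wc c by simp
  also have "\<dots> = k \<otimes> w \<otimes> ((a1 \<ominus> a) \<otimes> (fst z \<ominus> a0) \<oplus> (a \<ominus> a0) \<otimes> (fst z \<ominus> a1))"
  proof -
    have "(k \<otimes> p) \<otimes> (q \<otimes> w) \<oplus> (r \<otimes> k) \<otimes> (s \<otimes> w) = k \<otimes> w \<otimes> (p \<otimes> q \<oplus> r \<otimes> s)"
      if "p \<in> carrier R" "q \<in> carrier R" "r \<in> carrier R" "s \<in> carrier R" for p q r s
      using that k(1) wc by (simp add: r_distr m_ac)
    then show ?thesis using o c by simp
  qed
  also have "(a1 \<ominus> a) \<otimes> (fst z \<ominus> a0) \<oplus> (a \<ominus> a0) \<otimes> (fst z \<ominus> a1) = (a1 \<ominus> a0) \<otimes> (fst z \<ominus> a)"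
    using o(3) c(3-5) by algebra
  also have "k \<otimes> w \<otimes> ((a1 \<ominus> a0) \<otimes> (fst z \<ominus> a)) = ((a1 \<ominus> a0) \<otimes> k) \<otimes> ((fst z \<ominus> a) \<otimes> w)"
    using k(1) wc o c by (simp add: m_ac)
  finally show ?thesis unfolding pencil_def w_def k_def .
qed

text \<open>The value of \<open>a\<close> makes the edge density \<open>2 a D^2\<close> with
  \<open>D = 8 N K\<close> equal to the richness \<open>N^2 / (2^37 K^10)\<close> of the third
  points. \<open>k\<close> is the 31st power of the dilate bound \<open>2^29 / a^15\<close>. The
  assumptions \<open>N2\<close> and \<open>N3\<close> are the two size conditions of
  \<open>subfield_of_small_dilates\<close>.\<close>

lemma subfield_structure:
  assumes P: "P \<subseteq> carrier R \<times> carrier R"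
    and L: "finite L" "\<And>l. l \<in> L \<Longrightarrow> l \<in> lines R \<and> (\<exists>m\<in>carrier R. \<exists>b\<in>carrier R. l = graph_line m b)"
    and n: "real (card P) \<le> N\<^sup>2" "real (card L) \<le> N\<^sup>2"
    and K: "K \<ge> 1" and N: "2 ^ 42 * K ^ 11 \<le> N"
    and many: "N ^ 3 / K \<le> edges (\<in>) P L"
    and a: "a = 1 / (2 ^ 44 * K ^ 12)" and k: "k = (2 ^ 29 / a ^ 15) ^ 31"
    and N2: "k \<le> a * N * K"
    and N3: "32 * k * N * K \<le> (a ^ 4 / 64 * (N / (2 ^ 40 * K ^ 11)))\<^sup>2"
  shows "\<exists>F a0 a1 s X. subfield F R \<and> real (card F) \<le> 32 * k * N * K \<and> X \<subseteq> fst ` P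
    \<and> a ^ 4 / 64 * (N / (2 ^ 40 * K ^ 11)) \<le> real (card X)
    \<and> a0 \<in> carrier R \<and> a1 \<in> carrier R \<and> s \<in> carrier R \<and> a0 \<noteq> a1 \<and> s \<noteq> \<zero>
    \<and> (\<forall>x\<in>X. \<exists>r\<in>F. x \<ominus> a0 = r \<otimes> s \<otimes> (a1 \<ominus> x))"
proof -
  have K0: "K > 0" using K by simp
  have "1 \<le> K ^ 11" using K by (rule one_le_power)
  then have N0: "N > 0" using N by (smt (verit) mult_le_cancel_left1 zero_less_power)
  have a0: "a > 0" using K0 by (simp add: a)
  have a1: "a \<le> 1"
  proof -
    have "1 \<le> K ^ 12" using K by (rule one_le_power)
    then have "1 \<le> 2 ^ 44 * K ^ 12" by simp
    then show ?thesis unfolding a by (simp add: divide_le_eq)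
  qed
  have finP: "finite P" using P finite_carrier finite_subset by blast
  have free: "rectangle_free (\<in>) P L"
    by (rule rectangle_free_subset[OF rectangle_free_lines]) (use L in auto)
  obtain P' L' l q0 q1 Q where sub: "P' \<subseteq> P" "L' \<subseteq> L" and l: "l \<in> L'"
    and q: "q0 \<in> P'" "q1 \<in> P'" "Q \<subseteq> P'" "q0 \<in> l" "q1 \<in> l" "q0 \<noteq> q1" "q0 \<notin> Q" "q1 \<notin> Q"
    and deg: "\<forall>q\<in>P'. real (card {l' \<in> L'. q \<in> l'}) \<le> 8 * N * K"
    and cQ: "N / (2 ^ 40 * K ^ 11) \<le> real (card Q)"
    and rich: "\<forall>q\<in>Q. q \<in> l \<and> N\<^sup>2 / (2 ^ 37 * K ^ 10) \<le> real (card {z \<in> P'. z \<notin> l \<and>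
        (\<exists>l'\<in>L'. z \<in> l' \<and> q0 \<in> l') \<and> (\<exists>l'\<in>L'. z \<in> l' \<and> q1 \<in> l') \<and> (\<exists>l'\<in>L'. z \<in> l' \<and> q \<in> l')})"
    using rich_line[OF finP L(1) free n K N many]
    by (elim exE bexE conjE) (rule that; assumption)
  define D where "D = 8 * N * K"
  have D0: "D > 0" using N0 K0 by (simp add: D_def)
  obtain m b where mb: "m \<in> carrier R" "b \<in> carrier R" and lg: "l = graph_line m b" using L(2) l sub by blast
  have Pc: "P' \<subseteq> carrier R \<times> carrier R" using sub P by blast
  have L': "L' \<subseteq> lines R" "finite L'" using sub L finite_subset by blast+
  have on_l: "q = (fst q, m \<otimes> fst q \<oplus> b)" "fst q \<in> carrier R" if "q \<in> l" for q
    using that unfolding lg graph_line_def by auto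
  define x0 x1 where "x0 = fst q0" and "x1 = fst q1"
  have xc: "x0 \<in> carrier R" "x1 \<in> carrier R" using on_l q by (auto simp: x0_def x1_def)
  have q01: "q0 = (x0, m \<otimes> x0 \<oplus> b)" "q1 = (x1, m \<otimes> x1 \<oplus> b)" using on_l q by (auto simp: x0_def x1_def)
  have x01: "x0 \<noteq> x1" using q01 q(6) by auto
  define X0 where "X0 = fst ` Q"
  have injQ: "inj_on fst Q"
  proof (rule inj_onI)
    fix u v assume "u \<in> Q" "v \<in> Q" "fst u = fst v"
    then show "u = v" using on_l(1)[of u] on_l(1)[of v] rich by metis
  qed
  have cX0: "card X0 = card Q" unfolding X0_def using injQ by (rule card_image)
  have X0: "x \<in> carrier R \<and> (x, m \<otimes> x \<oplus> b) \<in> Q \<and> x \<noteq> x0 \<and> x \<noteq> x1" if xX: "x \<in> X0" for x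
  proof -
    obtain u where u: "u \<in> Q" "x = fst u" using xX unfolding X0_def by blast
    then have "u \<in> l" using rich by blast
    then have e: "u = (x, m \<otimes> x \<oplus> b)" "x \<in> carrier R" using on_l u by auto
    then show ?thesis using u q(7,8) q01 by auto
  qed
  define \<rho> where "\<rho> = (\<lambda>x. (x \<ominus> x0) \<otimes> inv (x1 \<ominus> x))"
  have \<rho>c: "\<rho> x \<in> carrier R" "\<rho> x \<noteq> \<zero>" "x \<ominus> x0 = \<rho> x \<otimes> (x1 \<ominus> x)" if x: "x \<in> X0" for x
  proof -
    have nz: "x \<ominus> x0 \<noteq> \<zero>" "x1 \<ominus> x \<noteq> \<zero>" and c: "x \<ominus> x0 \<in> carrier R" "x1 \<ominus> x \<in> carrier R"
      using X0[OF x] xc minus_eq_zero[of x x0] minus_eq_zero[of x1 x] by auto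
    note i = nonzero_inv[OF c(2) nz(2)]
    show "\<rho> x \<in> carrier R" using c i by (simp add: \<rho>_def)
    show "\<rho> x \<noteq> \<zero>" using c i nz integral[of "x \<ominus> x0" "inv (x1 \<ominus> x)"] by (auto simp: \<rho>_def)
    show "x \<ominus> x0 = \<rho> x \<otimes> (x1 \<ominus> x)" using c i by (simp add: \<rho>_def m_assoc)
  qed
  have inj\<rho>: "inj_on \<rho> X0"
  proof (rule inj_onI)
    fix x y assume x: "x \<in> X0" and y: "y \<in> X0" and e: "\<rho> x = \<rho> y"
    have cc: "x \<in> carrier R" "y \<in> carrier R" using X0 x y by auto
    define r where "r = \<rho> x"
    have r: "r \<in> carrier R" "x \<ominus> x0 = r \<otimes> (x1 \<ominus> x)" "y \<ominus> x0 = r \<otimes> (x1 \<ominus> y)"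
      using \<rho>c[OF x] \<rho>c[OF y] e by (auto simp: r_def)
    \<comment> \<open>The equation solved for \<open>u\<close>. If \<open>1 + r\<close> were zero,
      it would say \<open>x0 = x1\<close>; so \<open>r\<close> determines the abscissa.\<close>
    have s: "(\<one> \<oplus> r) \<otimes> u = x0 \<oplus> r \<otimes> x1" if "u \<in> carrier R" "u \<ominus> x0 = r \<otimes> (x1 \<ominus> u)" for u
    proof -
      have "(\<one> \<oplus> r) \<otimes> u = (u \<ominus> x0) \<oplus> x0 \<oplus> r \<otimes> u" using that(1) r(1) xc by algebra
      also have "\<dots> = x0 \<oplus> r \<otimes> x1" unfolding that(2) using that(1) r(1) xc by algebra
      finally show ?thesis .
    qed
    show "x = y"
    proof (cases "\<one> \<oplus> r = \<zero>")
      case True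
      then have r': "r = \<ominus> \<one>" using r(1) minus_equality[of r \<one>] by (simp add: a_comm)
      have "\<zero> = x0 \<oplus> r \<otimes> x1" using s[OF cc(1) r(2)] True cc by simp
      also have "\<dots> = x0 \<ominus> x1" unfolding r' using xc by algebra
      finally have "x0 = x1" using minus_eq_zero[OF xc] by metis
      then show ?thesis using x01 by blast
    next
      case False
      have "(\<one> \<oplus> r) \<otimes> x = (\<one> \<oplus> r) \<otimes> y" using s[OF cc(1) r(2)] s[OF cc(2) r(3)] by simp
      then show ?thesis using m_lcancel[OF False] r(1) cc by auto
    qed
  qed
  define J where "J = (\<lambda>z q. \<exists>l'\<in>L'. z \<in> l' \<and> q \<in> l')"
  define Zx where "Zx = (\<lambda>x. {z \<in> P'. z \<notin> l \<and> J z q0 \<and> J z q1 \<and> J z (x, m \<otimes> x \<oplus> b)})"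
  have Zx: "z \<in> carrier R \<times> carrier R" "z \<notin> graph_line m b" if "z \<in> Zx x" for z x
    using that Pc lg by (auto simp: Zx_def)
  have cZx: "2 * a * D\<^sup>2 \<le> real (card (Zx x))" if "x \<in> X0" for x
  proof -
    have "2 * a * D\<^sup>2 = N\<^sup>2 / (2 ^ 37 * K ^ 10)"
      using K0 by (simp add: a D_def field_simps power2_eq_square numeral_eq_Suc)
    then show ?thesis using rich X0[OF that] by (simp add: Zx_def J_def)
  qed
  define \<Phi> where "\<Phi> = (\<lambda>z. (pencil m b x0 z, pencil m b x1 z))"
  have inj\<Phi>: "inj_on \<Phi> (Zx x)" for x
    using pencil_inj[OF mb xc x01] Zx by (intro inj_onI) (auto simp: \<Phi>_def)
  define U where "U = pencil m b x0 ` {z \<in> P'. z \<notin> l \<and> J z q0}"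
  define V where "V = pencil m b x1 ` {z \<in> P'. z \<notin> l \<and> J z q1}"
  have U: "U \<subseteq> carrier R" "real (card U) \<le> D"
  proof -
    show "U \<subseteq> carrier R" using pencil_closed[OF mb xc(1)] Pc lg by (auto simp: U_def)
    have "card U \<le> card {l' \<in> L'. (x0, m \<otimes> x0 \<oplus> b) \<in> l'}"
      unfolding U_def by (rule card_pencil_le[OF mb xc(1) L']) (auto simp: J_def lg q01)
    then show "real (card U) \<le> D" using deg q(1) unfolding D_def q01(1) by fastforce
  qed
  have V: "V \<subseteq> carrier R" "real (card V) \<le> D"
  proof -
    show "V \<subseteq> carrier R" using pencil_closed[OF mb xc(2)] Pc lg by (auto simp: V_def)
    have "card V \<le> card {l' \<in> L'. (x1, m \<otimes> x1 \<oplus> b) \<in> l'}"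
      unfolding V_def by (rule card_pencil_le[OF mb xc(2) L']) (auto simp: J_def lg q01)
    then show "real (card V) \<le> D" using deg q(2) unfolding D_def q01(2) by fastforce
  qed
  define A where "A = \<rho> ` X0"
  have cA: "card A = card Q" unfolding A_def using card_image[OF inj\<rho>] cX0 by simp
  have "N / (2 ^ 40 * K ^ 11) > 0" using N0 K0 by simp
  then have Ane: "A \<noteq> {}" using cQ cA by auto
  have Ac: "A \<subseteq> carrier R - {\<zero>}" using \<rho>c by (auto simp: A_def)
  define g where "g = inv_into X0 \<rho>"
  have g: "g r \<in> X0" "\<rho> (g r) = r" if "r \<in> A" for r
    using that unfolding A_def g_def by (auto intro: inv_into_into f_inv_into_f)
  define G where "G = (\<lambda>r. \<Phi> ` Zx (g r))"
  have G1: "G r \<subseteq> U \<times> V" for r by (auto simp: G_def \<Phi>_def Zx_def U_def V_def)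
  have G2: "2 * a * D\<^sup>2 \<le> real (card (G r))" if "r \<in> A" for r
    unfolding G_def using card_image[OF inj\<Phi>] cZx[OF g(1)[OF that]] by simp
  have S: "real (card ((\<lambda>(u, v). u \<oplus> r \<otimes> v) ` G r)) \<le> D" if r: "r \<in> A" for r
  proof -
    let ?x = "g r"
    have x: "?x \<in> carrier R" "?x \<noteq> x1" "(?x, m \<otimes> ?x \<oplus> b) \<in> Q" using X0[OF g(1)[OF r]] by auto
    have fZ: "finite (Zx ?x)" using finite_subset[OF sub(1) finP] by (simp add: Zx_def)
    have "(\<lambda>(u, v). u \<oplus> r \<otimes> v) ` G r \<subseteq> (\<lambda>w. ((x1 \<ominus> x0) \<otimes> inv (x1 \<ominus> ?x)) \<otimes> w) ` (pencil m b ?x ` Zx ?x)"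
    proof
      fix w assume "w \<in> (\<lambda>(u, v). u \<oplus> r \<otimes> v) ` G r"
      then obtain z where z: "z \<in> Zx ?x" "w = pencil m b x0 z \<oplus> r \<otimes> pencil m b x1 z"
        by (auto simp: G_def \<Phi>_def)
      have "r = (?x \<ominus> x0) \<otimes> inv (x1 \<ominus> ?x)" using g(2)[OF r] by (simp add: \<rho>_def)
      then have "w = ((x1 \<ominus> x0) \<otimes> inv (x1 \<ominus> ?x)) \<otimes> pencil m b ?x z"
        using pencil_linear[OF mb xc x(1,2) Zx[OF z(1)]] z(2) by simp
      then show "w \<in> (\<lambda>w. ((x1 \<ominus> x0) \<otimes> inv (x1 \<ominus> ?x)) \<otimes> w) ` (pencil m b ?x ` Zx ?x)" using z by blast
    qed
    then have "card ((\<lambda>(u, v). u \<oplus> r \<otimes> v) ` G r)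
        \<le> card ((\<lambda>w. ((x1 \<ominus> x0) \<otimes> inv (x1 \<ominus> ?x)) \<otimes> w) ` (pencil m b ?x ` Zx ?x))"
      using fZ by (intro card_mono) auto
    also have "\<dots> \<le> card (pencil m b ?x ` Zx ?x)" using fZ by (intro card_image_le) auto
    also have "\<dots> \<le> card {l' \<in> L'. (?x, m \<otimes> ?x \<oplus> b) \<in> l'}"
      by (rule card_pencil_le[OF mb x(1) L']) (auto simp: Zx_def J_def lg)
    finally show ?thesis using deg x(3) q(3) unfolding D_def by fastforce
  qed
  obtain W r A' where W: "W \<subseteq> V" "a * D / 4 \<le> real (card W)" and r: "r \<in> A" and A': "A' \<subseteq> A"
    "a ^ 4 / 64 * real (card A) \<le> real (card A')"
    and dW: "real (card (diff_set R W W)) \<le> 4096 / a ^ 6 * real (card W)"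
    and dil: "\<forall>s\<in>A'. real (card (diff_set R (dilate R s W) (dilate R r W))) \<le> 2 ^ 29 / a ^ 15 * real (card W)"
    using common_small_dilates[OF U V Ac Ane G1 G2 S a0 a1 D0] by blast
  have Wc: "W \<subseteq> carrier R" using W V by blast
  have fW: "finite W" using Wc finite_sub by blast
  have rc: "r \<in> carrier R" "r \<noteq> \<zero>" using r Ac by auto
  note ir = nonzero_inv[OF rc]
  have A'c: "A' \<subseteq> carrier R" using A' Ac by blast
  have "a * D / 4 > 0" using a0 D0 by simp
  then have Wne: "W \<noteq> {}" using W(2) by auto
  define c where "c = 2 ^ 29 / a ^ 15"
  have c1: "4096 / a ^ 6 \<le> c" "1 \<le> c"
  proof -
    have "a ^ 15 \<le> a ^ 6" "a ^ 15 \<le> 1" using a0 a1 by (auto intro: power_decreasing power_le_one)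
    then show "4096 / a ^ 6 \<le> c" unfolding c_def using a0 by (intro frac_le) auto
    show "1 \<le> c" unfolding c_def using a0 \<open>a ^ 15 \<le> 1\<close> by (simp add: le_divide_eq)
  qed
  \<comment> \<open>Division by the fixed \<open>r\<close> turns \<open>s W - r W\<close> into a
    dilate of \<open>W - x W\<close> with \<open>x = s / r\<close>. Zero and one are added because
    the quotient set argument starts from them; both have small dilates as well.\<close>
  define S where "S = insert \<zero> (insert \<one> ((\<lambda>s. s \<otimes> inv r) ` A'))"
  have Sc: "S \<subseteq> carrier R" using A'c ir by (auto simp: S_def)
  have injS: "inj_on (\<lambda>s. s \<otimes> inv r) A'"
    using ir A'c m_rcancel[of "inv r"] by (intro inj_onI) (auto simp: subset_iff)
  have cS: "a ^ 4 / 64 * (N / (2 ^ 40 * K ^ 11)) \<le> real (card A')" "card A' \<le> card S"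
  proof -
    have "a ^ 4 / 64 * (N / (2 ^ 40 * K ^ 11)) \<le> a ^ 4 / 64 * real (card A)"
      using cQ cA by (intro mult_left_mono) auto
    then show "a ^ 4 / 64 * (N / (2 ^ 40 * K ^ 11)) \<le> real (card A')" using A' by linarith
    have "card A' = card ((\<lambda>s. s \<otimes> inv r) ` A')" using card_image[OF injS] by simp
    also have "\<dots> \<le> card S" using Sc finite_sub by (intro card_mono) (auto simp: S_def)
    finally show "card A' \<le> card S" .
  qed
  have small: "real (card (diff_set R W (dilate R x W))) \<le> c * real (card W)" if x: "x \<in> S" for x
  proof -
    consider "x = \<zero>" | "x = \<one>" | s where "s \<in> A'" "x = s \<otimes> inv r" using x by (auto simp: S_def)
    then show ?thesis
    proof cases
      case 1
      have "diff_set R W (dilate R x W) \<subseteq> W"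
        using 1 Wc by (auto simp: diff_set_def dilate_def a_minus_def subset_iff)
      then have "card (diff_set R W (dilate R x W)) \<le> card W" using fW by (intro card_mono)
      then have "real (card (diff_set R W (dilate R x W))) \<le> 1 * real (card W)" by simp
      also have "\<dots> \<le> c * real (card W)" using c1 by (intro mult_right_mono) auto
      finally show ?thesis .
    next
      case 2
      have "dilate R x W = W" using 2 Wc by (force simp: dilate_def image_iff subset_iff)
      then have "real (card (diff_set R W (dilate R x W))) \<le> 4096 / a ^ 6 * real (card W)" using dW by simp
      also have "\<dots> \<le> c * real (card W)" using c1 by (intro mult_right_mono) auto
      finally show ?thesis .
    next
      case (3 s)
      have sc: "s \<in> carrier R" using 3 A'c by auto
      have xcR: "x \<in> carrier R" using 3 sc ir by simp
      have rx: "r \<otimes> x = s" using 3(2) sc ir rc m_lcomm[of r s "inv r"] by simp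
      have dc: "diff_set R W (dilate R x W) \<subseteq> carrier R"
        using diff_set_closed Wc dilate_closed[OF xcR] by blast
      have "dilate R r (diff_set R W (dilate R x W)) = diff_set R (dilate R r W) (dilate R s W)"
      proof -
        have "r \<otimes> (u \<ominus> x \<otimes> v) = r \<otimes> u \<ominus> s \<otimes> v" if "u \<in> W" "v \<in> W" for u v
        proof -
          have uv: "u \<in> carrier R" "v \<in> carrier R" using that Wc by auto
          have "r \<otimes> (u \<ominus> x \<otimes> v) = r \<otimes> u \<ominus> (r \<otimes> x) \<otimes> v" using uv rc xcR by algebra
          then show ?thesis using rx by simp
        qed
        then show ?thesis unfolding diff_set_def dilate_def by (force simp: image_iff)
      qed
      then have "card (diff_set R W (dilate R x W)) = card (diff_set R (dilate R r W) (dilate R s W))"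
        using card_dilate[OF rc dc] by simp
      also have "\<dots> = card (diff_set R (dilate R s W) (dilate R r W))"
        by (rule card_diff_set_swap) (use dilate_closed Wc rc sc in auto)
      finally show ?thesis using dil 3 by (simp add: c_def)
    qed
  qed
  have kc: "k = c ^ 31" by (simp add: k c_def)
  have k0: "k \<ge> 0" using c1 by (simp add: kc)
  have V2: "2 * c ^ 31 \<le> real (card W)"
  proof -
    have "a * D / 4 = 2 * (a * N * K)" by (simp add: D_def)
    then show ?thesis using W(2) N2 unfolding kc by linarith
  qed
  have cW: "real (card W) \<le> 8 * N * K"
  proof -
    have "card W \<le> card V" using W V finite_sub by (intro card_mono) auto
    then show ?thesis using V by (simp add: D_def)
  qed
  have A2: "4 * c ^ 31 * real (card W) \<le> (real (card S))\<^sup>2"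
  proof -
    have "4 * k * real (card W) \<le> 4 * k * (8 * N * K)" using cW k0 by (intro mult_left_mono) auto
    also have "\<dots> = 32 * k * N * K" by simp
    also have "\<dots> \<le> (a ^ 4 / 64 * (N / (2 ^ 40 * K ^ 11)))\<^sup>2" by (rule N3)
    also have "\<dots> \<le> (real (card S))\<^sup>2"
      using cS a0 N0 K0 by (intro power_mono) auto
    finally show ?thesis by (simp add: kc)
  qed
  have "\<exists>F. subfield F R \<and> S \<subseteq> F \<and> real (card F) \<le> 4 * c ^ 31 * real (card W)"
    by (rule subfield_of_small_dilates[OF Wc Wne Sc _ _ small c1(2) V2 A2]) (auto simp: S_def)
  then obtain F where F: "subfield F R" "S \<subseteq> F" "real (card F) \<le> 4 * k * real (card W)"
    unfolding kc by blast
  have cF: "real (card F) \<le> 32 * k * N * K"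
  proof -
    have "4 * k * real (card W) \<le> 4 * k * (8 * N * K)" using cW k0 by (intro mult_left_mono) auto
    also have "\<dots> = 32 * k * N * K" by simp
    finally show ?thesis using F(3) by linarith
  qed
  \<comment> \<open>The abscissae whose ratio survived. For them \<open>\<rho> x / r\<close> lies in
    the subfield, which is the equation of a circle with \<open>s = r\<close>.\<close>
  define X where "X = {x \<in> X0. \<rho> x \<in> A'}"
  have "\<rho> ` X = A'" using A'(1) by (auto simp: X_def A_def)
  moreover have "inj_on \<rho> X" using inj\<rho> by (rule inj_on_subset) (auto simp: X_def)
  ultimately have cX: "card X = card A'" by (metis card_image)
  have XP: "X \<subseteq> fst ` P" using q(3) sub by (auto simp: X_def X0_def)
  have rel: "\<exists>u\<in>F. x \<ominus> x0 = u \<otimes> r \<otimes> (x1 \<ominus> x)" if x: "x \<in> X" for x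
  proof
    have xX: "x \<in> X0" "\<rho> x \<in> A'" using x by (auto simp: X_def)
    show "\<rho> x \<otimes> inv r \<in> F" using F(2) xX by (auto simp: S_def)
    have "\<rho> x \<otimes> inv r \<otimes> r = \<rho> x" using \<rho>c[OF xX(1)] ir rc by (simp add: m_assoc)
    then show "x \<ominus> x0 = \<rho> x \<otimes> inv r \<otimes> r \<otimes> (x1 \<ominus> x)" using \<rho>c(3)[OF xX(1)] by simp
  qed
  show ?thesis
    using F(1) cF XP cS(1) cX xc rc x01 rel
    by (intro exI[of _ F] exI[of _ x0] exI[of _ x1] exI[of _ r] exI[of _ X] conjI ballI) auto
qed

end

subsection \<open>The incidence bound\<close>

text \<open>A numerical constant below \<open>2^50\<close> costs one factor \<open>b\<close>. So
  \<open>1 / a <= b^121\<close>, the dilate bound is at most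
  \<open>b^(1 + 15 * 121) = b^1816\<close>, and \<open>k <= b^(31 * 1816)\<close>. The abscissae
  number at least \<open>b^(64190 - 4 * 121 - 111) = b^63595\<close>.\<close>

lemma exponent_bounds:
  fixes b :: real
  assumes b: "b \<ge> 2 ^ 50" and K: "K = b ^ 10" and N: "N = b ^ 64190"
    and a: "a = 1 / (2 ^ 44 * K ^ 12)" and k: "k = (2 ^ 29 / a ^ 15) ^ 31"
  shows "2 ^ 42 * K ^ 11 \<le> N" and "k \<le> b ^ 56296" and "k \<ge> 0" and "k \<le> a * N * K"
    and "32 * k * N * K \<le> b ^ 120497"
    and "b ^ 63595 \<le> a ^ 4 / 64 * (N / (2 ^ 40 * K ^ 11))"
    and "32 * k * N * K \<le> (a ^ 4 / 64 * (N / (2 ^ 40 * K ^ 11)))\<^sup>2"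
proof -
  have b0: "b > 0" and b1: "b \<ge> 1" using b by auto
  have b2: "2 ^ i \<le> b" if "i \<le> 50" for i
    using power_increasing[OF that, of "2::real"] b by linarith
  have mono: "b ^ i \<le> b ^ j" if "i \<le> j" for i j using power_increasing[OF that b1] .
  have inva: "1 / a = 2 ^ 44 * b ^ 120" by (simp add: a K flip: power_mult)
  have a0: "a > 0" using b0 by (simp add: a K)
  have "2 ^ 44 * b ^ 120 \<le> b * b ^ 120" using b2[of 44] b0 by (intro mult_right_mono) auto
  also have "\<dots> = b ^ 121" by (simp flip: power_Suc)
  finally have ia: "1 / a \<le> b ^ 121" using inva by simp
  then have al: "1 / b ^ 121 \<le> a" using a0 b0 by (simp add: field_simps)
  have "2 ^ 42 * K ^ 11 \<le> b * b ^ 110"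
    unfolding K power_mult[symmetric] using b2[of 42] b0 by (intro mult_mono) auto
  also have "\<dots> = b ^ 111" by (simp flip: power_Suc)
  also have "\<dots> \<le> N" unfolding N by (rule mono) simp
  finally show "2 ^ 42 * K ^ 11 \<le> N" .
  have "2 ^ 29 / a ^ 15 = 2 ^ 29 * (1 / a) ^ 15" by (simp add: power_divide)
  also have "\<dots> \<le> b * (b ^ 121) ^ 15"
    using b2[of 29] ia a0 b0 by (intro mult_mono power_mono) auto
  also have "\<dots> = b ^ 1816" by (simp flip: power_mult power_Suc)
  finally have "k \<le> (b ^ 1816) ^ 31" unfolding k using a0 by (intro power_mono) auto
  then show kb: "k \<le> b ^ 56296" by (simp flip: power_mult)
  show k0: "k \<ge> 0" unfolding k using a0 by simp
  have "k * b ^ 121 \<le> b ^ 56296 * b ^ 121" using kb b0 by (intro mult_right_mono) auto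
  also have "\<dots> = b ^ 56417" by (simp flip: power_add)
  also have "\<dots> \<le> b ^ 64200" by (rule mono) simp
  also have "\<dots> = N * K" by (simp add: N K flip: power_add)
  finally have "k \<le> 1 / b ^ 121 * (N * K)" using b0 by (simp add: field_simps)
  also have "\<dots> \<le> a * (N * K)" using al b0 by (intro mult_right_mono) (auto simp: N K)
  finally show "k \<le> a * N * K" by (simp add: mult.assoc)
  have "32 * k * N * K = 2 ^ 5 * k * (N * K)" by simp
  also have "\<dots> \<le> b * b ^ 56296 * (N * K)"
    using b2[of 5] kb k0 b0 by (intro mult_right_mono mult_mono) (auto simp: N K)
  also have "\<dots> = b ^ 120497" by (simp add: N K flip: power_add power_Suc)
  finally show u: "32 * k * N * K \<le> b ^ 120497" .
  have "b ^ 63595 * (b ^ 121) ^ 4 * (2 ^ 46 * b ^ 110) \<le> b ^ 63595 * (b ^ 121) ^ 4 * (b * b ^ 110)"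
    using b2[of 46] b0 by (intro mult_left_mono mult_right_mono) auto
  also have "\<dots> = b ^ 64190" by (simp flip: power_add power_mult power_Suc)
  finally have "b ^ 63595 * (b ^ 121) ^ 4 * (2 ^ 46 * b ^ 110) \<le> N" by (simp add: N)
  then have "b ^ 63595 \<le> (1 / b ^ 121) ^ 4 * (N / (2 ^ 46 * b ^ 110))"
    using b0 by (simp add: field_simps)
  also have "\<dots> \<le> a ^ 4 * (N / (2 ^ 46 * b ^ 110))"
    using al b0 by (intro mult_right_mono power_mono) (auto simp: N)
  also have "\<dots> = a ^ 4 / 64 * (N / (2 ^ 40 * K ^ 11))"
    by (simp add: K flip: power_mult)
  finally show l: "b ^ 63595 \<le> a ^ 4 / 64 * (N / (2 ^ 40 * K ^ 11))" .
  have "32 * k * N * K \<le> b ^ 127190" using u mono[of 120497 127190] by simp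
  also have "\<dots> = (b ^ 63595)\<^sup>2" by (simp flip: power_mult)
  also have "\<dots> \<le> (a ^ 4 / 64 * (N / (2 ^ 40 * K ^ 11)))\<^sup>2" using l b0 by (intro power_mono) auto
  finally show "32 * k * N * K \<le> (a ^ 4 / 64 * (N / (2 ^ 40 * K ^ 11)))\<^sup>2" .
qed

context finite_field
begin

lemma card_graph_line:
  assumes "m \<in> carrier R" "b \<in> carrier R"
  shows "card (graph_line m b) = order R"
proof -
  have "graph_line m b = (\<lambda>x. (x, m \<otimes> x \<oplus> b)) ` carrier R"
    using assms by (auto simp: graph_line_def)
  moreover have "inj_on (\<lambda>x. (x, m \<otimes> x \<oplus> b)) (carrier R)" by (auto simp: inj_on_def)
  ultimately show ?thesis by (simp add: card_image order_def)
qed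

lemma vertical_incidences:
  assumes P: "finite P" and L: "finite L" "\<And>l. l \<in> L \<Longrightarrow> \<exists>c. l = {c} \<times> carrier R"
  shows "edges (\<in>) P L \<le> real (card P)"
proof -
  have "edges (\<in>) P L \<le> (\<Sum>q\<in>P. 1)"
    unfolding edges_def
  proof (rule sum_mono)
    fix q
    have "l = l'" if h: "l \<in> L" "l' \<in> L" "q \<in> l" "q \<in> l'" for l l'
    proof -
      obtain d d' where "l = {d} \<times> carrier R" "l' = {d'} \<times> carrier R" using L(2) h by meson
      then show ?thesis using h by auto
    qed
    then have "card {l \<in> L. q \<in> l} \<le> Suc 0" using L(1) by (subst card_le_Suc0_iff_eq) auto
    then show "real (card {l \<in> L. q \<in> l}) \<le> 1" by simp
  qed
  then show ?thesis by simp
qed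

lemma few_incidences:
  fixes b c :: real
  assumes p: "prime p" "order R = p\<^sup>2" and K: "subfield K R" "card K = p"
    and t: "t \<in> carrier R" "t \<notin> K"
    and P: "P \<subseteq> carrier R \<times> carrier R" "card P = n" and n: "real n = b ^ 128380"
    and small: "real (card (fst ` P)) \<le> c * real p"
    and J: "J \<subseteq> K" "real (card J) \<le> c * max (sqrt (real p)) (b ^ 51200)"
    and A: "fst ` P = (\<Union>j\<in>J. A j)"
    and coset: "\<And>j. j \<in> J \<Longrightarrow> A j \<subseteq> K +> (j \<otimes> t)"
    and cA: "\<And>j. j \<in> J \<Longrightarrow> real (card (A j)) \<le> c * max (sqrt (real p)) (b ^ 51200)"
    and L: "card L \<le> n" "finite L"
      "\<And>l. l \<in> L \<Longrightarrow> l \<in> lines R \<and> (\<exists>m\<in>carrier R. \<exists>b\<in>carrier R. l = graph_line m b)"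
    and c: "c > 0" "c \<le> b" and b: "b \<ge> 2 ^ 50"
  shows "edges (\<in>) P L < 2 * b ^ 192560"
proof (rule ccontr)
  assume neg: "\<not> ?thesis"
  define k0 N a k where "k0 = b ^ 10" and "N = b ^ 64190" and "a = 1 / (2 ^ 44 * k0 ^ 12)"
    and "k = (2 ^ 29 / a ^ 15) ^ 31"
  note bounds = exponent_bounds[OF b k0_def N_def a_def k_def]
  have b0: "b > 0" and b1: "b \<ge> 1" using b by auto
  have mono: "b ^ i \<le> b ^ j" if "i \<le> j" for i j using power_increasing[OF that b1] .
  have strict: "\<not> b ^ j \<le> b ^ i" if "i < j" for i j
    using power_strict_increasing[OF that, of b] b by simp
  have four: "4 * c\<^sup>2 \<le> b ^ 4"
  proof -
    have "4 \<le> b\<^sup>2" using power_mono[of 2 b 2] b by simp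
    moreover have "c\<^sup>2 \<le> b\<^sup>2" using c by (intro power_mono) auto
    ultimately have "4 * c\<^sup>2 \<le> b\<^sup>2 * b\<^sup>2" by (intro mult_mono) auto
    then show ?thesis by (simp flip: power_add)
  qed
  have N0: "N > 0" and k00: "k0 > 0" using b0 by (auto simp: N_def k0_def)
  have nN: "real n = N\<^sup>2" unfolding n N_def by (simp flip: power_mult)
  have N3: "N ^ 3 / k0 = b ^ 192560"
    using b0 power_diff[of b 10 192570] by (simp add: N_def k0_def flip: power_mult)
  have p0: "real p > 0" using p(1) prime_gt_0_nat by simp
  have finP: "finite P" using P finite_carrier finite_subset by blast
  have cL: "real (card L) \<le> N\<^sup>2" and cP: "real (card P) \<le> N\<^sup>2" using L P nN by auto
  show False
  proof (cases "real p * k0 \<le> N")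
    case True
    \<comment> \<open>A point has at most \<open>c p\<close> abscissae and \<open>p^2\<close>
      ordinates to choose from. This keeps \<open>p\<close> from being small compared with
      \<open>N^(2/3)\<close>.\<close>
    have np: "N\<^sup>2 \<le> c * real p ^ 3"
    proof -
      have "card P \<le> card (fst ` P \<times> carrier R)"
        using P finP finite_carrier by (intro card_mono) force+
      then have "real n \<le> real (card (fst ` P)) * real (order R)"
        using P by (simp add: card_cartesian_product order_def flip: of_nat_mult)
      also have "\<dots> \<le> c * real p * real (order R)" using small by (intro mult_right_mono) auto
      finally show ?thesis using nN p by (simp add: power2_eq_square power3_eq_cube)
    qed
    have "(edges (\<in>) P L - real (card P) * real (card L) / (real p)\<^sup>2)\<^sup>2
        \<le> (real p)\<^sup>2 * real (card P) * real (card L)"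
    proof (rule edges_regular[of "carrier R \<times> carrier R"])
      show "rectangle_free (\<in>) (carrier R \<times> carrier R) L"
        by (rule rectangle_free_subset[OF rectangle_free_lines]) (use L in auto)
      show "real (card (carrier R \<times> carrier R)) = ((real p)\<^sup>2)\<^sup>2"
        using p by (simp add: card_cartesian_product order_def power2_eq_square)
      fix l assume "l \<in> L"
      then obtain m d where "m \<in> carrier R" "d \<in> carrier R" "l = graph_line m d" using L by blast
      moreover from this have "{q \<in> carrier R \<times> carrier R. q \<in> l} = l" by (auto simp: graph_line_def)
      ultimately show "real (card {q \<in> carrier R \<times> carrier R. q \<in> l}) = (real p)\<^sup>2"
        using card_graph_line p by simp
    qed (use finite_carrier L P p0 in auto)
    also have "\<dots> \<le> (real p)\<^sup>2 * N\<^sup>2 * N\<^sup>2" using cL cP by (intro mult_mono) auto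
    also have "\<dots> = (real p * N\<^sup>2)\<^sup>2" by (simp add: power2_eq_square)
    finally have "edges (\<in>) P L - real (card P) * real (card L) / (real p)\<^sup>2 \<le> real p * N\<^sup>2"
      by (rule power2_le_imp_le) (use p0 in auto)
    moreover have "real (card P) * real (card L) / (real p)\<^sup>2 \<le> N\<^sup>2 * N\<^sup>2 / (real p)\<^sup>2"
      using cL cP by (intro divide_right_mono mult_mono) auto
    moreover have "real p * N\<^sup>2 \<le> N ^ 3 / k0"
    proof -
      have "(real p * k0) * N\<^sup>2 \<le> N * N\<^sup>2" using True by (intro mult_right_mono) auto
      then show ?thesis using k00 by (simp add: field_simps power2_eq_square power3_eq_cube)
    qed
    \<comment> \<open>The claim amounts to \<open>N K < p^2\<close>. Since
      \<open>p^6 c^2 >= N^4\<close>, it suffices that \<open>N > K^3 c^2\<close>, which holds with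
      much room.\<close>
    moreover have "N\<^sup>2 * N\<^sup>2 / (real p)\<^sup>2 < N ^ 3 / k0"
    proof -
      have "k0 ^ 3 * c\<^sup>2 \<le> b ^ 30 * b\<^sup>2"
        using c b0 by (intro mult_mono power_mono) (auto simp: k0_def simp flip: power_mult)
      also have "\<dots> = b ^ 32" by (simp flip: power_add)
      also have "\<dots> < N" unfolding N_def using strict[of 32 64190] by simp
      finally have kc: "k0 ^ 3 * c\<^sup>2 < N" .
      have "(N * k0) ^ 3 * c\<^sup>2 = N ^ 3 * (k0 ^ 3 * c\<^sup>2)" by (simp add: power_mult_distrib)
      also have "\<dots> < N ^ 3 * N" using kc N0 by simp
      also have "\<dots> = (N\<^sup>2)\<^sup>2" by (simp add: power2_eq_square power3_eq_cube)
      also have "\<dots> \<le> (c * real p ^ 3)\<^sup>2" using np N0 by (intro power_mono) auto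
      also have "\<dots> = ((real p)\<^sup>2) ^ 3 * c\<^sup>2" by (simp add: power_mult_distrib flip: power_mult)
      finally have "(N * k0) ^ 3 < ((real p)\<^sup>2) ^ 3" using c by simp
      then have "N * k0 < (real p)\<^sup>2" by (rule power_less_imp_less_base) simp
      then have "N ^ 3 * (N * k0) < N ^ 3 * (real p)\<^sup>2" using N0 by simp
      then show ?thesis using k00 p0 by (simp add: field_simps power2_eq_square power3_eq_cube)
    qed
    ultimately have "edges (\<in>) P L < 2 * (N ^ 3 / k0)" by linarith
    then show False using neg N3 by simp
  next
    case False
    have "N ^ 3 / k0 \<le> edges (\<in>) P L" using neg N3 b0 zero_less_power[of b 192560] by linarith
    moreover have "1 \<le> k0" using b1 by (simp add: k0_def)
    ultimately obtain F a0 a1 s X where F: "subfield F R" "real (card F) \<le> 32 * k * N * k0"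
      and X: "X \<subseteq> fst ` P" "a ^ 4 / 64 * (N / (2 ^ 40 * k0 ^ 11)) \<le> real (card X)"
      and as: "a0 \<in> carrier R" "a1 \<in> carrier R" "s \<in> carrier R" "a0 \<noteq> a1" "s \<noteq> \<zero>"
      and circ: "\<forall>x\<in>X. \<exists>r\<in>F. x \<ominus> a0 = r \<otimes> s \<otimes> (a1 \<ominus> x)"
      using subfield_structure[OF P(1) L(2,3) cP cL _ bounds(1) _ a_def k_def bounds(4,7)] by blast
    show False
    proof (cases "F = K")
      \<comment> \<open>A different subfield has at least \<open>p^2\<close> elements. With
        \<open>N < p K\<close> the upper bound for its size gives \<open>p <= 32 k K^2\<close>,
        hence \<open>N <= 32 k K^3 <= b^56327\<close>, below \<open>N = b^64190\<close>.\<close>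
      case False
      have "real p * real p \<le> real (card F)"
        using subfield_of_prime_square[OF K(1) F(1)] K(2) p(1) False
        by (simp add: power2_eq_square flip: of_nat_mult)
      also have "\<dots> \<le> 32 * k * N * k0" by (rule F(2))
      also have "\<dots> \<le> 32 * k * (real p * k0) * k0"
        using \<open>\<not> real p * k0 \<le> N\<close> bounds(3) k00 by (intro mult_right_mono mult_left_mono) auto
      finally have "real p \<le> 32 * k * k0 * k0" using p0 by (simp add: mult_ac)
      then have "N \<le> (32 * k * k0 * k0) * k0"
        using \<open>\<not> real p * k0 \<le> N\<close> k00 by (smt (verit) mult_right_mono)
      also have "\<dots> \<le> (b * b ^ 56296 * k0 * k0) * k0"
        using b bounds(2,3) k00 by (intro mult_right_mono mult_mono) auto
      also have "\<dots> = b ^ 56327" by (simp add: k0_def flip: power_add power_Suc)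
      finally show False using strict[of 56327 64190] by (simp add: N_def)
    next
      \<comment> \<open>The circle has at least \<open>b^63595\<close> points and at most
        \<open>2 M\<close>. If the second term of the maximum dominates,
        \<open>2 M <= b^51202\<close>. Otherwise \<open>p = |F| <= b^120497\<close> gives
        \<open>(2 M)^2 <= b^120501\<close>, below \<open>b^127190\<close>.\<close>
      case True
      have pb: "real p \<le> b ^ 120497" using F(2) K(2) bounds(5) True by simp
      define M where "M = c * max (sqrt (real p)) (b ^ 51200)"
      have "fst ` P \<subseteq> carrier R" using P(1) by auto
      then have "X \<subseteq> carrier R" using X(1) by blast
      then have "real (card X) \<le> 2 * M"
        using circ True J A coset cA X(1) as
        by (intro card_circle_le[OF K(1) as _ _ t J(1), where A = A]) (auto simp: M_def)
      then have bM: "b ^ 63595 \<le> 2 * M" using X(2) bounds(6) by linarith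
      show False
      proof (cases "sqrt (real p) \<le> b ^ 51200")
        case True
        then have "b ^ 63595 \<le> 2 * c * b ^ 51200" using bM by (simp add: M_def max_def)
        also have "\<dots> \<le> b * b * b ^ 51200" using c b by (intro mult_right_mono mult_mono) auto
        also have "\<dots> = b\<^sup>2 * b ^ 51200" by (simp add: power2_eq_square)
        also have "\<dots> = b ^ 51202" by (simp flip: power_add)
        finally show False using strict[of 51202 63595] by simp
      next
        case False
        then have "b ^ 63595 \<le> 2 * c * sqrt (real p)" using bM by (simp add: M_def max_def)
        then have "(b ^ 63595)\<^sup>2 \<le> (2 * c * sqrt (real p))\<^sup>2" using b0 by (intro power_mono) auto
        also have "\<dots> = 4 * c\<^sup>2 * real p" by (simp add: power_mult_distrib)
        also have "\<dots> \<le> b ^ 4 * b ^ 120497" using four pb by (intro mult_mono) auto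
        also have "\<dots> = b ^ 120501" by (simp flip: power_add)
        finally show False using strict[of 120501 127190] by (simp flip: power_mult)
      qed
    qed
  qed
qed

end

theorem corollary3:
  fixes c :: real
  assumes "c > 0"
  shows "\<exists>C::real. C > 0 \<and>
    (\<forall>(p::nat) (F::'a ring) Fp t (n::nat) P A J A' L.
       prime p \<longrightarrow> field F \<longrightarrow> order F = p\<^sup>2 \<longrightarrow> subfield Fp F \<longrightarrow> card Fp = p \<longrightarrow>
       defining_element F Fp t \<longrightarrow>
       P \<subseteq> carrier F \<times> carrier F \<longrightarrow> card P = n \<longrightarrow> A = {x. \<exists>y. (x, y) \<in> P} \<longrightarrow>
       real (card A) \<le> c * real p \<longrightarrow>
       J \<subseteq> Fp \<longrightarrow>
       real (card J) \<le> c * max (real p powr (1/2)) (real n powr (2560/6419)) \<longrightarrow>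
       A = (\<Union>j\<in>J. A' j) \<longrightarrow>
       (\<forall>j\<in>J. A' j \<subseteq> Fp +>\<^bsub>F\<^esub> (j \<otimes>\<^bsub>F\<^esub> t) \<and>
          real (card (A' j)) \<le> c * max (real p powr (1/2)) (real n powr (2560/6419))) \<longrightarrow>
       L \<subseteq> lines F \<longrightarrow> card L = n \<longrightarrow>
       real (incidences P L) \<le> C * real n powr (3/2 - 1/12838))"
proof -
  \<comment> \<open>Below this threshold for \<open>b\<close> the trivial bound
    \<open>n^2 = b^256760\<close> is absorbed in \<open>C\<close>. Above it the graph lines
    contribute at most \<open>2 b^192560\<close> and the vertical lines at most
    \<open>n <= b^192560\<close>, which explains the 3.\<close>
  define B where "B = max (2 ^ 50) c"
  define C where "C = B ^ 256760 + 3"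
  have B1: "B \<ge> 1" by (simp add: B_def)
  have C3: "C \<ge> 3" using B1 by (simp add: C_def)
  show ?thesis
  proof (intro exI[of _ C] conjI allI impI)
    show "C > 0" using C3 by simp
    fix p :: nat and F :: "'a ring" and Fp t and n :: nat and P A J A' L
    assume p: "prime p" and "field F" and o: "order F = p\<^sup>2" and K: "subfield Fp F" "card Fp = p"
      and t: "defining_element F Fp t" and P: "P \<subseteq> carrier F \<times> carrier F" "card P = n"
      and A: "A = {x. \<exists>y. (x, y) \<in> P}" and cA: "real (card A) \<le> c * real p"
      and J: "J \<subseteq> Fp" "real (card J) \<le> c * max (real p powr (1/2)) (real n powr (2560/6419))"
      and AJ: "A = (\<Union>j\<in>J. A' j)"
      and A': "\<forall>j\<in>J. A' j \<subseteq> Fp +>\<^bsub>F\<^esub> (j \<otimes>\<^bsub>F\<^esub> t) \<and>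
          real (card (A' j)) \<le> c * max (real p powr (1/2)) (real n powr (2560/6419))"
      and L: "L \<subseteq> lines F" "card L = n"
    have p1: "p > 1" using p prime_gt_1_nat by blast
    have "finite (carrier F)"
      using o p1 unfolding order_def by (metis card.infinite power_eq_0_iff not_one_less_zero)
    then interpret finite_field F
      using \<open>field F\<close> by (simp add: finite_field_def finite_field_axioms_def)
    have finP: "finite P" using P finite_carrier finite_subset by blast
    have "lines F \<subseteq> Pow (carrier F \<times> carrier F)" by (auto simp: lines_def)
    then have finL: "finite L" using L finite_carrier by (meson finite_Pow_iff finite_SigmaI finite_subset)
    have inc: "real (incidences P L) = edges (\<in>) P L"
      unfolding incidences_def edges_card[OF finP finL] ..
    define b where "b = real n powr (1 / 128380)"
    show "real (incidences P L) \<le> C * real n powr (3/2 - 1/12838)"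
    proof (cases "n = 0")
      \<comment> \<open>Zero \<open>powr\<close> any exponent is zero, so the count itself has to
        vanish; \<open>P\<close> is empty because it is finite of cardinality zero.\<close>
      case True
      then have "P = {}" using P finP by simp
      then show ?thesis by (simp add: incidences_def True)
    next
      case False
      then have n1: "real n \<ge> 1" by simp
      have b0: "b > 0" using False by (simp add: b_def)
      have bp: "b ^ i = real n powr (real i / 128380)" for i
        using b0 by (simp add: b_def powr_powr flip: powr_realpow)
      have nb: "real n = b ^ 128380" using n1 by (simp add: bp)
      have nb1: "real n powr (2560/6419) = b ^ 51200" by (simp add: bp)
      have nb2: "real n powr (3/2 - 1/12838) = b ^ 192560" by (simp add: bp)
      show ?thesis
      proof (cases "b \<le> B")
        case True
        have "edges (\<in>) P L \<le> real n * real n" using edges_le[OF finL] P L by metis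
        also have "\<dots> = b ^ 256760" unfolding nb by (simp flip: power_add)
        also have "\<dots> \<le> B ^ 256760" using True b0 by (intro power_mono) auto
        also have "\<dots> \<le> C * 1" by (simp add: C_def)
        also have "\<dots> \<le> C * real n powr (3/2 - 1/12838)"
          using n1 C3 by (intro mult_left_mono ge_one_powr_ge_zero) auto
        finally show ?thesis unfolding inc .
      next
        case False
        then have b: "b \<ge> 2 ^ 50" "c \<le> b" by (auto simp: B_def)
        have b1: "b \<ge> 1" using False B1 by simp
        \<comment> \<open>The non-vertical lines. A point lies on at most one vertical line, so the
          rest contributes at most \<open>n\<close> incidences.\<close>
        define G where "G = {l \<in> L. \<exists>m\<in>carrier F. \<exists>d\<in>carrier F. l = graph_line m d}"
        have tK: "t \<in> carrier F" "t \<notin> Fp"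
        proof -
          show tc: "t \<in> carrier F" using t by (simp add: defining_element_def)
          have Kc: "Fp \<subseteq> carrier F" using subfieldE(3)[OF K(1)] .
          show "t \<notin> Fp"
          proof
            assume "t \<in> Fp"
            then have "generate_field F (insert t Fp) \<subseteq> Fp"
              by (intro generate_field_min_subfield1[OF _ K(1)]) (use tc Kc in auto)
            then have "carrier F = Fp" using t Kc by (auto simp: defining_element_def)
            then show False using K o p1 by (simp add: order_def power2_eq_square)
          qed
        qed
        have sq: "real p powr (1/2) = sqrt (real p)" by (simp add: powr_half_sqrt)
        have Af: "A = fst ` P" unfolding A by force
        have "edges (\<in>) P G < 2 * b ^ 192560"
        proof (rule few_incidences[OF p o K tK P nb, of c J A'])
          show "finite G" "card G \<le> n" using finL L by (auto simp: G_def intro: card_mono)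
          show "l \<in> lines F \<and> (\<exists>m\<in>carrier F. \<exists>b\<in>carrier F. l = graph_line m b)" if "l \<in> G" for l
            using that L by (auto simp: G_def)
          show "fst ` P = (\<Union>j\<in>J. A' j)" using Af AJ by simp
          show "real (card (fst ` P)) \<le> c * real p" using cA Af by simp
        qed (use J A' assms b in \<open>simp_all only: sq nb1\<close>)
        moreover have "edges (\<in>) P (L - G) \<le> real n"
          unfolding P(2)[symmetric]
        proof (rule vertical_incidences[OF finP])
          show "finite (L - G)" using finL by simp
          show "\<exists>c. l = {c} \<times> carrier F" if "l \<in> L - G" for l
          proof -
            have "l \<in> lines F" using that L by blast
            then show ?thesis by (cases rule: line_cases) (use that in \<open>auto simp: G_def\<close>)
          qed
        qed
        moreover have "edges (\<in>) P L = edges (\<in>) P G + edges (\<in>) P (L - G)"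
        proof -
          have "real (card {l \<in> L. q \<in> l}) = real (card {l \<in> G. q \<in> l}) + real (card {l \<in> L - G. q \<in> l})" for q
          proof -
            have GL: "G \<subseteq> L" by (auto simp: G_def)
            then have "{l \<in> L. q \<in> l} = {l \<in> G. q \<in> l} \<union> {l \<in> L - G. q \<in> l}" by blast
            moreover have "{l \<in> G. q \<in> l} \<inter> {l \<in> L - G. q \<in> l} = {}" by blast
            moreover have "finite {l \<in> G. q \<in> l}" "finite {l \<in> L - G. q \<in> l}"
              using finL finite_subset[OF GL finL] by simp_all
            ultimately show ?thesis by (simp add: card_Un_disjoint)
          qed
          then show ?thesis by (simp add: edges_def sum.distrib)
        qed
        moreover have "real n \<le> b ^ 192560" unfolding nb using b1 by (intro power_increasing) auto
        ultimately have "edges (\<in>) P L \<le> 3 * b ^ 192560" by linarith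
        also have "\<dots> \<le> C * b ^ 192560" using C3 b0 by (intro mult_right_mono) auto
        finally show ?thesis unfolding inc nb2 .
      qed
    qed
  qed
qed

end
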